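(* Let $\kappa_v,\kappa_d,a_v,a_d,\sigma_v,\sigma_d>0$, $\theta_v,\theta_d\ge 0$, and let $V_0,r^d_0>0$ be deterministic. Then there exist Markov times $\tau_0^V$ and $\tau_0^d$ such that the stochastic differential equation $$dV(t)=\kappa_v(a_v-V(t-))\,dt+\theta_v\,d\gamma(t)+\sigma_v\sqrt{V(t-)}\,d\Gamma_2(t),\qquad V(0)=V_0,$$ admits a pathwise unique non-negative strong solution up to $\tau_0^V$, and the stochastic differential equation $$dr^d(t)=\kappa_d(a_d-r^d(t-))\,dt+\theta_d\,d\gamma(t)+\sigma_d\sqrt{r^d(t-)}\,d\Gamma_3(t),\qquad r^d(0)=r^d_0,$$ admits a pathwise unique non-negative strong solution up to $\tau_0^d$.
   Context: Setting. $(\Omega,\mathcal F,\{\mathcal F_t\}_{t\ge0},\mathbf Q)$ is a complete filtered probability space. $\mathbf W=(W_1,W_2,W_3,W_4)$ is a $4$-dimensional Brownian motion whose instantaneous correlation matrix $\Sigma_{\mathbf W}$ is symmetric positive definite with unit diagonal (so each $W_j$ is a standard one-dimensional Brownian motion). $\gamma$ is a Gamma subordinator independent of $\mathbf W$: a pure-jump increasing Lévy process with $\gamma(0)=0$ and Lévy measure $g_\gamma(s)\,ds=\frac{\alpha}{s}e^{-\beta s}1_{(0,+\infty)}(s)\,ds$, where $\alpha,\beta>0$ are fixed. $\Gamma_j(t)=W_j(\gamma(t))$, $j=1,\dots,4$; the paths of $\Gamma_j$ are a.s. of bounded variation. $f(t-)$ denotes the left limit of $f$ at $t$. A Markov time is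 a stopping time. Consider either the equation $dV(t)=\kappa_v(a_v-V(t-))\,dt+\theta_v\,d\gamma(t)+\sigma_v\sqrt{V(t-)}\,d\Gamma_2(t)$, $V(0)=V_0$, whose driving processes are $(\gamma,\Gamma_2)$, or the equation $dr^d(t)=\kappa_d(a_d-r^d(t-))\,dt+\theta_d\,d\gamma(t)+\sigma_d\sqrt{r^d(t-)}\,d\Gamma_3(t)$, $r^d(0)=r^d_0$, whose driving processes are $(\gamma,\Gamma_3)$. A strong solution of one of these two equations up to a Markov time $\tau$ (with $\mathbf Q(\tau>0)=1$) is a càdlàg process defined on $[0,\tau)$, adapted to the usual augmentation of the filtration generated by the driving processes of that equation, satisfying the integral form of the equation for all $t<\tau$ almost surely. Non-negative means that the process is $\ge 0$ on $[0,\tau)$. Pathwise unique means that any other strong solution of the same equation (same initial datum, same driving processes) up to a Markov time $\widetilde\tau$ with $\mathbf Q(\widetilde\tau>0)=1$ coincides with it almost surely on $[0,\tau\wedge\widetilde\tau)$. *)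

theory Defs
  imports "HOL-Probability.Probability"
begin

text \<open>
  A process is a function \<open>X :: real \<Rightarrow> 'a \<Rightarrow> 'b\<close> of which only the values at times \<open>t \<ge> 0\<close> matter.
\<close>

section \<open>Paths\<close>

text \<open>The left limit \<open>f(t-)\<close>; unspecified where the limit does not exist.\<close>

definition left_lim :: "(real \<Rightarrow> real) \<Rightarrow> real \<Rightarrow> real" where
  "left_lim f t = Lim (at_left t) f"

definition jump :: "(real \<Rightarrow> real) \<Rightarrow> real \<Rightarrow> real" where
  "jump f t = f t - left_lim f t"

definition cadlag_until :: "ennreal \<Rightarrow> (real \<Rightarrow> real) \<Rightarrow> bool" where
  "cadlag_until T f \<longleftrightarrow>
     (\<forall>t\<ge>0. ennreal t < T \<longrightarrow>
        continuous (at_right t) f \<and> (0 < t \<longrightarrow> (\<exists>l. (f \<longlongrightarrow> l) (at_left t))))"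

definition total_variation :: "(real \<Rightarrow> real) \<Rightarrow> real \<Rightarrow> real" where
  "total_variation f t =
     (SUP ts \<in> {ts. sorted ts \<and> set ts \<subseteq> {0..t}}.
        \<Sum>i<length ts - 1. \<bar>f (ts ! Suc i) - f (ts ! i)\<bar>)"

text \<open>
  The Jordan decomposition \<open>f t - f 0 = pos_variation f t - neg_variation f t\<close> on \<open>[0, \<infinity>)\<close>,
  continued by \<open>0\<close> to negative times.  For \<open>f\<close> right-continuous and of bounded variation on
  compact intervals, both parts are nondecreasing and right-continuous, as required by
  \<^const>\<open>interval_measure\<close>.
\<close>

definition pos_variation :: "(real \<Rightarrow> real) \<Rightarrow> real \<Rightarrow> real" where
  "pos_variation f t =
     (if t < 0 then 0 else (total_variation f t + (f t - f 0)) / 2)"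

definition neg_variation :: "(real \<Rightarrow> real) \<Rightarrow> real \<Rightarrow> real" where
  "neg_variation f t =
     (if t < 0 then 0 else (total_variation f t - (f t - f 0)) / 2)"

text \<open>The pathwise Lebesgue--Stieltjes integral of \<open>h\<close> with respect to \<open>f\<close> over \<open>(0, t]\<close>.\<close>

definition stieltjes_integral :: "(real \<Rightarrow> real) \<Rightarrow> (real \<Rightarrow> real) \<Rightarrow> real \<Rightarrow> real" where
  "stieltjes_integral h f t =
     (LINT s:{0<..t}|interval_measure (pos_variation f). h s) -
     (LINT s:{0<..t}|interval_measure (neg_variation f). h s)"

section \<open>Filtrations\<close>

text \<open>
  Filtrations are indexed by \<^typ>\<open>ennreal\<close> so that stopping times in the sense of
  \<^const>\<open>stopping_time\<close> may be infinite; the \<open>\<sigma>\<close>-algebra at index \<open>\<infinity>\<close> imposes no condition.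
\<close>

definition complete_filtered_prob_space :: "'a measure \<Rightarrow> (ennreal \<Rightarrow> 'a measure) \<Rightarrow> bool" where
  "complete_filtered_prob_space M F \<longleftrightarrow>
     prob_space M \<and> complete_measure M \<and>
     filtration (space M) F \<and> (\<forall>t. subalgebra M (F t)) \<and> null_sets M \<subseteq> sets (F 0)"

definition adapted :: "(ennreal \<Rightarrow> 'a measure) \<Rightarrow> (real \<Rightarrow> 'a \<Rightarrow> 'b::topological_space) \<Rightarrow> bool" where
  "adapted F X \<longleftrightarrow> (\<forall>t\<ge>0. X t \<in> borel_measurable (F (ennreal t)))"

definition generated_by ::
  "'a measure \<Rightarrow> real set \<Rightarrow> (real \<Rightarrow> 'a \<Rightarrow> 'b::topological_space) \<Rightarrow> 'a set set" where
  "generated_by M T X =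
     sigma_sets (space M) {X s -` B \<inter> space M | s B. s \<in> T \<and> B \<in> sets borel}"

text \<open>The filtration generated by \<open>X\<close>, made complete and right-continuous.\<close>

definition usual_augmentation ::
  "'a measure \<Rightarrow> (real \<Rightarrow> 'a \<Rightarrow> 'b::topological_space) \<Rightarrow> real \<Rightarrow> 'a measure" where
  "usual_augmentation M X t =
     sigma (space M) (\<Inter>u\<in>{t<..}. sigma_sets (space M) (generated_by M {0..u} X \<union> null_sets M))"

section \<open>Driving processes\<close>

definition independent_increments ::
  "'a measure \<Rightarrow> (real \<Rightarrow> 'a \<Rightarrow> 'b::euclidean_space) \<Rightarrow> bool" where
  "independent_increments M X \<longleftrightarrow>
     (\<forall>n (ts :: nat \<Rightarrow> real). 0 \<le> ts 0 \<longrightarrow> (\<forall>i<n. ts i \<le> ts (Suc i)) \<longrightarrow>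
        prob_space.indep_vars M (\<lambda>_. borel) (\<lambda>i \<omega>. X (ts (Suc i)) \<omega> - X (ts i) \<omega>) {..<n})"

text \<open>
  The increments over \<open>[s, t]\<close> are centred Gaussian vectors with covariance matrix
  \<open>(t - s) \<Sigma>\<close>: every nonzero linear functional of them has the corresponding one-dimensional
  normal distribution.
\<close>

definition brownian_motion ::
  "'a measure \<Rightarrow> real^'n^'n \<Rightarrow> (real \<Rightarrow> 'a \<Rightarrow> real^'n) \<Rightarrow> bool" where
  "brownian_motion M \<Sigma> W \<longleftrightarrow>
     (\<forall>t\<ge>0. W t \<in> borel_measurable M) \<and>
     (AE \<omega> in M. W 0 \<omega> = 0) \<and>
     (AE \<omega> in M. continuous_on {0..} (\<lambda>t. W t \<omega>)) \<and>
     independent_increments M W \<and>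
     (\<forall>s t u. 0 \<le> s \<longrightarrow> s < t \<longrightarrow> u \<noteq> 0 \<longrightarrow>
        distributed M lborel (\<lambda>\<omega>. u \<bullet> (W t \<omega> - W s \<omega>))
          (\<lambda>x. ennreal (normal_density 0 (sqrt ((t - s) * (u \<bullet> (\<Sigma> *v u)))) x)))"

definition levy_process :: "'a measure \<Rightarrow> (real \<Rightarrow> 'a \<Rightarrow> real) \<Rightarrow> bool" where
  "levy_process M X \<longleftrightarrow>
     (\<forall>t\<ge>0. X t \<in> borel_measurable M) \<and>
     (AE \<omega> in M. X 0 \<omega> = 0) \<and>
     (AE \<omega> in M. cadlag_until \<infinity> (\<lambda>t. X t \<omega>)) \<and>
     independent_increments M X \<and>
     (\<forall>s h. 0 \<le> s \<longrightarrow> 0 \<le> h \<longrightarrow>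
        distr M borel (\<lambda>\<omega>. X (s + h) \<omega> - X s \<omega>) = distr M borel (\<lambda>\<omega>. X h \<omega> - X 0 \<omega>))"

text \<open>The expected number of jumps in \<open>A\<close> per unit of time.\<close>

definition levy_measure :: "'a measure \<Rightarrow> (real \<Rightarrow> 'a \<Rightarrow> real) \<Rightarrow> real set \<Rightarrow> ennreal" where
  "levy_measure M X A =
     (\<integral>\<^sup>+\<omega>. emeasure (count_space UNIV)
        {t\<in>{0<..1}. jump (\<lambda>s. X s \<omega>) t \<noteq> 0 \<and> jump (\<lambda>s. X s \<omega>) t \<in> A} \<partial>M)"

definition gamma_subordinator ::
  "'a measure \<Rightarrow> real \<Rightarrow> real \<Rightarrow> (real \<Rightarrow> 'a \<Rightarrow> real) \<Rightarrow> bool" where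
  "gamma_subordinator M \<alpha> \<beta> \<gamma> \<longleftrightarrow>
     levy_process M \<gamma> \<and>
     (AE \<omega> in M. mono_on {0..} (\<lambda>t. \<gamma> t \<omega>)) \<and>
     (AE \<omega> in M. \<forall>t\<ge>0. (jump (\<lambda>s. \<gamma> s \<omega>) has_sum \<gamma> t \<omega>) {0<..t}) \<and>
     (\<forall>A\<in>sets borel. levy_measure M \<gamma> A =
        emeasure (density lborel (\<lambda>s. ennreal (\<alpha> / s * exp (- \<beta> * s) * indicator {0<..} s))) A)"

definition time_changed ::
  "(real \<Rightarrow> 'a \<Rightarrow> real^'n) \<Rightarrow> (real \<Rightarrow> 'a \<Rightarrow> real) \<Rightarrow> 'n \<Rightarrow> real \<Rightarrow> 'a \<Rightarrow> real" where
  "time_changed W \<gamma> j t \<omega> = W (\<gamma> t \<omega>) \<omega> $ j"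

section \<open>The equation \<open>dX = \<kappa>(a - X-) dt + \<theta> d\<gamma> + \<sigma> sqrt(X-) d\<Gamma>\<close>\<close>

text \<open>
  Integral form along a single path \<open>x\<close> of the solution and paths \<open>g\<close>, \<open>G\<close> of the drivers.
  The condition \<open>0 \<le> x(t-)\<close> says that the square root is meaningful; it has to be stated because
  \<^const>\<open>sqrt\<close> is total (\<open>sqrt (- y) = - sqrt y\<close>).
\<close>

definition solves_until ::
  "real \<Rightarrow> real \<Rightarrow> real \<Rightarrow> real \<Rightarrow> real \<Rightarrow> (real \<Rightarrow> real) \<Rightarrow> (real \<Rightarrow> real) \<Rightarrow>
   ennreal \<Rightarrow> (real \<Rightarrow> real) \<Rightarrow> bool" where
  "solves_until \<kappa> a \<theta> \<sigma> x0 g G T x \<longleftrightarrow>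
     (\<forall>t\<ge>0. ennreal t < T \<longrightarrow>
        (0 < t \<longrightarrow> 0 \<le> left_lim x t) \<and>
        x t = x0 + (LBINT s:{0..t}. \<kappa> * (a - left_lim x s))
              + \<theta> * (g t - g 0)
              + \<sigma> * stieltjes_integral (\<lambda>s. sqrt (left_lim x s)) G t)"

text \<open>
  A process on the stochastic interval \<open>[0, \<tau>)\<close> is represented by a total function whose values at
  times \<open>t \<ge> \<tau>\<close> are irrelevant; accordingly, \<open>X t\<close> is measurable as a function on
  \<open>{t < \<tau>}\<close> with the trace of the \<open>\<sigma>\<close>-algebra at time \<open>t\<close>.
\<close>

definition strong_solution ::
  "'a measure \<Rightarrow> (ennreal \<Rightarrow> 'a measure) \<Rightarrow> real \<Rightarrow> real \<Rightarrow> real \<Rightarrow> real \<Rightarrow> real \<Rightarrow>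
   (real \<Rightarrow> 'a \<Rightarrow> real) \<Rightarrow> (real \<Rightarrow> 'a \<Rightarrow> real) \<Rightarrow> ('a \<Rightarrow> ennreal) \<Rightarrow> (real \<Rightarrow> 'a \<Rightarrow> real) \<Rightarrow> bool"
where
  "strong_solution M F \<kappa> a \<theta> \<sigma> x0 \<gamma> \<Gamma> \<tau> X \<longleftrightarrow>
     stopping_time F \<tau> \<and> (AE \<omega> in M. 0 < \<tau> \<omega>) \<and>
     (\<forall>\<omega>\<in>space M. cadlag_until (\<tau> \<omega>) (\<lambda>t. X t \<omega>)) \<and>
     (\<forall>t\<ge>0. X t \<in> borel_measurable
        (restrict_space (usual_augmentation M (\<lambda>s \<omega>. (\<gamma> s \<omega>, \<Gamma> s \<omega>)) t)
           {\<omega>\<in>space M. ennreal t < \<tau> \<omega>})) \<and>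
     (AE \<omega> in M. solves_until \<kappa> a \<theta> \<sigma> x0 (\<lambda>t. \<gamma> t \<omega>) (\<lambda>t. \<Gamma> t \<omega>) (\<tau> \<omega>) (\<lambda>t. X t \<omega>))"

definition nonnegative_until :: "'a measure \<Rightarrow> ('a \<Rightarrow> ennreal) \<Rightarrow> (real \<Rightarrow> 'a \<Rightarrow> real) \<Rightarrow> bool" where
  "nonnegative_until M \<tau> X \<longleftrightarrow>
     (\<forall>\<omega>\<in>space M. \<forall>t\<ge>0. ennreal t < \<tau> \<omega> \<longrightarrow> 0 \<le> X t \<omega>)"

definition pathwise_unique ::
  "'a measure \<Rightarrow> (ennreal \<Rightarrow> 'a measure) \<Rightarrow> real \<Rightarrow> real \<Rightarrow> real \<Rightarrow> real \<Rightarrow> real \<Rightarrow>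
   (real \<Rightarrow> 'a \<Rightarrow> real) \<Rightarrow> (real \<Rightarrow> 'a \<Rightarrow> real) \<Rightarrow> ('a \<Rightarrow> ennreal) \<Rightarrow> (real \<Rightarrow> 'a \<Rightarrow> real) \<Rightarrow> bool"
where
  "pathwise_unique M F \<kappa> a \<theta> \<sigma> x0 \<gamma> \<Gamma> \<tau> X \<longleftrightarrow>
     (\<forall>\<tau>' X'. strong_solution M F \<kappa> a \<theta> \<sigma> x0 \<gamma> \<Gamma> \<tau>' X' \<longrightarrow>
        (AE \<omega> in M. \<forall>t\<ge>0. ennreal t < min (\<tau> \<omega>) (\<tau>' \<omega>) \<longrightarrow> X' t \<omega> = X t \<omega>))"

end

theory Submission
  imports Defs
begin

text \<open>
  Paths of a Gamma subordinator are sums of their jumps, and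
  \<open>E |W(\<gamma>(t)) - W(\<gamma>(s))| \<le> E sqrt (\<gamma>(t) - \<gamma>(s))\<close> by independence.  The expected sum of the
  square roots of the jumps is the integral of \<open>sqrt\<close> against the Levy measure, which is finite; so
  the expected dyadic variation of \<open>\<Gamma>\<close> stays bounded and \<open>\<Gamma>\<close> has bounded variation almost surely.

  From there on the equation is solved path by path.  Let the clock be
  \<open>A(t) = t + \<gamma>(t) - \<gamma>(0) + (variation of \<Gamma> on [0, t])\<close>.  Every path \<open>x\<close> in question satisfies
  \<open>|x(t) - x(s)| \<le> K (A(t) - A(s))\<close>, and the square root is Lipschitz on \<open>[x0 / 2, \<infinity>)\<close>.  Until the
  first time \<open>\<tau>\<close> at which \<open>A\<close> reaches a small threshold, Picard iteration is a contraction and does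
  not leave \<open>[x0 / 2, 3 x0 / 2]\<close>.  Since \<open>A\<close> is right-continuous and adapted, \<open>{\<tau> \<le> t}\<close> is the event
  \<open>{A(t) \<ge> threshold}\<close>, so \<open>\<tau>\<close> is a stopping time although the filtration need not be
  right-continuous.  Uniqueness needs a lower bound for one of the two solutions only, because
  \<open>|sqrt x - sqrt y| \<le> |x - y| / sqrt m\<close> for \<open>x \<ge> m\<close> and \<open>y \<ge> 0\<close>.
\<close>

section \<open>Paths of bounded variation\<close>

text \<open>Solving path by path leaves open whether the solution is adapted: it must be a
  measurable function of the drivers up to time t, and so must the clock that defines the stopping
  time. Total variation is a supremum over uncountably many partitions and a left limit is a limit
  over uncountably many times, so both are rewritten as limits along dyadic grids, and so are the
  Stieltjes integrals and with them the Picard iterates. The paths are only cadlag, hence the side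
  matters: points of a partition are rounded up (right-continuity), points at which an integrand is
  evaluated are rounded strictly down (left limits). Two filtrations occur, \<open>F\<close> for the
  stopping time and the usual augmentation for the solution; both contain the null sets, so the set
  of bad paths can be removed at every time.

  Grids also carry the moment estimate. Independence of W and \<gamma> says nothing directly about W
  at a random time; \<gamma> is first rounded to countably many values, the sum over these values
  factors, and Fatou's lemma with the continuity of W removes the rounding.\<close>

definition variation_sum :: "('a \<Rightarrow> real) \<Rightarrow> 'a list \<Rightarrow> real" where
  "variation_sum f ts = (\<Sum>i<length ts - 1. \<bar>f (ts ! Suc i) - f (ts ! i)\<bar>)"

lemma variation_sum_simps [simp]:
  "variation_sum f [] = 0"
  "variation_sum f [x] = 0"
  "variation_sum f (x # y # zs) = \<bar>f y - f x\<bar> + variation_sum f (y # zs)"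
  by (simp_all add: variation_sum_def sum.lessThan_Suc_shift del: sum.lessThan_Suc)

lemma variation_sum_nonneg: "0 \<le> variation_sum f ts"
  by (simp add: variation_sum_def sum_nonneg)

lemma variation_sum_append:
  "variation_sum f (xs @ y # ys) = variation_sum f (xs @ [y]) + variation_sum f (y # ys)"
  by (induction xs rule: induct_list012) auto

text \<open>The triangle inequality at the inserted point; at either end of the list the new point
  only adds a nonnegative term.\<close>

lemma variation_sum_insert: "variation_sum f (xs @ ys) \<le> variation_sum f (xs @ y # ys)"
proof (induction xs rule: induct_list012)
  case 1
  then show ?case by (cases ys) auto
next
  case (2 x)
  then show ?case by (cases ys) auto
qed auto

lemma variation_sum_map: "variation_sum f (map k ts) = variation_sum (\<lambda>x. f (k x)) ts"
  unfolding variation_sum_def by (intro sum.cong) auto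

text \<open>Each increment telescopes into unit steps, and the ranges of these steps do not overlap
  because the list is sorted.\<close>

lemma variation_sum_nat_le:
  fixes ks :: "nat list"
  assumes "sorted ks" "\<And>k. k \<in> set ks \<Longrightarrow> k \<le> n"
  shows "variation_sum h ks \<le> (\<Sum>i<n. \<bar>h (Suc i) - h i\<bar>)"
proof -
  \<comment> \<open>The induction needs the sharper bound that only counts unit steps from the head
    of the list on; for the empty list this range is empty.\<close>
  have "variation_sum h ks \<le> (\<Sum>i\<in>{(case ks of [] \<Rightarrow> n | k # _ \<Rightarrow> k)..<n}. \<bar>h (Suc i) - h i\<bar>)"
    using assms
  proof (induction ks rule: induct_list012)
    case (3 x y zs)
    have "\<bar>h y - h x\<bar> = \<bar>\<Sum>i\<in>{x..<y}. h (Suc i) - h i\<bar>"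
      using 3 by (simp add: sum_Suc_diff')
    also have "\<dots> \<le> (\<Sum>i\<in>{x..<y}. \<bar>h (Suc i) - h i\<bar>)"
      by (rule sum_abs)
    finally have "\<bar>h y - h x\<bar> + variation_sum h (y # zs)
        \<le> (\<Sum>i\<in>{x..<y}. \<bar>h (Suc i) - h i\<bar>) + (\<Sum>i\<in>{y..<n}. \<bar>h (Suc i) - h i\<bar>)"
      using 3 by auto
    also have "\<dots> = (\<Sum>i\<in>{x..<n}. \<bar>h (Suc i) - h i\<bar>)"
      using 3 by (intro sum.atLeastLessThan_concat) auto
    finally show ?case by simp
  qed (auto intro!: sum_nonneg)
  also have "\<dots> \<le> (\<Sum>i<n. \<bar>h (Suc i) - h i\<bar>)"
    by (intro sum_mono2) auto
  finally show ?thesis .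
qed

text \<open>Countably many partitions replace the uncountable supremum in
  \<open>total_variation\<close>; that is what makes the variation measurable in \<omega>.\<close>

definition dyadic_sum :: "(real \<Rightarrow> real) \<Rightarrow> real \<Rightarrow> nat \<Rightarrow> real" where
  "dyadic_sum f t n = (\<Sum>i<2^n. \<bar>f (t * real (Suc i) / 2^n) - f (t * real i / 2^n)\<bar>)"

text \<open>Rounding goes up, since the paths are continuous from the right only.\<close>

lemma dyadic_above_tendsto:
  fixes s t :: real
  assumes "0 \<le> s" "s \<le> t" "0 < t"
  shows "(\<lambda>n. t * real (nat \<lceil>2^n * (s / t)\<rceil>) / 2^n) \<longlonglongrightarrow> s"
    and "s \<le> t * real (nat \<lceil>2^n * (s / t)\<rceil>) / 2^n"
    and "nat \<lceil>2^n * (s / t)\<rceil> \<le> 2^n"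
proof -
  have nn: "0 \<le> 2^n * (s / t)" for n :: nat
    using assms by simp
  have r: "real (nat \<lceil>2^n * (s / t)\<rceil>) = of_int \<lceil>2^n * (s / t)\<rceil>" for n
    using nn[of n] by (simp add: of_nat_nat)
  have lo: "s \<le> t * real (nat \<lceil>2^n * (s / t)\<rceil>) / 2^n" for n
  proof -
    have "2^n * (s / t) \<le> real (nat \<lceil>2^n * (s / t)\<rceil>)"
      unfolding r by (rule le_of_int_ceiling)
    then have "t * (2^n * (s / t)) \<le> t * real (nat \<lceil>2^n * (s / t)\<rceil>)"
      using assms by (intro mult_left_mono) auto
    then show ?thesis using assms by (simp add: le_divide_eq mult.commute)
  qed
  have hi: "t * real (nat \<lceil>2^n * (s / t)\<rceil>) / 2^n \<le> s + t * (1/2)^n" for n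
  proof -
    have "real (nat \<lceil>2^n * (s / t)\<rceil>) \<le> 2^n * (s / t) + 1"
      unfolding r by linarith
    then have "t * real (nat \<lceil>2^n * (s / t)\<rceil>) \<le> t * (2^n * (s / t) + 1)"
      using assms by (intro mult_left_mono) auto
    also have "\<dots> = s * 2^n + t"
      using assms by (simp add: field_simps)
    finally have "t * real (nat \<lceil>2^n * (s / t)\<rceil>) / 2^n \<le> (s * 2^n + t) / 2^n"
      by (intro divide_right_mono) auto
    also have "\<dots> = s + t * (1/2)^n"
      by (simp add: add_divide_distrib power_one_over)
    finally show ?thesis .
  qed
  have lim: "(\<lambda>n. s + t * (1/2)^n) \<longlonglongrightarrow> s + t * 0"
    by (intro tendsto_intros LIMSEQ_realpow_zero) auto
  then have lim': "(\<lambda>n. s + t * (1/2)^n) \<longlonglongrightarrow> s"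
    by simp
  show "(\<lambda>n. t * real (nat \<lceil>2^n * (s / t)\<rceil>) / 2^n) \<longlonglongrightarrow> s"
    by (rule tendsto_sandwich[OF always_eventually always_eventually tendsto_const lim'])
       (intro allI lo hi)+
  show "s \<le> t * real (nat \<lceil>2^n * (s / t)\<rceil>) / 2^n"
    by (rule lo)
  have "2^n * (s / t) \<le> 2^n"
    using assms by (simp add: field_simps)
  then show "nat \<lceil>2^n * (s / t)\<rceil> \<le> 2^n"
    by (simp add: ceiling_le_iff nat_le_iff)
qed

text \<open>Every point of the list moves up to the next grid point. Rounding is monotone, so the
  moved list is a sorted list of grid indices and \<open>variation_sum_nat_le\<close> bounds its
  sum; right-continuity makes the moved sums converge to the original one.\<close>

lemma variation_sum_approx:
  assumes "sorted ts" "set ts \<subseteq> {0..t}" "0 < t"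
    and rc: "\<And>s. 0 \<le> s \<Longrightarrow> continuous (at_right s) f"
  obtains h where "\<And>n. h n \<le> dyadic_sum f t n" "h \<longlonglongrightarrow> variation_sum f ts"
proof -
  define k where "k n s = nat \<lceil>2^n * (s / t)\<rceil>" for n s
  have mem: "0 \<le> s \<and> s \<le> t" if "s \<in> set ts" for s
    using assms(2) that by auto
  have fk: "(\<lambda>n. f (t * real (k n s) / 2^n)) \<longlonglongrightarrow> f s" if "s \<in> set ts" for s
  proof -
    have s: "0 \<le> s" "s \<le> t" using mem[OF that] by auto
    have "(f \<longlongrightarrow> f s) (at s within {s..})"
      using rc[of s] s by (simp add: continuous_within at_within_Ici_at_right)
    moreover have "(\<lambda>n. t * real (k n s) / 2^n) \<longlonglongrightarrow> s" "\<And>n. s \<le> t * real (k n s) / 2^n"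
      unfolding k_def using dyadic_above_tendsto[OF s \<open>0 < t\<close>] by auto
    ultimately show ?thesis
      using continuous_within_tendsto_compose'[of s "{s..}" f "\<lambda>n. t * real (k n s) / 2^n" sequentially]
      by (auto simp: continuous_within)
  qed
  show thesis
  proof
    fix n
    have "variation_sum (\<lambda>s. f (t * real (k n s) / 2^n)) ts
        = variation_sum (\<lambda>j. f (t * real j / 2^n)) (map (k n) ts)"
      by (simp add: variation_sum_map)
    also have "\<dots> \<le> dyadic_sum f t n"
      unfolding dyadic_sum_def
    proof (rule variation_sum_nat_le)
      have "mono (k n)"
        unfolding k_def using \<open>0 < t\<close>
        by (intro monoI nat_mono ceiling_mono mult_left_mono divide_right_mono) auto
      then show "sorted (map (k n) ts)"
        using assms(1) by (intro sorted_map_mono) (auto simp: mono_on_def mono_def)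
      fix j assume "j \<in> set (map (k n) ts)"
      then show "j \<le> 2^n"
        unfolding k_def using dyadic_above_tendsto(3)[OF _ _ \<open>0 < t\<close>] mem by auto
    qed
    finally show "variation_sum (\<lambda>s. f (t * real (k n s) / 2^n)) ts \<le> dyadic_sum f t n" .
  next
    show "(\<lambda>n. variation_sum (\<lambda>s. f (t * real (k n s) / 2^n)) ts) \<longlonglongrightarrow> variation_sum f ts"
      unfolding variation_sum_def by (intro tendsto_intros fk) auto
  qed
qed

lemma dyadic_sum_eq_variation_sum:
  assumes "0 \<le> t"
  obtains ts where "sorted ts" "set ts \<subseteq> {0..t}" "dyadic_sum f t n = variation_sum f ts"
proof
  let ?ts = "map (\<lambda>i. t * real i / 2^n) [0..<Suc (2^n)]"
  show "sorted ?ts"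
    using assms
    by (intro sorted_map_mono sorted_upt)
       (auto simp: mono_on_def intro!: divide_right_mono mult_left_mono)
  show "set ?ts \<subseteq> {0..t}"
  proof -
    have "t * real i / 2^n \<le> t" if "i \<le> 2^n" for i
    proof -
      have "t * real i \<le> t * 2^n"
        using assms that by (intro mult_left_mono) (auto simp: of_nat_le_iff[symmetric] simp del: of_nat_le_iff)
      then show ?thesis by (simp add: divide_le_eq)
    qed
    then show ?thesis using assms by (auto simp: less_Suc_eq_le)
  qed
  show "dyadic_sum f t n = variation_sum f ?ts"
    unfolding dyadic_sum_def variation_sum_def
    by (intro sum.cong) (auto simp del: upt_Suc simp: nth_upt)
qed

section \<open>Total variation of a right-continuous path\<close>

lemma total_variation_eq:
  "total_variation f t = Sup (variation_sum f ` {ts. sorted ts \<and> set ts \<subseteq> {0..t}})"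
  by (simp add: total_variation_def variation_sum_def[abs_def])

text \<open>Boundedness is assumed for the sums themselves: the real \<open>Sup\<close> in
  \<open>total_variation\<close> carries no information about an unbounded set.\<close>

locale bv_path =
  fixes f :: "real \<Rightarrow> real"
  assumes right_cont: "\<And>t. 0 \<le> t \<Longrightarrow> continuous (at_right t) f"
    and bounded_variation:
      "\<And>t. 0 \<le> t \<Longrightarrow> bdd_above (variation_sum f ` {ts. sorted ts \<and> set ts \<subseteq> {0..t}})"
begin

lemma variation_sum_le_total:
  assumes "sorted ts" "set ts \<subseteq> {0..t}" "0 \<le> t"
  shows "variation_sum f ts \<le> total_variation f t"
  unfolding total_variation_eq using assms bounded_variation by (intro cSUP_upper) auto

lemma total_variation_leI:
  assumes "\<And>ts. sorted ts \<Longrightarrow> set ts \<subseteq> {0..t} \<Longrightarrow> variation_sum f ts \<le> B"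
  shows "total_variation f t \<le> B"
  unfolding total_variation_eq
proof (rule cSUP_least)
  have "[] \<in> {ts. sorted ts \<and> set ts \<subseteq> {0..t}}" by simp
  then show "{ts. sorted ts \<and> set ts \<subseteq> {0..t}} \<noteq> {}" by blast
qed (use assms in auto)

lemma total_variation_0: "total_variation f 0 = 0"
proof (rule antisym)
  show "total_variation f 0 \<le> 0"
  proof (rule total_variation_leI)
    fix ts :: "real list" assume "set ts \<subseteq> {0..0}"
    then have "\<And>i. i < length ts \<Longrightarrow> ts ! i = 0"
      by (metis atLeastAtMost_singleton nth_mem singletonD subsetD)
    then show "variation_sum f ts \<le> 0"
      unfolding variation_sum_def by simp
  qed
  show "0 \<le> total_variation f 0"
    using variation_sum_le_total[of "[]" 0] by simp
qed

text \<open>Any list below t, followed by a list that starts at t, is again a list in [0, u]. This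
  superadditivity gives both the bound on increments and the right-continuity of the
  variation.\<close>

lemma total_variation_tail_le:
  assumes "0 \<le> t" "sorted (t # ts)" "set (t # ts) \<subseteq> {0..u}"
  shows "total_variation f t + variation_sum f (t # ts) \<le> total_variation f u"
proof -
  have "total_variation f t \<le> total_variation f u - variation_sum f (t # ts)"
  proof (rule total_variation_leI)
    fix zs assume zs: "sorted zs" "set zs \<subseteq> {0..t}"
    have "variation_sum f zs + variation_sum f (t # ts) \<le> variation_sum f (zs @ [t]) + variation_sum f (t # ts)"
      using variation_sum_insert[of f zs "[]" t] by simp
    also have "\<dots> = variation_sum f (zs @ t # ts)"
      by (simp add: variation_sum_append[of f zs t ts])
    also have "\<dots> \<le> total_variation f u"
      using assms zs by (intro variation_sum_le_total) (fastforce simp: sorted_append)+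
    finally show "variation_sum f zs \<le> total_variation f u - variation_sum f (t # ts)"
      by simp
  qed
  then show ?thesis by simp
qed

lemma increment_le_total_variation:
  assumes "0 \<le> s" "s \<le> t"
  shows "\<bar>f t - f s\<bar> \<le> total_variation f t - total_variation f s"
  using total_variation_tail_le[of s "[t]" t] assms by simp

lemma total_variation_mono: "0 \<le> s \<Longrightarrow> s \<le> t \<Longrightarrow> total_variation f s \<le> total_variation f t"
  using increment_le_total_variation[of s t] by linarith

text \<open>A nearly optimal list for a longer interval is cut at t, and t and a slightly later s
  are inserted. The head costs at most the variation up to t, the tail at most the variation after
  s, and the link between them is small by right-continuity of \<open>f\<close>; what remains is an
  upper bound for the variation at s.\<close>

lemma right_cont_total_variation:
  assumes "0 \<le> t"
  shows "continuous (at_right t) (total_variation f)"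
proof -
  have "(total_variation f \<longlongrightarrow> total_variation f t) (at_right t)"
  proof (rule tendstoI)
    fix e :: real assume "0 < e"
    define u where "u = t + 1"
    have "total_variation f u - e / 2 < total_variation f u"
      using \<open>0 < e\<close> by simp
    then obtain ts where ts: "sorted ts" "set ts \<subseteq> {0..u}"
      and tsv: "total_variation f u - e / 2 < variation_sum f ts"
      using total_variation_leI[of u "total_variation f u - e/2"] by force
    define xs ys where "xs = filter (\<lambda>s. s \<le> t) ts" and "ys = filter (\<lambda>s. t < s) ts"
    have split: "ts = xs @ ys"
      using ts(1) unfolding xs_def ys_def
    proof (induction ts)
      case (Cons a ts)
      show ?case
      proof (cases "a \<le> t")
        case True
        then show ?thesis using Cons by auto
      next
        case False
        then have "\<forall>s\<in>set ts. t < s" using Cons by auto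
        then have "filter (\<lambda>s. s \<le> t) ts = []" "filter (\<lambda>s. t < s) ts = ts"
          by (auto simp: filter_empty_conv)
        then show ?thesis using False by simp
      qed
    qed simp
    \<comment> \<open>No point of the list lies strictly between t and \<open>v\<close>, so
      \<open>s # ys\<close> stays sorted for every s in that gap.\<close>
    define v where "v = Min (set (u # ys))"
    have "v > t"
      unfolding v_def by (subst Min_gr_iff) (auto simp: ys_def u_def)
    have "(f \<longlongrightarrow> f t) (at_right t)"
      using right_cont[OF assms] by (simp add: continuous_within)
    then have "\<forall>\<^sub>F s in at_right t. dist (f s) (f t) < e / 2"
      using \<open>0 < e\<close> by (intro tendstoD) auto
    moreover have "\<forall>\<^sub>F s in at_right t. s \<in> {t<..<v}"
      using eventually_at_right_real[OF \<open>v > t\<close>] .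
    ultimately show "\<forall>\<^sub>F s in at_right t. dist (total_variation f s) (total_variation f t) < e"
    proof eventually_elim
      case (elim s)
      have sv: "\<forall>y\<in>set ys. s \<le> y" and su: "s \<le> u"
        using elim(2) unfolding v_def by auto
      have "variation_sum f ts \<le> variation_sum f (xs @ t # s # ys)"
        unfolding split using variation_sum_insert[of f xs ys s] variation_sum_insert[of f xs "s # ys" t]
        by linarith
      also have "\<dots> = variation_sum f (xs @ [t]) + \<bar>f s - f t\<bar> + variation_sum f (s # ys)"
        by (simp add: variation_sum_append[of f xs t "s # ys"])
      also have "variation_sum f (xs @ [t]) \<le> total_variation f t"
        using assms ts by (intro variation_sum_le_total) (auto simp: xs_def sorted_append intro: sorted_filter[of id, simplified])
      also have "variation_sum f (s # ys) \<le> total_variation f u - total_variation f s"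
      proof -
        have "sorted ys" "set ys \<subseteq> {0..u}"
          using ts by (auto simp: ys_def intro: sorted_filter[of id, simplified])
        then show ?thesis
          using total_variation_tail_le[of s ys u] assms su sv elim(2) by auto
      qed
      finally have "total_variation f s < total_variation f t + e"
        using tsv elim(1) by (simp add: dist_real_def)
      moreover have "total_variation f t \<le> total_variation f s"
        using elim(2) assms by (intro total_variation_mono) auto
      ultimately show ?case by (simp add: dist_real_def)
    qed
  qed
  then show ?thesis by (simp add: continuous_within)
qed

text \<open>The dyadic sums never exceed the supremum, and by \<open>variation_sum_approx\<close>
  they eventually come close to the sum of a nearly optimal list.\<close>

lemma dyadic_sum_tendsto_total_variation:
  assumes "0 < t"
  shows "dyadic_sum f t \<longlonglongrightarrow> total_variation f t"
proof (rule LIMSEQ_I)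
  fix e :: real assume "0 < e"
  then obtain ts where ts: "sorted ts" "set ts \<subseteq> {0..t}"
    and tsv: "total_variation f t - e < variation_sum f ts"
    using total_variation_leI[of t "total_variation f t - e"] by force
  from variation_sum_approx[OF ts assms right_cont]
  obtain h where h: "\<And>n. h n \<le> dyadic_sum f t n" "h \<longlonglongrightarrow> variation_sum f ts"
    by blast
  have "\<forall>\<^sub>F n in sequentially. total_variation f t - e < h n"
    using h(2) tsv by (rule order_tendstoD)
  then obtain N where N: "\<And>n. n \<ge> N \<Longrightarrow> total_variation f t - e < h n"
    by (auto simp: eventually_sequentially)
  have "dyadic_sum f t n \<le> total_variation f t" for n
    using variation_sum_le_total assms dyadic_sum_eq_variation_sum[of t f n] by (metis less_imp_le)
  then show "\<exists>N. \<forall>n\<ge>N. norm (dyadic_sum f t n - total_variation f t) < e"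
    using N h(1) by (intro exI[of _ N]) (smt (verit) real_norm_def)
qed

end

text \<open>A finite liminf is what Fatou's lemma can deliver. It suffices because the lower
  approximants of \<open>variation_sum_approx\<close> converge; integer horizons suffice because
  every t lies below one of them.\<close>

lemma bv_pathI:
  assumes rc: "\<And>t. 0 \<le> t \<Longrightarrow> continuous (at_right t) f"
    and bd: "\<And>m::nat. liminf (\<lambda>n. ennreal (dyadic_sum f (Suc m) n)) < \<infinity>"
  shows "bv_path f"
proof
  fix t :: real assume "0 \<le> t"
  obtain m :: nat where m: "t \<le> Suc m"
    using real_arch_simple[of t] by (metis le_SucI of_nat_le_iff order_trans le_refl order.refl lessI less_imp_le)
  define B where "B = enn2real (liminf (\<lambda>n. ennreal (dyadic_sum f (Suc m) n)))"
  have B: "liminf (\<lambda>n. ennreal (dyadic_sum f (Suc m) n)) = ennreal B"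
    unfolding B_def using bd[of m] by simp
  show "bdd_above (variation_sum f ` {ts. sorted ts \<and> set ts \<subseteq> {0..t}})"
  proof (rule bdd_aboveI2)
    fix ts assume "ts \<in> {ts. sorted ts \<and> set ts \<subseteq> {0..t}}"
    then have ts: "sorted ts" "set ts \<subseteq> {0..real (Suc m)}" using m by auto
    from variation_sum_approx[OF ts _ rc]
    obtain h where h: "\<And>n. h n \<le> dyadic_sum f (Suc m) n" "h \<longlonglongrightarrow> variation_sum f ts"
      by auto
    have "(\<lambda>n. ennreal (h n)) \<longlonglongrightarrow> ennreal (variation_sum f ts)"
      by (intro tendsto_ennrealI h)
    then have "ennreal (variation_sum f ts) = liminf (\<lambda>n. ennreal (h n))"
      by (intro lim_imp_Liminf[symmetric]) auto
    also have "\<dots> \<le> liminf (\<lambda>n. ennreal (dyadic_sum f (Suc m) n))"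
      using h(1) by (intro Liminf_mono always_eventually allI ennreal_leI)
    finally show "variation_sum f ts \<le> B"
      unfolding B using variation_sum_nonneg[of f ts] by (simp add: B_def)
  qed
qed (rule rc)

section \<open>Integrals over half-open intervals and the Jordan parts\<close>

lemma set_integrable_Ioc_bounded:
  fixes u :: "real \<Rightarrow> real"
  assumes [measurable_cong]: "sets \<mu> = sets borel"
    and fin: "emeasure \<mu> {s<..t} < \<infinity>"
    and u: "u \<in> borel_measurable (restrict_space borel {s<..t})"
    and B: "\<And>r. r \<in> {s<..t} \<Longrightarrow> \<bar>u r\<bar> \<le> B"
  shows "set_integrable \<mu> {s<..t} u"
  unfolding set_integrable_def
proof (rule integrableI_bounded_set[where A="{s<..t}" and B=B])
  show "(\<lambda>x. indicator {s<..t} x *\<^sub>R u x) \<in> borel_measurable \<mu>"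
    using u by (subst (asm) borel_measurable_restrict_space_iff) (auto cong: measurable_cong_sets)
qed (use fin B assms(1) in \<open>auto intro!: AE_I2\<close>)

text \<open>Integrands that vanish up to r cover two situations at once: the difference of two
  integrands that agree up to r, and the increment of one integral after time r.\<close>

lemma set_integral_Ioc_bound:
  fixes u :: "real \<Rightarrow> real"
  assumes [measurable_cong]: "sets \<mu> = sets borel"
    and fin: "emeasure \<mu> {s<..t} < \<infinity>" and "s \<le> r"
    and u: "u \<in> borel_measurable (restrict_space borel {s<..t})"
    and z: "\<And>x. x \<in> {s<..r} \<Longrightarrow> u x = 0"
    and d: "\<And>x. x \<in> {r<..t} \<Longrightarrow> \<bar>u x\<bar> \<le> d"
  shows "\<bar>LINT x:{s<..t}|\<mu>. u x\<bar> \<le> d * measure \<mu> {r<..t}"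
proof -
  have fin': "emeasure \<mu> {r<..t} < \<infinity>"
    using fin assms(1) \<open>s \<le> r\<close>
    by (intro le_less_trans[OF emeasure_mono[of "{r<..t}" "{s<..t}"]]) auto
  have "set_integrable \<mu> {s<..t} u"
  proof (rule set_integrable_Ioc_bounded[OF assms(1) fin u])
    fix x assume "x \<in> {s<..t}"
    then show "\<bar>u x\<bar> \<le> max d 0"
      using z[of x] d[of x] by (cases "x \<le> r") (simp, simp add: max.coboundedI1)
  qed
  then have i: "integrable \<mu> (\<lambda>x. indicator {s<..t} x *\<^sub>R u x)"
    by (simp add: set_integrable_def)
  have "\<bar>LINT x:{s<..t}|\<mu>. u x\<bar> \<le> (LINT x|\<mu>. \<bar>indicator {s<..t} x *\<^sub>R u x\<bar>)"
    unfolding set_lebesgue_integral_def by (rule integral_abs_bound)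
  also have "\<dots> \<le> (LINT x|\<mu>. d * indicator {r<..t} x)"
  proof (rule integral_mono)
    show "integrable \<mu> (\<lambda>x. \<bar>indicator {s<..t} x *\<^sub>R u x\<bar>)"
      using i by auto
    show "integrable \<mu> (\<lambda>x. d * indicator {r<..t} x)"
      using fin' assms(1) by auto
    fix x show "\<bar>indicator {s<..t} x *\<^sub>R u x\<bar> \<le> d * indicator {r<..t} x"
      using z[of x] d[of x] \<open>s \<le> r\<close> by (auto simp: indicator_def)
  qed
  also have "\<dots> = d * measure \<mu> {r<..t}"
    using fin' assms(1) by simp
  finally show ?thesis .
qed

context bv_path
begin

lemma pos_variation_mono: "x \<le> y \<Longrightarrow> pos_variation f x \<le> pos_variation f y"
  using increment_le_total_variation[of x y] increment_le_total_variation[of 0 y] total_variation_0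
  by (auto simp: pos_variation_def)

lemma neg_variation_mono: "x \<le> y \<Longrightarrow> neg_variation f x \<le> neg_variation f y"
  using increment_le_total_variation[of x y] increment_le_total_variation[of 0 y] total_variation_0
  by (auto simp: neg_variation_def)

lemma right_cont_variation:
  "continuous (at_right t) (pos_variation f)" "continuous (at_right t) (neg_variation f)"
proof -
  have "(pos_variation f \<longlongrightarrow> pos_variation f t) (at_right t) \<and> (neg_variation f \<longlongrightarrow> neg_variation f t) (at_right t)"
  proof (cases "t < 0")
    case True
    have "\<forall>\<^sub>F s in at_right t. s < 0"
      using eventually_at_right_real[OF True] by eventually_elim auto
    then have "\<forall>\<^sub>F s in at_right t. 0 = pos_variation f s" "\<forall>\<^sub>F s in at_right t. 0 = neg_variation f s"
      by (eventually_elim, simp add: pos_variation_def neg_variation_def)+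
    moreover have "pos_variation f t = 0" "neg_variation f t = 0"
      using True by (simp_all add: pos_variation_def neg_variation_def)
    ultimately show ?thesis
      using Lim_transform_eventually[OF tendsto_const] by metis
  next
    case False
    then have "0 \<le> t" by simp
    have ft: "(f \<longlongrightarrow> f t) (at_right t)" "(total_variation f \<longlongrightarrow> total_variation f t) (at_right t)"
      using right_cont[OF \<open>0 \<le> t\<close>] right_cont_total_variation[OF \<open>0 \<le> t\<close>] by (auto simp: continuous_within)
    have ev: "\<forall>\<^sub>F s in at_right t. 0 \<le> s"
      using eventually_at_right_less[of t] by eventually_elim (use \<open>0 \<le> t\<close> in auto)
    have "((\<lambda>s. (total_variation f s + (f s - f 0)) / 2) \<longlongrightarrow> pos_variation f t) (at_right t)"
         "((\<lambda>s. (total_variation f s - (f s - f 0)) / 2) \<longlongrightarrow> neg_variation f t) (at_right t)"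
      using \<open>0 \<le> t\<close> by (auto simp: pos_variation_def neg_variation_def intro!: tendsto_intros ft)
    moreover have "\<forall>\<^sub>F s in at_right t. (total_variation f s + (f s - f 0)) / 2 = pos_variation f s"
         "\<forall>\<^sub>F s in at_right t. (total_variation f s - (f s - f 0)) / 2 = neg_variation f s"
      using ev by (eventually_elim, simp add: pos_variation_def neg_variation_def)+
    ultimately show ?thesis
      using Lim_transform_eventually by blast
  qed
  then show "continuous (at_right t) (pos_variation f)" "continuous (at_right t) (neg_variation f)"
    by (simp_all add: continuous_within)
qed

lemma emeasure_variation_Ioc:
  assumes "s \<le> t"
  shows "emeasure (interval_measure (pos_variation f)) {s<..t} = pos_variation f t - pos_variation f s"
    and "emeasure (interval_measure (neg_variation f)) {s<..t} = neg_variation f t - neg_variation f s"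
  using assms pos_variation_mono neg_variation_mono right_cont_variation
  by (auto intro: emeasure_interval_measure_Ioc)

lemma measure_variation_Ioc:
  assumes "0 \<le> s" "s \<le> t"
  shows "measure (interval_measure (pos_variation f)) {s<..t} + measure (interval_measure (neg_variation f)) {s<..t}
    = total_variation f t - total_variation f s"
  using assms pos_variation_mono neg_variation_mono right_cont_variation
  by (simp add: measure_interval_measure_Ioc) (simp add: pos_variation_def neg_variation_def field_simps)

lemma variation_Ioc_finite:
  "emeasure (interval_measure (pos_variation f)) {s<..t} < \<infinity>"
  "emeasure (interval_measure (neg_variation f)) {s<..t} < \<infinity>"
  by (cases "s \<le> t"; simp add: emeasure_variation_Ioc)+

text \<open>Boundedness and measurability give integrability against both Jordan parts; for a
  function that is not integrable the integral takes the value 0 and additivity could fail.\<close>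

lemma stieltjes_integral_diff:
  assumes "h \<in> borel_measurable (restrict_space borel {0<..t})"
    and "k \<in> borel_measurable (restrict_space borel {0<..t})"
    and "\<And>r. r \<in> {0<..t} \<Longrightarrow> \<bar>h r\<bar> \<le> B" and "\<And>r. r \<in> {0<..t} \<Longrightarrow> \<bar>k r\<bar> \<le> B"
  shows "stieltjes_integral h f t - stieltjes_integral k f t = stieltjes_integral (\<lambda>s. h s - k s) f t"
proof -
  have "set_integrable (interval_measure F) {0<..t} h" "set_integrable (interval_measure F) {0<..t} k"
    if "F = pos_variation f \<or> F = neg_variation f" for F
    using that variation_Ioc_finite assms by (auto intro!: set_integrable_Ioc_bounded[where B=B])
  then show ?thesis
    by (simp add: stieltjes_integral_def)
qed

lemma stieltjes_integral_bound:
  assumes "u \<in> borel_measurable (restrict_space borel {0<..t})" "0 \<le> s" "s \<le> t"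
    and "\<And>x. x \<in> {0<..s} \<Longrightarrow> u x = 0"
    and "\<And>x. x \<in> {s<..t} \<Longrightarrow> \<bar>u x\<bar> \<le> d"
  shows "\<bar>stieltjes_integral u f t\<bar> \<le> d * (total_variation f t - total_variation f s)"
proof -
  have "\<bar>LINT x:{0<..t}|interval_measure F. u x\<bar> \<le> d * measure (interval_measure F) {s<..t}"
    if "F = pos_variation f \<or> F = neg_variation f" for F
    using that variation_Ioc_finite assms by (intro set_integral_Ioc_bound) auto
  from this[of "pos_variation f"] this[of "neg_variation f"]
  have "\<bar>stieltjes_integral u f t\<bar> \<le> d * measure (interval_measure (pos_variation f)) {s<..t}
      + d * measure (interval_measure (neg_variation f)) {s<..t}"
    unfolding stieltjes_integral_def by simp
  then show ?thesis
    using measure_variation_Ioc[OF assms(2,3)] by (simp add: distrib_left[symmetric])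
qed

end

text \<open>Brings integrals with different upper limits to one domain, where their difference is
  the integral of a difference.\<close>

lemma set_integral_Ioc_cut:
  fixes h :: "real \<Rightarrow> real"
  assumes "s \<le> t"
  shows "(LINT x:{0<..s}|\<mu>. h x) = (LINT x:{0<..t}|\<mu>. (if x \<le> s then h x else 0))"
  unfolding set_lebesgue_integral_def using assms
  by (intro Bochner_Integration.integral_cong) (auto simp: indicator_def)

lemma stieltjes_integral_cut:
  "s \<le> t \<Longrightarrow> stieltjes_integral h f s = stieltjes_integral (\<lambda>x. if x \<le> s then h x else 0) f t"
  unfolding stieltjes_integral_def by (simp add: set_integral_Ioc_cut)

lemma stieltjes_integral_cong:
  assumes "\<And>s. s \<in> {0<..t} \<Longrightarrow> h s = k s"
  shows "stieltjes_integral h f t = stieltjes_integral k f t"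
proof -
  have "(LINT x:{0<..t}|interval_measure F. h x) = (LINT x:{0<..t}|interval_measure F. k x)" for F
    using assms by (intro set_lebesgue_integral_cong) auto
  then show ?thesis by (simp add: stieltjes_integral_def)
qed

section \<open>Left limits\<close>

lemma left_lim_eq: "(f \<longlongrightarrow> l) (at_left t) \<Longrightarrow> left_lim f t = l"
  unfolding left_lim_def by (intro tendsto_Lim) auto

lemma left_lim_tendsto: "\<exists>l. (f \<longlongrightarrow> l) (at_left t) \<Longrightarrow> (f \<longlongrightarrow> left_lim f t) (at_left t)"
  using left_lim_eq by blast

lemma left_lim_cong:
  assumes "s < t" "\<And>r. r \<in> {s<..<t} \<Longrightarrow> f r = g r"
  shows "left_lim f t = left_lim g t"
proof -
  have "(f \<longlongrightarrow> l) (at_left t) \<longleftrightarrow> (g \<longlongrightarrow> l) (at_left t)" for l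
    using eventually_at_left_real[OF assms(1)] assms(2)
    by (intro tendsto_cong) (auto elim!: eventually_mono)
  then show ?thesis
    by (simp add: left_lim_def Topological_Spaces.Lim_def)
qed

lemma left_lim_diff_le:
  assumes "s < t" "\<And>r. r \<in> {s<..<t} \<Longrightarrow> \<bar>f r - g r\<bar> \<le> d"
    and "\<exists>l. (f \<longlongrightarrow> l) (at_left t)" "\<exists>l. (g \<longlongrightarrow> l) (at_left t)"
  shows "\<bar>left_lim f t - left_lim g t\<bar> \<le> d"
proof (rule tendsto_upperbound)
  show "((\<lambda>r. \<bar>f r - g r\<bar>) \<longlongrightarrow> \<bar>left_lim f t - left_lim g t\<bar>) (at_left t)"
    by (intro tendsto_intros left_lim_tendsto assms)
  show "\<forall>\<^sub>F r in at_left t. \<bar>f r - g r\<bar> \<le> d"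
    using eventually_at_left_real[OF assms(1)] by eventually_elim (use assms(2) in auto)
qed auto

lemma mono_on_left_limit:
  fixes u :: "real \<Rightarrow> real"
  assumes "mono_on {0..t} u" "0 < t"
  shows "\<exists>l. (u \<longlongrightarrow> l) (at_left t)"
proof -
  have "(u \<longlongrightarrow> Sup (u ` ({..<t} \<inter> {0<..}))) (at t within ({..<t} \<inter> {0<..}))"
    using assms by (intro Lim_left_bound[where K="u t"]) (auto intro: mono_onD)
  moreover have "at t within ({..<t} \<inter> {0<..}) = at_left t"
    using assms(2) by (intro at_within_nhd[where S="{0<..}"]) auto
  ultimately show ?thesis by metis
qed

section \<open>Left limits and Stieltjes integrals along dyadic grids\<close>

definition dyadic_below :: "real \<Rightarrow> nat \<Rightarrow> real \<Rightarrow> real" where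
  "dyadic_below t n s = t * of_int (\<lceil>2^n * (s / t)\<rceil> - 1) / 2^n"

text \<open>The ceiling minus one, unlike the floor, sends a grid point to its predecessor. The
  approximation is therefore strictly below s for every s, as convergence in
  \<open>at_left s\<close> requires.\<close>

lemma dyadic_below_tendsto:
  assumes "0 < t"
  shows "filterlim (\<lambda>n. dyadic_below t n s) (at_left s) sequentially"
proof -
  have up: "dyadic_below t n s < s" for n
  proof -
    have "of_int (\<lceil>2^n * (s / t)\<rceil> - 1) < 2^n * (s / t)" by linarith
    then have "t * of_int (\<lceil>2^n * (s / t)\<rceil> - 1) < t * (2^n * (s / t))"
      using assms by (intro mult_strict_left_mono) auto
    then show ?thesis using assms by (simp add: dyadic_below_def divide_less_eq mult.commute)
  qed
  have lo: "s - t * (1/2)^n \<le> dyadic_below t n s" for n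
  proof -
    have "2^n * (s / t) - 1 \<le> of_int (\<lceil>2^n * (s / t)\<rceil> - 1)" by linarith
    then have "t * (2^n * (s / t) - 1) \<le> t * of_int (\<lceil>2^n * (s / t)\<rceil> - 1)"
      using assms by (intro mult_left_mono) auto
    also have "t * (2^n * (s / t) - 1) = (s - t * (1/2)^n) * 2^n"
      using assms by (simp add: field_simps power_one_over)
    finally show ?thesis by (simp add: dyadic_below_def le_divide_eq)
  qed
  have "(\<lambda>n. s - t * (1/2)^n) \<longlonglongrightarrow> s - t * 0"
    by (intro tendsto_intros LIMSEQ_realpow_zero) auto
  then have lim: "(\<lambda>n. s - t * (1/2)^n) \<longlonglongrightarrow> s" by simp
  have "(\<lambda>n. dyadic_below t n s) \<longlonglongrightarrow> s"
    by (rule tendsto_sandwich[OF always_eventually always_eventually lim tendsto_const])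
       (use lo up less_imp_le in blast)+
  then show ?thesis
    unfolding filterlim_at using up by (auto simp: less_imp_neq intro!: always_eventually)
qed

text \<open>The function factors through the integers, on which every function is measurable, so
  \<open>h\<close> may be arbitrary.\<close>

lemma measurable_dyadic_below [measurable]:
  "(\<lambda>s. h (dyadic_below t n s)) \<in> borel_measurable borel" for h :: "real \<Rightarrow> real"
proof -
  have "(\<lambda>s::real. \<lceil>2^n * (s / t)\<rceil>) \<in> measurable borel (count_space UNIV)"
    by measurable
  then show ?thesis
    unfolding dyadic_below_def
    by (rule measurable_compose[where N="count_space UNIV" and g="\<lambda>i. h (t * of_int (i - 1) / 2^n)"]) auto
qed

lemma dyadic_below_limit:
  assumes "\<exists>l. (h \<longlongrightarrow> l) (at_left s)" "0 < t"
  shows "(\<lambda>n. h (dyadic_below t n s)) \<longlonglongrightarrow> left_lim h s"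
  using filterlim_compose[OF left_lim_tendsto[OF assms(1)] dyadic_below_tendsto[OF assms(2)]] .

text \<open>A pointwise limit of step functions, each measurable by
  \<open>measurable_dyadic_below\<close>.\<close>

lemma measurable_left_lim:
  assumes "\<And>s. s \<in> {0<..t} \<Longrightarrow> \<exists>l. (h \<longlongrightarrow> l) (at_left s)"
  shows "left_lim h \<in> borel_measurable (restrict_space borel {0<..t})"
proof (rule borel_measurable_LIMSEQ_real)
  fix s assume "s \<in> space (restrict_space borel {0<..t})"
  then show "(\<lambda>n. h (dyadic_below 1 n s)) \<longlonglongrightarrow> left_lim h s"
    using assms by (intro dyadic_below_limit) (auto simp: space_restrict_space)
qed (intro measurable_restrict_space1 measurable_dyadic_below)

text \<open>As a finite sum of indicators, the step function integrates to a Riemann sum with left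
  endpoints.\<close>

lemma dyadic_below_step:
  fixes h :: "real \<Rightarrow> real"
  assumes "0 < t"
  shows "indicator {0<..t} s * h (dyadic_below t n s)
    = (\<Sum>i<2^n. h (t * real i / 2^n) * indicator {t * real i / 2^n<..t * real (Suc i) / 2^n} s)"
proof -
  \<comment> \<open>Cells open on the left and closed on the right are exactly the level sets of the
    ceiling.\<close>
  have ind: "s \<in> {t * real i / 2^n<..t * real (Suc i) / 2^n} \<longleftrightarrow> \<lceil>2^n * (s / t)\<rceil> = int i + 1" for i
    using assms by (auto simp: ceiling_eq_iff field_simps)
  show ?thesis
  proof (cases "s \<in> {0<..t}")
    case True
    define j where "j = nat (\<lceil>2^n * (s / t)\<rceil> - 1)"
    have "0 < 2^n * (s / t)" "2^n * (s / t) \<le> 2^n"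
      using True assms by (auto simp: field_simps)
    then have "1 \<le> \<lceil>2^n * (s / t)\<rceil>" "\<lceil>2^n * (s / t)\<rceil> \<le> 2^n"
      by (auto simp: ceiling_le_iff intro: order.trans[of 1 "\<lceil>2^n * (s / t)\<rceil>"])
    then have j: "\<lceil>2^n * (s / t)\<rceil> = int j + 1" "j < 2^n"
      by (auto simp: j_def nat_less_iff)
    have "(\<Sum>i<2^n. h (t * real i / 2^n) * indicator {t * real i / 2^n<..t * real (Suc i) / 2^n} s)
        = (\<Sum>i<2^n. if i = j then h (t * real j / 2^n) else 0)"
      using ind j by (intro sum.cong) (auto simp: indicator_def simp del: of_nat_Suc)
    then show ?thesis using True j by (simp add: dyadic_below_def)
  next
    case False
    have "s \<notin> {t * real i / 2^n<..t * real (Suc i) / 2^n}" if "i < 2^n" for i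
    proof
      assume s: "s \<in> {t * real i / 2^n<..t * real (Suc i) / 2^n}"
      have "0 \<le> t * real i / 2^n" using assms by simp
      moreover have "t * real (Suc i) / 2^n \<le> t"
      proof -
        have "real (Suc i) \<le> 2^n" using that by (metis Suc_leI of_nat_le_iff of_nat_numeral of_nat_power)
        then show ?thesis using assms by (simp add: divide_le_eq del: of_nat_Suc)
      qed
      ultimately show False using s False by auto
    qed
    then have "(\<Sum>i<2^n. h (t * real i / 2^n) * indicator {t * real i / 2^n<..t * real (Suc i) / 2^n} s) = 0"
      by (intro sum.neutral) (auto simp: indicator_def simp del: of_nat_Suc)
    then show ?thesis using False by (simp only:) simp
  qed
qed

text \<open>The sums are integrals of step functions that tend pointwise to the left limits of
  \<open>h\<close>; dominated convergence applies with the bound \<open>B\<close> on (0, t]. The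
  point is that the sums involve \<open>h\<close> and \<open>F\<close> at finitely many times up to
  t.\<close>

lemma Riemann_sum_tendsto:
  assumes lim: "\<And>s. s \<in> {0<..t} \<Longrightarrow> \<exists>l. (h \<longlongrightarrow> l) (at_left s)" and "0 < t"
    and B: "\<And>s. \<bar>h s\<bar> \<le> B"
    and F: "\<And>x y. x \<le> y \<Longrightarrow> F x \<le> F y" "\<And>a. continuous (at_right a) F"
  shows "(\<lambda>n. \<Sum>i<2^n. h (t * real i / 2^n) * (F (t * real (Suc i) / 2^n) - F (t * real i / 2^n)))
    \<longlonglongrightarrow> (LINT s:{0<..t}|interval_measure F. left_lim h s)"
proof -
  have fin: "emeasure (interval_measure F) {x<..y} < \<infinity>" for x y
    using F by (simp add: emeasure_interval_measure_Ioc_eq)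
  have "(\<Sum>i<2^n. h (t * real i / 2^n) * (F (t * real (Suc i) / 2^n) - F (t * real i / 2^n)))
      = (LINT s|interval_measure F. indicator {0<..t} s *\<^sub>R h (dyadic_below t n s))" for n
  proof -
    have 1: "(LINT s|interval_measure F. h (t * real i / 2^n) * indicator {t * real i / 2^n<..t * real (Suc i) / 2^n} s)
        = h (t * real i / 2^n) * (F (t * real (Suc i) / 2^n) - F (t * real i / 2^n))" for i
    proof -
      have "t * real i / 2^n \<le> t * real (Suc i) / 2^n"
        using \<open>0 < t\<close> by (intro divide_right_mono mult_left_mono) auto
      then show ?thesis
        using measure_interval_measure_Ioc[OF _ F] by (simp del: of_nat_Suc)
    qed
    have 2: "integrable (interval_measure F)
        (\<lambda>s. h (t * real i / 2^n) * indicator {t * real i / 2^n<..t * real (Suc i) / 2^n} s)" for i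
      using fin by (intro integrable_mult_right integrable_real_indicator) auto
    show ?thesis
      unfolding real_scaleR_def dyadic_below_step[OF \<open>0 < t\<close>] Bochner_Integration.integral_sum[OF 2] 1 ..
  qed
  moreover have "(\<lambda>n. LINT s|interval_measure F. indicator {0<..t} s *\<^sub>R h (dyadic_below t n s))
      \<longlonglongrightarrow> (LINT s|interval_measure F. indicator {0<..t} s *\<^sub>R left_lim h s)"
  proof (rule integral_dominated_convergence[where w="\<lambda>s. B * indicator {0<..t} s"])
    show "(\<lambda>s. indicator {0<..t} s *\<^sub>R left_lim h s) \<in> borel_measurable (interval_measure F)"
      using measurable_left_lim[OF lim]
      by (subst (asm) borel_measurable_restrict_space_iff) (auto cong: measurable_cong_sets)
    show "integrable (interval_measure F) (\<lambda>s. B * indicator {0<..t} s)"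
      using fin by (auto simp: less_top)
    show "AE s in interval_measure F. (\<lambda>n. indicator {0<..t} s *\<^sub>R h (dyadic_below t n s)) \<longlonglongrightarrow> indicator {0<..t} s *\<^sub>R left_lim h s"
    proof (rule AE_I2)
      fix s
      show "(\<lambda>n. indicator {0<..t} s *\<^sub>R h (dyadic_below t n s)) \<longlonglongrightarrow> indicator {0<..t} s *\<^sub>R left_lim h s"
        using dyadic_below_limit[OF lim \<open>0 < t\<close>, of s] by (cases "s \<in> {0<..t}") (auto intro!: tendsto_intros)
    qed
    show "AE s in interval_measure F. norm (indicator {0<..t} s *\<^sub>R h (dyadic_below t n s)) \<le> B * indicator {0<..t} s" for n
      using B by (auto simp: indicator_def)
  qed measurable
  ultimately show ?thesis by (simp add: set_lebesgue_integral_def)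
qed

lemma (in bv_path) Riemann_Stieltjes_sum_tendsto:
  assumes "\<And>s. s \<in> {0<..t} \<Longrightarrow> \<exists>l. (h \<longlongrightarrow> l) (at_left s)" "0 < t" "\<And>s. \<bar>h s\<bar> \<le> B"
  shows "(\<lambda>n. \<Sum>i<2^n. h (t * real i / 2^n) * (f (t * real (Suc i) / 2^n) - f (t * real i / 2^n)))
    \<longlonglongrightarrow> stieltjes_integral (left_lim h) f t"
proof -
  \<comment> \<open>Restricted to nonnegative times: before 0 the Jordan parts are set to 0 and do
    not describe \<open>f\<close>.\<close>
  have "f y - f x = (pos_variation f y - pos_variation f x) - (neg_variation f y - neg_variation f x)"
    if "0 \<le> x" "0 \<le> y" for x y
    using that by (simp add: pos_variation_def neg_variation_def field_simps)
  then have "(\<Sum>i<2^n. h (t * real i / 2^n) * (f (t * real (Suc i) / 2^n) - f (t * real i / 2^n)))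
      = (\<Sum>i<2^n. h (t * real i / 2^n) * (pos_variation f (t * real (Suc i) / 2^n) - pos_variation f (t * real i / 2^n)))
      - (\<Sum>i<2^n. h (t * real i / 2^n) * (neg_variation f (t * real (Suc i) / 2^n) - neg_variation f (t * real i / 2^n)))" for n
    using \<open>0 < t\<close> by (simp add: sum_subtractf[symmetric] right_diff_distrib[symmetric] del: of_nat_Suc)
  then show ?thesis
    unfolding stieltjes_integral_def
    using tendsto_diff[OF Riemann_sum_tendsto[OF assms pos_variation_mono right_cont_variation(1)]
      Riemann_sum_tendsto[OF assms neg_variation_mono right_cont_variation(2)]]
    by (simp only:)
qed

lemma emeasure_lborel_Ioc_finite: "emeasure lborel {x<..y::real} < \<infinity>"
  by (cases "x \<le> y") auto

lemma left_lim_bounds: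
  assumes "\<exists>l. (f \<longlongrightarrow> l) (at_left t)" "s < t" "\<And>r. r \<in> {s<..<t} \<Longrightarrow> m \<le> f r" "\<And>r. r \<in> {s<..<t} \<Longrightarrow> f r \<le> B"
  shows "m \<le> left_lim f t" "left_lim f t \<le> B"
proof -
  have ev: "\<forall>\<^sub>F r in at_left t. m \<le> f r" "\<forall>\<^sub>F r in at_left t. f r \<le> B"
    using eventually_at_left_real[OF assms(2)] by (eventually_elim, use assms in auto)+
  show "m \<le> left_lim f t" "left_lim f t \<le> B"
    using tendsto_lowerbound[OF left_lim_tendsto[OF assms(1)] ev(1)]
      tendsto_upperbound[OF left_lim_tendsto[OF assms(1)] ev(2)] by auto
qed

lemma abs_sqrt_diff_le:
  assumes "0 < m" "m \<le> x" "0 \<le> y"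
  shows "\<bar>sqrt x - sqrt y\<bar> \<le> \<bar>x - y\<bar> / sqrt m"
proof -
  have "\<bar>sqrt x - sqrt y\<bar> * sqrt m \<le> \<bar>sqrt x - sqrt y\<bar> * (sqrt x + sqrt y)"
    using assms by (intro mult_left_mono) (auto intro: add_increasing2)
  also have "\<dots> = \<bar>(sqrt x - sqrt y) * (sqrt x + sqrt y)\<bar>"
    using assms by (simp add: abs_mult)
  also have "(sqrt x - sqrt y) * (sqrt x + sqrt y) = x - y"
    using assms by (simp add: algebra_simps)
  finally show ?thesis
    using assms by (simp add: le_divide_eq)
qed

section \<open>The pathwise equation\<close>

text \<open>The integrand \<open>h\<close> is a parameter of its own, so that both the left limits
  of a solution and the clamped left limits of an iterate can be inserted.\<close>

definition rhs ::
  "real \<Rightarrow> real \<Rightarrow> real \<Rightarrow> real \<Rightarrow> real \<Rightarrow> (real \<Rightarrow> real) \<Rightarrow> (real \<Rightarrow> real) \<Rightarrow> (real \<Rightarrow> real) \<Rightarrow> real \<Rightarrow> real"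
  where
  "rhs \<kappa> a \<theta> \<sigma> x0 g G h t = x0 + (LBINT s:{0..t}. \<kappa> * (a - h s)) + \<theta> * (g t - g 0)
    + \<sigma> * stieltjes_integral (\<lambda>s. sqrt (h s)) G t"

lemma solves_until_rhs:
  "solves_until \<kappa> a \<theta> \<sigma> x0 g G T x \<longleftrightarrow>
    (\<forall>t\<ge>0. ennreal t < T \<longrightarrow> (0 < t \<longrightarrow> 0 \<le> left_lim x t) \<and> x t = rhs \<kappa> a \<theta> \<sigma> x0 g G (left_lim x) t)"
  by (simp add: solves_until_def rhs_def)

text \<open>The point 0 is Lebesgue null. Removing it gives both integrals the domain (0, t], and
  the left limit at 0, which looks at negative times, no longer enters.\<close>

lemma rhs_Ioc:
  "rhs \<kappa> a \<theta> \<sigma> x0 g G h t = x0 + (LBINT s:{0<..t}. \<kappa> * (a - h s)) + \<theta> * (g t - g 0)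
    + \<sigma> * stieltjes_integral (\<lambda>s. sqrt (h s)) G t"
proof -
  have "(LBINT s:{0..t}. \<kappa> * (a - h s)) = (LBINT s:{0<..t}. \<kappa> * (a - h s))"
    by (rule set_integral_discrete_difference[where X="{0}"]) auto
  then show ?thesis by (simp add: rhs_def)
qed

lemma rhs_cong:
  assumes "\<And>s. s \<in> {0<..t} \<Longrightarrow> h s = k s"
  shows "rhs \<kappa> a \<theta> \<sigma> x0 g G h t = rhs \<kappa> a \<theta> \<sigma> x0 g G k t"
proof -
  have "(LBINT s:{0<..t}. \<kappa> * (a - h s)) = (LBINT s:{0<..t}. \<kappa> * (a - k s))"
    using assms by (intro set_lebesgue_integral_cong) auto
  moreover have "stieltjes_integral (\<lambda>s. sqrt (h s)) G t = stieltjes_integral (\<lambda>s. sqrt (k s)) G t"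
    using assms by (intro stieltjes_integral_cong) auto
  ultimately show ?thesis by (simp add: rhs_Ioc)
qed

lemma rhs_0: "rhs \<kappa> a \<theta> \<sigma> x0 g G h 0 = x0"
  by (simp add: rhs_Ioc stieltjes_integral_def set_lebesgue_integral_def)

section \<open>The clock, its constants and the Picard iterates\<close>

definition clock :: "(real \<Rightarrow> real) \<Rightarrow> (real \<Rightarrow> real) \<Rightarrow> real \<Rightarrow> real" where
  "clock g G t = t + (g t - g 0) + total_variation G t"

text \<open>The clamp keeps the square root Lipschitz; it is inactive for as long as the clock is short.\<close>

definition clamp :: "real \<Rightarrow> real \<Rightarrow> real" where
  "clamp x0 y = max (x0 / 2) (min (3 * x0 / 2) y)"

primrec picard ::
  "real \<Rightarrow> real \<Rightarrow> real \<Rightarrow> real \<Rightarrow> real \<Rightarrow> (real \<Rightarrow> real) \<Rightarrow> (real \<Rightarrow> real) \<Rightarrow> nat \<Rightarrow> real \<Rightarrow> real"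
  where
  "picard \<kappa> a \<theta> \<sigma> x0 g G 0 = (\<lambda>t. x0)"
| "picard \<kappa> a \<theta> \<sigma> x0 g G (Suc n) =
    rhs \<kappa> a \<theta> \<sigma> x0 g G (\<lambda>s. clamp x0 (left_lim (picard \<kappa> a \<theta> \<sigma> x0 g G n) s))"

text \<open>A joint Lipschitz constant, relative to the clock, of the drift and the square root
  coefficient when one of the two arguments is at least m.\<close>

definition sqrt_lipschitz :: "real \<Rightarrow> real \<Rightarrow> real \<Rightarrow> real" where
  "sqrt_lipschitz \<kappa> \<sigma> m = \<kappa> + \<sigma> / sqrt m"

text \<open>Bounds all three coefficients together for arguments in [0, B], hence the growth of the
  right-hand side per unit of the clock.\<close>

definition max_speed :: "real \<Rightarrow> real \<Rightarrow> real \<Rightarrow> real \<Rightarrow> real \<Rightarrow> real" where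
  "max_speed \<kappa> a \<theta> \<sigma> B = \<kappa> * (a + B) + \<theta> + \<sigma> * sqrt B"

text \<open>The first bound keeps every path of speed \<open>K\<close> within x0 / 2 of x0, where
  the clamp is inactive; the second makes the Picard map a contraction with factor 1/2.\<close>

definition threshold :: "real \<Rightarrow> real \<Rightarrow> real \<Rightarrow> real \<Rightarrow> real \<Rightarrow> real" where
  "threshold \<kappa> a \<theta> \<sigma> x0 =
    min (x0 / (2 * max_speed \<kappa> a \<theta> \<sigma> (3 * x0 / 2))) (1 / (2 * sqrt_lipschitz \<kappa> \<sigma> (x0 / 2)))"

lemma clamp_bounds: "0 < x0 \<Longrightarrow> x0 / 2 \<le> clamp x0 y" "0 < x0 \<Longrightarrow> clamp x0 y \<le> 3 * x0 / 2"
  by (auto simp: clamp_def)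

lemma clamp_id:
  assumes "x0 / 2 \<le> y" "y \<le> 3 * x0 / 2"
  shows "clamp x0 y = y"
  using assms by (simp add: clamp_def)

lemma clamp_diff_le: "\<bar>clamp x0 y - clamp x0 z\<bar> \<le> \<bar>y - z\<bar>"
  by (auto simp: clamp_def max_def min_def)

lemma continuous_clamp: "continuous_on UNIV (clamp x0)"
  unfolding clamp_def[abs_def] by (intro continuous_intros)

lemma measurable_clamp [measurable]: "clamp x0 \<in> borel_measurable borel"
  by (intro borel_measurable_continuous_onI continuous_clamp)

lemma half_geometric_limit:
  fixes u :: "nat \<Rightarrow> real"
  assumes "\<And>n. \<bar>u (Suc n) - u n\<bar> \<le> C * (1/2)^n"
  shows "u \<longlonglongrightarrow> lim u" "\<bar>lim u - u n\<bar> \<le> 2 * C * (1/2)^n"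
proof -
  have C: "0 \<le> C" using assms[of 0] by simp
  \<comment> \<open>The factor 1 - (1/2)^k is the partial geometric sum; with the plain bound the
    induction on k would not close.\<close>
  have d: "\<bar>u (n + k) - u n\<bar> \<le> 2 * C * (1/2)^n * (1 - (1/2)^k)" for n k
  proof (induction k)
    case (Suc k)
    have "\<bar>u (n + Suc k) - u n\<bar> \<le> C * (1/2)^(n+k) + 2 * C * (1/2)^n * (1 - (1/2)^k)"
      using Suc assms[of "n+k"] by simp
    then show ?case by (simp add: power_add algebra_simps)
  qed simp
  have d': "\<bar>u (n + k) - u n\<bar> \<le> 2 * C * (1/2)^n" for n k
  proof -
    have "2 * C * (1/2)^n * (1 - (1/2)^k) \<le> 2 * C * (1/2)^n * 1"
      using C by (intro mult_left_mono) auto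
    then show ?thesis using d[of n k] by linarith
  qed
  have lim0: "(\<lambda>n. 2 * C * (1/2)^n) \<longlonglongrightarrow> 0"
    using tendsto_mult_right_zero[OF LIMSEQ_realpow_zero[of "1/2"]] by simp
  have "Cauchy u"
  proof (rule metric_CauchyI)
    fix e :: real assume "0 < e"
    then obtain N where N: "2 * C * (1/2)^N < e / 2"
      using order_tendstoD(2)[OF lim0, of "e/2"] by (auto simp: eventually_sequentially)
    show "\<exists>N. \<forall>m\<ge>N. \<forall>n\<ge>N. dist (u m) (u n) < e"
    proof (intro exI allI impI)
      fix m n assume "m \<ge> N" "n \<ge> N"
      then show "dist (u m) (u n) < e"
        using d'[of N "m - N"] d'[of N "n - N"] N by (simp add: dist_real_def)
    qed
  qed
  then show L: "u \<longlonglongrightarrow> lim u"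
    using Cauchy_convergent convergent_LIMSEQ_iff by blast
  show "\<bar>lim u - u n\<bar> \<le> 2 * C * (1/2)^n"
  proof (rule tendsto_upperbound)
    show "(\<lambda>k. \<bar>u (n + k) - u n\<bar>) \<longlonglongrightarrow> \<bar>lim u - u n\<bar>"
      using LIMSEQ_ignore_initial_segment[OF L, of n] by (intro tendsto_intros) (simp add: add.commute)
  qed (use d' in auto)
qed

section \<open>Estimates for the equation along one pair of driving paths\<close>

locale driven_equation = bv_path G for G :: "real \<Rightarrow> real" +
  fixes g :: "real \<Rightarrow> real" and \<kappa> a \<theta> \<sigma> x0 :: real
  assumes mono_g: "mono_on {0..} g"
    and right_cont_g: "\<And>t. 0 \<le> t \<Longrightarrow> continuous (at_right t) g"
    and params: "0 < \<kappa>" "0 < a" "0 \<le> \<theta>" "0 < \<sigma>" "0 < x0"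
begin

abbreviation "\<Phi> \<equiv> rhs \<kappa> a \<theta> \<sigma> x0 g G"
abbreviation "A \<equiv> clock g G"
abbreviation "pic \<equiv> picard \<kappa> a \<theta> \<sigma> x0 g G"

lemma g_le: "0 \<le> s \<Longrightarrow> s \<le> t \<Longrightarrow> g s \<le> g t"
  using mono_g by (auto intro: mono_onD)

lemma clock_mono: "0 \<le> s \<Longrightarrow> s \<le> t \<Longrightarrow> A s \<le> A t"
  using g_le[of s t] total_variation_mono[of s t] by (simp add: clock_def)

lemma clock_0: "A 0 = 0"
  by (simp add: clock_def total_variation_0)

lemma right_cont_clock:
  assumes "0 \<le> t"
  shows "(A \<longlongrightarrow> A t) (at_right t)"
  using right_cont_g[OF assms] right_cont_total_variation[OF assms]
  unfolding clock_def[abs_def] continuous_within by (intro tendsto_intros)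

lemma clock_bounds:
  assumes "0 \<le> s" "s \<le> t"
  shows "t - s \<le> A t - A s" "total_variation G t - total_variation G s \<le> A t - A s" "g t - g s \<le> A t - A s"
  using g_le[OF assms] total_variation_mono[OF assms] assms by (auto simp: clock_def)

text \<open>The hypotheses are deliberately asymmetric: \<open>h\<close> stays above m, while
  \<open>k\<close> is only nonnegative. The same estimate then serves the contraction, where both
  are clamped, and uniqueness, where the competing solution may come close to 0. Agreement up to s
  allows the estimate to be restarted at s.\<close>

lemma rhs_diff:
  assumes h: "h \<in> borel_measurable (restrict_space borel {0<..t})"
    and k: "k \<in> borel_measurable (restrict_space borel {0<..t})"
    and st: "0 \<le> s" "s \<le> t" and "0 < m"
    and eq: "\<And>r. r \<in> {0<..s} \<Longrightarrow> h r = k r"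
    and d: "\<And>r. r \<in> {s<..t} \<Longrightarrow> \<bar>h r - k r\<bar> \<le> d"
    and hm: "\<And>r. r \<in> {0<..t} \<Longrightarrow> m \<le> h r \<and> h r \<le> B"
    and kB: "\<And>r. r \<in> {0<..t} \<Longrightarrow> 0 \<le> k r \<and> k r \<le> B"
  shows "\<bar>\<Phi> h t - \<Phi> k t\<bar> \<le> sqrt_lipschitz \<kappa> \<sigma> m * d * (A t - A s)"
proof -
  note [measurable] = h k
  have int: "set_integrable lborel {0<..t} (\<lambda>r. \<kappa> * (a - u r))"
    if [measurable]: "u \<in> borel_measurable (restrict_space borel {0<..t})"
      and u: "\<And>r. r \<in> {0<..t} \<Longrightarrow> 0 \<le> u r \<and> u r \<le> B" for u
  proof (rule set_integrable_Ioc_bounded[where B="\<kappa> * (a + B)"])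
    fix r assume "r \<in> {0<..t}"
    then have "\<bar>a - u r\<bar> \<le> a + B" using u[of r] params by auto
    then show "\<bar>\<kappa> * (a - u r)\<bar> \<le> \<kappa> * (a + B)"
      using params by (simp add: abs_mult)
  qed (use emeasure_lborel_Ioc_finite in auto)
  have "(LBINT r:{0<..t}. \<kappa> * (a - h r)) - (LBINT r:{0<..t}. \<kappa> * (a - k r))
      = (LBINT r:{0<..t}. \<kappa> * (a - h r) - \<kappa> * (a - k r))"
    using int[OF h] int[OF k] hm kB \<open>0 < m\<close> by (intro set_integral_diff(2)[symmetric]) force+
  also have "\<bar>\<dots>\<bar> \<le> \<kappa> * d * measure lborel {s<..t}"
  proof (rule set_integral_Ioc_bound)
    fix r assume "r \<in> {s<..t}"
    have "\<bar>\<kappa> * (a - h r) - \<kappa> * (a - k r)\<bar> = \<kappa> * \<bar>h r - k r\<bar>"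
      using params by (simp add: right_diff_distrib[symmetric] abs_mult abs_minus_commute)
    then show "\<bar>\<kappa> * (a - h r) - \<kappa> * (a - k r)\<bar> \<le> \<kappa> * d"
      using d[OF \<open>r \<in> {s<..t}\<close>] params by simp
  qed (use st eq emeasure_lborel_Ioc_finite in auto)
  finally have 1: "\<bar>(LBINT r:{0<..t}. \<kappa> * (a - h r)) - (LBINT r:{0<..t}. \<kappa> * (a - k r))\<bar> \<le> \<kappa> * d * (t - s)"
    using st by simp
  have "stieltjes_integral (\<lambda>r. sqrt (h r)) G t - stieltjes_integral (\<lambda>r. sqrt (k r)) G t
      = stieltjes_integral (\<lambda>r. sqrt (h r) - sqrt (k r)) G t"
  proof (rule stieltjes_integral_diff[where B="sqrt B"])
    fix r assume r: "r \<in> {0<..t}"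
    show "\<bar>sqrt (h r)\<bar> \<le> sqrt B" "\<bar>sqrt (k r)\<bar> \<le> sqrt B"
      using hm[OF r] kB[OF r] \<open>0 < m\<close> by simp_all
  qed simp_all
  also have "\<bar>\<dots>\<bar> \<le> d / sqrt m * (total_variation G t - total_variation G s)"
  proof (rule stieltjes_integral_bound)
    fix r assume r: "r \<in> {s<..t}"
    then have "\<bar>sqrt (h r) - sqrt (k r)\<bar> \<le> \<bar>h r - k r\<bar> / sqrt m"
      using st hm[of r] kB[of r] \<open>0 < m\<close> by (intro abs_sqrt_diff_le) auto
    also have "\<dots> \<le> d / sqrt m"
      using d[OF r] \<open>0 < m\<close> by (intro divide_right_mono) auto
    finally show "\<bar>sqrt (h r) - sqrt (k r)\<bar> \<le> d / sqrt m" .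
  qed (use st eq in auto)
  finally have 2: "\<sigma> * \<bar>stieltjes_integral (\<lambda>r. sqrt (h r)) G t - stieltjes_integral (\<lambda>r. sqrt (k r)) G t\<bar>
      \<le> \<sigma> * (d / sqrt m * (total_variation G t - total_variation G s))"
    using params by (intro mult_left_mono) auto
  \<comment> \<open>For s = t nothing forces d to be nonnegative, so this case is settled separately
    by equality of the integrands.\<close>
  show ?thesis
  proof (cases "s = t")
    case True
    have "\<Phi> h t = \<Phi> k t" using eq True by (intro rhs_cong) auto
    then show ?thesis using True by simp
  next
    case False
    then have "0 \<le> d" using d[of t] st by (auto intro: order.trans[OF abs_ge_zero])
    have "\<bar>\<Phi> h t - \<Phi> k t\<bar> \<le> \<bar>(LBINT r:{0<..t}. \<kappa> * (a - h r)) - (LBINT r:{0<..t}. \<kappa> * (a - k r))\<bar>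
      + \<bar>\<sigma> * (stieltjes_integral (\<lambda>r. sqrt (h r)) G t - stieltjes_integral (\<lambda>r. sqrt (k r)) G t)\<bar>"
      unfolding rhs_Ioc by (simp add: right_diff_distrib)
    also have "\<dots> \<le> \<kappa> * d * (t - s) + \<sigma> * (d / sqrt m * (total_variation G t - total_variation G s))"
      using 1 2 params by (simp add: abs_mult)
    also have "\<dots> \<le> \<kappa> * d * (A t - A s) + \<sigma> * (d / sqrt m * (A t - A s))"
      using clock_bounds[OF st] params \<open>0 \<le> d\<close> \<open>0 < m\<close>
      by (intro add_mono mult_left_mono) auto
    finally show ?thesis
      by (simp add: sqrt_lipschitz_def algebra_simps)
  qed
qed

text \<open>Subtracting the integrand cut off at s leaves an integrand that vanishes up to s, so
  only the mass of (s, t] is charged, and the clock bounds that mass for each driver.\<close>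

lemma rhs_increment:
  assumes h: "h \<in> borel_measurable (restrict_space borel {0<..t})"
    and st: "0 \<le> s" "s \<le> t"
    and hB: "\<And>r. r \<in> {0<..t} \<Longrightarrow> 0 \<le> h r \<and> h r \<le> B" and "0 \<le> B"
  shows "\<bar>\<Phi> h t - \<Phi> h s\<bar> \<le> max_speed \<kappa> a \<theta> \<sigma> B * (A t - A s)"
proof -
  have cut: "(\<lambda>r. if r \<le> s then u r else 0) \<in> borel_measurable (restrict_space borel {0<..t})"
    if "u \<in> borel_measurable (restrict_space borel {0<..t})" for u :: "real \<Rightarrow> real"
  proof -
    have "(\<lambda>r. u r * indicator {..s} r) \<in> borel_measurable (restrict_space borel {0<..t})"
      by (intro borel_measurable_times that measurable_restrict_space1) simp
    moreover have "(\<lambda>r. u r * indicator {..s} r) = (\<lambda>r. if r \<le> s then u r else 0)"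
      by (auto simp: indicator_def)
    ultimately show ?thesis by simp
  qed
  have hu: "(\<lambda>r. \<kappa> * (a - h r)) \<in> borel_measurable (restrict_space borel {0<..t})"
    "(\<lambda>r. sqrt (h r)) \<in> borel_measurable (restrict_space borel {0<..t})"
    using h by simp_all
  note meas = borel_measurable_diff hu cut[OF hu(1)] cut[OF hu(2)]
  have u: "\<bar>\<kappa> * (a - h r)\<bar> \<le> \<kappa> * (a + B)" if "r \<in> {0<..t}" for r
    using hB[OF that] params by (auto simp: abs_mult)
  have "(LBINT r:{0<..t}. \<kappa> * (a - h r)) - (LBINT r:{0<..s}. \<kappa> * (a - h r))
      = (LBINT r:{0<..t}. \<kappa> * (a - h r) - (if r \<le> s then \<kappa> * (a - h r) else 0))"
    unfolding set_integral_Ioc_cut[OF st(2)] using u params \<open>0 \<le> B\<close>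
    by (intro set_integral_diff(2)[symmetric] set_integrable_Ioc_bounded[where B="\<kappa> * (a + B)"] meas)
       (auto intro: emeasure_lborel_Ioc_finite[unfolded infinity_ennreal_def])
  also have "\<bar>\<dots>\<bar> \<le> \<kappa> * (a + B) * measure lborel {s<..t}"
    using st u by (intro set_integral_Ioc_bound meas) (auto intro: emeasure_lborel_Ioc_finite[unfolded infinity_ennreal_def])
  finally have 1: "\<bar>(LBINT r:{0<..t}. \<kappa> * (a - h r)) - (LBINT r:{0<..s}. \<kappa> * (a - h r))\<bar> \<le> \<kappa> * (a + B) * (t - s)"
    using st by simp
  have v: "\<bar>sqrt (h r)\<bar> \<le> sqrt B" if "r \<in> {0<..t}" for r
    using hB[OF that] by auto
  have "stieltjes_integral (\<lambda>r. sqrt (h r)) G t - stieltjes_integral (\<lambda>r. sqrt (h r)) G s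
      = stieltjes_integral (\<lambda>r. sqrt (h r) - (if r \<le> s then sqrt (h r) else 0)) G t"
    unfolding stieltjes_integral_cut[OF st(2)] using v \<open>0 \<le> B\<close>
    by (intro stieltjes_integral_diff[where B="sqrt B"] meas) auto
  also have "\<bar>\<dots>\<bar> \<le> sqrt B * (total_variation G t - total_variation G s)"
    using st v by (intro stieltjes_integral_bound meas) auto
  finally have 2: "\<sigma> * \<bar>stieltjes_integral (\<lambda>r. sqrt (h r)) G t - stieltjes_integral (\<lambda>r. sqrt (h r)) G s\<bar>
      \<le> \<sigma> * (sqrt B * (total_variation G t - total_variation G s))"
    using params by (intro mult_left_mono) auto
  have "\<bar>\<Phi> h t - \<Phi> h s\<bar> \<le> \<bar>(LBINT r:{0<..t}. \<kappa> * (a - h r)) - (LBINT r:{0<..s}. \<kappa> * (a - h r))\<bar>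
      + \<bar>\<theta> * (g t - g s)\<bar>
      + \<bar>\<sigma> * (stieltjes_integral (\<lambda>r. sqrt (h r)) G t - stieltjes_integral (\<lambda>r. sqrt (h r)) G s)\<bar>"
    unfolding rhs_Ioc by (simp add: right_diff_distrib)
  also have "\<dots> \<le> \<kappa> * (a + B) * (t - s) + \<theta> * (g t - g s)
      + \<sigma> * (sqrt B * (total_variation G t - total_variation G s))"
    using 1 2 params g_le[OF st] by (intro add_mono) (simp_all add: abs_mult)
  also have "\<dots> \<le> \<kappa> * (a + B) * (A t - A s) + \<theta> * (A t - A s) + \<sigma> * (sqrt B * (A t - A s))"
    using clock_bounds[OF st] params \<open>0 \<le> B\<close> by (intro add_mono mult_left_mono) auto
  finally show ?thesis
    by (simp add: max_speed_def algebra_simps)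
qed

text \<open>Lipschitz continuity with respect to the clock. It provides left limits and
  right-continuity, and with a fixed constant it survives pointwise limits.\<close>

definition controlled :: "real \<Rightarrow> real \<Rightarrow> (real \<Rightarrow> real) \<Rightarrow> bool" where
  "controlled b K x \<longleftrightarrow> (\<forall>s t. 0 \<le> s \<longrightarrow> s \<le> t \<longrightarrow> t \<le> b \<longrightarrow> \<bar>x t - x s\<bar> \<le> K * (A t - A s))"

lemma controlledD:
  "controlled b K x \<Longrightarrow> 0 \<le> s \<Longrightarrow> s \<le> t \<Longrightarrow> t \<le> b \<Longrightarrow> \<bar>x t - x s\<bar> \<le> K * (A t - A s)"
  by (auto simp: controlled_def)

text \<open>\<open>x\<close> is the difference of the two nondecreasing functions
  \<open>x + K * A\<close> and \<open>K * A\<close>, each of which has left limits.\<close>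

lemma controlled_left_limit:
  assumes "controlled b K x" "0 \<le> K" "0 < t" "t \<le> b"
  shows "\<exists>l. (x \<longlongrightarrow> l) (at_left t)"
proof -
  have "mono_on {0..t} (\<lambda>s. x s + K * A s)"
    using controlledD[OF assms(1)] assms(4) by (intro mono_onI) (fastforce simp: algebra_simps abs_le_iff)
  moreover have "mono_on {0..t} (\<lambda>s. K * A s)"
    using clock_mono assms(2) by (intro mono_onI mult_left_mono) auto
  ultimately obtain l l' where "((\<lambda>s. x s + K * A s) \<longlongrightarrow> l) (at_left t)" "((\<lambda>s. K * A s) \<longlongrightarrow> l') (at_left t)"
    using mono_on_left_limit \<open>0 < t\<close> by blast
  then have "((\<lambda>s. (x s + K * A s) - K * A s) \<longlongrightarrow> l - l') (at_left t)"
    by (rule tendsto_diff)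
  then show ?thesis by auto
qed

lemma controlled_right_cont:
  assumes "controlled b K x" "0 \<le> t" "t < b"
  shows "continuous (at_right t) x"
proof -
  have "(x \<longlongrightarrow> x t) (at_right t)"
  proof (rule Lim_null_comparison[THEN LIM_zero_cancel])
    show "((\<lambda>s. K * (A s - A t)) \<longlongrightarrow> 0) (at_right t)"
      using tendsto_mult_right_zero[OF LIM_zero[OF right_cont_clock[OF assms(2)]]] by simp
    show "\<forall>\<^sub>F s in at_right t. norm (x s - x t) \<le> K * (A s - A t)"
      using eventually_at_right_real[OF assms(3)]
      by eventually_elim (use controlledD[OF assms(1)] assms in auto)
  qed
  then show ?thesis by (simp add: continuous_within)
qed

abbreviation "K \<equiv> max_speed \<kappa> a \<theta> \<sigma> (3 * x0 / 2)"
abbreviation "L \<equiv> sqrt_lipschitz \<kappa> \<sigma> (x0 / 2)"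

lemma K_pos: "0 < K" and sqrt_lipschitz_pos: "0 < m \<Longrightarrow> 0 < sqrt_lipschitz \<kappa> \<sigma> m"
  using params by (auto simp: max_speed_def sqrt_lipschitz_def intro!: add_pos_nonneg add_nonneg_pos)

lemma threshold_pos: "0 < threshold \<kappa> a \<theta> \<sigma> x0"
  using K_pos sqrt_lipschitz_pos[of "x0/2"] params by (simp add: threshold_def)

lemma measurable_clamp_left_lim:
  assumes "controlled b C x" "0 \<le> C" "t \<le> b"
  shows "(\<lambda>s. clamp x0 (left_lim x s)) \<in> borel_measurable (restrict_space borel {0<..t})"
  using measurable_compose[OF measurable_left_lim measurable_clamp, of t x]
    controlled_left_limit[OF assms(1,2)] assms(3) by auto

text \<open>The clamp bounds the integrand by 3 * x0 / 2 whatever the previous iterate does, so one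
  speed serves all iterates, on intervals of any length.\<close>

lemma controlled_picard: "controlled b K (pic n)"
proof (induction n)
  case 0
  then show ?case
    using K_pos clock_mono by (simp add: controlled_def)
next
  case (Suc n)
  show ?case
    unfolding controlled_def
  proof (intro allI impI)
    fix s t assume st: "0 \<le> s" "s \<le> t" "t \<le> b"
    show "\<bar>pic (Suc n) t - pic (Suc n) s\<bar> \<le> K * (A t - A s)"
      unfolding picard.simps
      using st clamp_bounds[of x0] params measurable_clamp_left_lim[OF Suc _ st(3)] K_pos
      by (intro rhs_increment) (auto intro: order.trans[of 0 "x0 / 2"])
  qed
qed

lemma picard_0: "pic n 0 = x0"
  by (cases n) (simp_all add: rhs_0)

text \<open>The contraction step. Only left limits enter the right-hand side, so closeness of
  \<open>x\<close> and \<open>y\<close> strictly before t controls the values at t, a jump at t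
  included.\<close>

lemma rhs_clamp_diff:
  assumes x: "controlled t K x" and y: "controlled t K y" and "0 \<le> t" "0 \<le> d"
    and d: "\<And>r. 0 \<le> r \<Longrightarrow> r < t \<Longrightarrow> \<bar>x r - y r\<bar> \<le> d"
    and thr: "A t < threshold \<kappa> a \<theta> \<sigma> x0"
  shows "\<bar>\<Phi> (\<lambda>s. clamp x0 (left_lim x s)) t - \<Phi> (\<lambda>s. clamp x0 (left_lim y s)) t\<bar> \<le> d / 2"
proof -
  have "\<bar>\<Phi> (\<lambda>s. clamp x0 (left_lim x s)) t - \<Phi> (\<lambda>s. clamp x0 (left_lim y s)) t\<bar> \<le> L * d * (A t - A 0)"
  proof (rule rhs_diff)
    fix r assume r: "r \<in> {0<..t}"
    have "\<bar>left_lim x r - left_lim y r\<bar> \<le> d"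
      using r d K_pos by (intro left_lim_diff_le[of 0] controlled_left_limit[OF x] controlled_left_limit[OF y]) auto
    then show "\<bar>clamp x0 (left_lim x r) - clamp x0 (left_lim y r)\<bar> \<le> d"
      using clamp_diff_le order.trans by blast
    show "x0 / 2 \<le> clamp x0 (left_lim x r) \<and> clamp x0 (left_lim x r) \<le> 3 * x0 / 2"
      using clamp_bounds params by auto
    show "0 \<le> clamp x0 (left_lim y r) \<and> clamp x0 (left_lim y r) \<le> 3 * x0 / 2"
      using clamp_bounds[of x0 "left_lim y r"] params by auto
  qed (use x y params K_pos \<open>0 \<le> t\<close> in \<open>auto intro!: measurable_clamp_left_lim\<close>)
  also have "\<dots> = d * (L * A t)" by (simp add: clock_0)
  also have "\<dots> \<le> d * (1 / 2)"
  proof (rule mult_left_mono[OF _ \<open>0 \<le> d\<close>])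
    have "L * A t \<le> L * (1 / (2 * L))"
      using thr sqrt_lipschitz_pos[of "x0/2"] params by (intro mult_left_mono) (auto simp: threshold_def)
    then show "L * A t \<le> 1 / 2" using sqrt_lipschitz_pos[of "x0/2"] params by simp
  qed
  finally show ?thesis by simp
qed

section \<open>Convergence of the iterates below the threshold\<close>

definition sol :: "real \<Rightarrow> real" where
  "sol t = lim (\<lambda>n. pic n t)"

context
  fixes b :: real
  assumes b: "0 \<le> b" "A b < threshold \<kappa> a \<theta> \<sigma> x0"
begin

lemma clock_lt_threshold: "0 \<le> r \<Longrightarrow> r \<le> b \<Longrightarrow> A r < threshold \<kappa> a \<theta> \<sigma> x0"
  using b clock_mono[of r b] by simp

lemma controlled_near_start:
  assumes x: "controlled b K x" and "x 0 = x0" "0 \<le> r" "r \<le> b"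
  shows "\<bar>x r - x0\<bar> \<le> x0 / 2"
proof -
  have "\<bar>x r - x0\<bar> \<le> K * A r"
    using controlledD[OF x, of 0 r] assms by (simp add: clock_0)
  also have "\<dots> \<le> K * (x0 / (2 * K))"
    using clock_lt_threshold[of r] assms K_pos by (intro mult_left_mono) (auto simp: threshold_def)
  finally show ?thesis using K_pos by simp
qed

lemma picard_step: "0 \<le> r \<Longrightarrow> r \<le> b \<Longrightarrow> \<bar>pic (Suc n) r - pic n r\<bar> \<le> x0 / 2 * (1/2)^n"
proof (induction n arbitrary: r)
  case 0
  then show ?case
    using controlled_near_start[OF controlled_picard[of b "Suc 0"] picard_0] by simp
next
  case (Suc n)
  have "\<bar>pic (Suc (Suc n)) r - pic (Suc n) r\<bar> \<le> x0 / 2 * (1/2)^n / 2"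
    \<comment> \<open>The second rewriting is applied at the argument \<open>r\<close>: it opens
      \<open>pic (Suc n) r\<close> but leaves the unapplied \<open>pic (Suc n)\<close> under
      \<open>left_lim\<close> untouched.\<close>
    unfolding picard.simps(2)[of _ _ _ _ _ _ _ "Suc n"]
    unfolding picard.simps(2)[of _ _ _ _ _ _ _ n, THEN fun_cong, of _ _ _ _ _ _ _ r]
    using Suc clock_lt_threshold params by (intro rhs_clamp_diff controlled_picard) auto
  then show ?case by simp
qed

lemma
  assumes "0 \<le> r" "r \<le> b"
  shows picard_tendsto: "(\<lambda>n. pic n r) \<longlonglongrightarrow> sol r"
    and sol_picard_le: "\<bar>sol r - pic n r\<bar> \<le> x0 * (1/2)^n"
  using half_geometric_limit[of "\<lambda>n. pic n r" "x0 / 2"] picard_step[OF assms]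
  unfolding sol_def by auto

lemma controlled_sol: "controlled b K sol"
  unfolding controlled_def
proof (intro allI impI)
  fix s t assume st: "0 \<le> s" "s \<le> t" "t \<le> b"
  show "\<bar>sol t - sol s\<bar> \<le> K * (A t - A s)"
  proof (rule tendsto_upperbound)
    show "(\<lambda>n. \<bar>pic n t - pic n s\<bar>) \<longlonglongrightarrow> \<bar>sol t - sol s\<bar>"
      using st by (intro tendsto_intros picard_tendsto) auto
  qed (use controlledD[OF controlled_picard st] in auto)
qed

lemma sol_0: "sol 0 = x0"
  using picard_tendsto[of 0] b by (simp add: picard_0 LIMSEQ_const_iff)

lemma sol_bounds: "0 \<le> r \<Longrightarrow> r \<le> b \<Longrightarrow> x0 / 2 \<le> sol r \<and> sol r \<le> 3 * x0 / 2"
  using controlled_near_start[OF controlled_sol sol_0, of r] by linarith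

lemma sol_left_lim_bounds:
  assumes "0 < r" "r \<le> b"
  shows "x0 / 2 \<le> left_lim sol r" "left_lim sol r \<le> 3 * x0 / 2"
  using left_lim_bounds[OF controlled_left_limit[OF controlled_sol _ assms] assms(1), of "x0/2" "3 * x0/2"]
    sol_bounds assms K_pos by auto

text \<open>Applied to \<open>pic n\<close> and \<open>sol\<close>, the contraction estimate makes
  \<open>sol\<close> a fixed point of the clamped map. The left limits of \<open>sol\<close> stay
  inside the clamp, so the clamp disappears.\<close>

lemma sol_rhs: "sol b = \<Phi> (left_lim sol) b"
proof -
  have "\<Phi> (left_lim sol) b = \<Phi> (\<lambda>s. clamp x0 (left_lim sol s)) b"
    using sol_left_lim_bounds by (intro rhs_cong clamp_id[symmetric]) auto
  moreover have "(\<lambda>n. pic (Suc n) b) \<longlonglongrightarrow> \<Phi> (\<lambda>s. clamp x0 (left_lim sol s)) b"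
  proof (rule Lim_null_comparison[THEN LIM_zero_cancel])
    show "\<forall>\<^sub>F n in sequentially. norm (pic (Suc n) b - \<Phi> (\<lambda>s. clamp x0 (left_lim sol s)) b) \<le> x0 * (1/2)^n / 2"
    proof (intro always_eventually allI)
      fix n
      show "norm (pic (Suc n) b - \<Phi> (\<lambda>s. clamp x0 (left_lim sol s)) b) \<le> x0 * (1/2)^n / 2"
        unfolding picard.simps real_norm_def using b sol_picard_le[of _ n] params
        by (intro rhs_clamp_diff controlled_picard controlled_sol) (auto simp: abs_minus_commute)
    qed
    show "(\<lambda>n. x0 * (1/2)^n / 2) \<longlonglongrightarrow> 0"
      using tendsto_mult_right_zero[OF LIMSEQ_realpow_zero[of "1/2"], of "x0/2"] by simp
  qed
  moreover have "(\<lambda>n. pic (Suc n) b) \<longlonglongrightarrow> sol b"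
    using picard_tendsto[of b] b by (intro LIMSEQ_Suc) auto
  ultimately show ?thesis
    using LIMSEQ_unique by metis
qed

end

lemma sol_until:
  assumes T: "\<And>t. 0 \<le> t \<Longrightarrow> ennreal t < T \<Longrightarrow> A t < threshold \<kappa> a \<theta> \<sigma> x0"
  shows "cadlag_until T sol" "solves_until \<kappa> a \<theta> \<sigma> x0 g G T sol"
    "\<And>t. 0 \<le> t \<Longrightarrow> ennreal t < T \<Longrightarrow> x0 / 2 \<le> sol t \<and> sol t \<le> 3 * x0 / 2"
proof -
  show "cadlag_until T sol"
    unfolding cadlag_until_def
  proof (intro allI impI conjI)
    fix t :: real assume t: "0 \<le> t" "ennreal t < T"
    \<comment> \<open>Right-continuity at t needs control beyond t, hence a real \<open>b\<close>
      strictly between t and \<open>T\<close>; it also covers an infinite \<open>T\<close>.\<close>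
    then obtain u where u: "ennreal t < u" "u < T" using dense by blast
    then obtain b where "u = ennreal b" "0 \<le> b" by (cases u) auto
    with u t have b: "0 \<le> b" "t < b" "ennreal b < T" by (auto simp: ennreal_less_iff)
    show "continuous (at_right t) sol"
      using controlled_right_cont[OF controlled_sol[OF b(1) T[OF b(1,3)]] t(1) b(2)] .
    assume "0 < t"
    then show "\<exists>l. (sol \<longlongrightarrow> l) (at_left t)"
      using controlled_left_limit[OF controlled_sol[OF b(1) T[OF b(1,3)]]] K_pos b by auto
  qed
  show "solves_until \<kappa> a \<theta> \<sigma> x0 g G T sol"
    unfolding solves_until_rhs using sol_rhs T sol_left_lim_bounds(1) params
    by (meson order.trans half_gt_zero less_imp_le order_refl)
  show "\<And>t. 0 \<le> t \<Longrightarrow> ennreal t < T \<Longrightarrow> x0 / 2 \<le> sol t \<and> sol t \<le> 3 * x0 / 2"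
    using sol_bounds T by (meson order_refl)
qed

end

section \<open>Uniqueness along one pair of driving paths\<close>

context driven_equation
begin

text \<open>Consider the infimum \<open>t0\<close> of the times of disagreement. The solutions still
  agree at \<open>t0\<close>, and right after it the clock grows so little that any bound on their
  distance can be halved indefinitely.\<close>

lemma solution_unique:
  assumes x: "solves_until \<kappa> a \<theta> \<sigma> x0 g G T x" "cadlag_until T x"
    and y: "solves_until \<kappa> a \<theta> \<sigma> x0 g G T' y" "cadlag_until T' y"
    and "0 < m" and bnd: "\<And>t. 0 \<le> t \<Longrightarrow> ennreal t < T \<Longrightarrow> m \<le> x t \<and> x t \<le> B"
    and t: "0 \<le> t" "ennreal t < min T T'"
  shows "y t = x t"
proof (rule ccontr)
  assume "y t \<noteq> x t"
  define N where "N = {s. 0 \<le> s \<and> s \<le> t \<and> y s \<noteq> x s}"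
  have "t \<in> N" using \<open>y t \<noteq> x t\<close> t by (simp add: N_def)
  have before: "ennreal s < T \<and> ennreal s < T'" if "s \<le> t" for s
    using t(2) that by (auto intro: le_less_trans[OF ennreal_leI])
  note eqs = x(1)[unfolded solves_until_rhs, rule_format] y(1)[unfolded solves_until_rhs, rule_format]
  have xlim: "\<exists>l. (x \<longlongrightarrow> l) (at_left s)" and ylim: "\<exists>l. (y \<longlongrightarrow> l) (at_left s)"
    if "0 < s" "s \<le> t" for s
    using x(2) y(2) before[OF that(2)] that unfolding cadlag_until_def by auto
  define t0 where "t0 = Inf N"
  have "bdd_below N" by (auto simp: N_def intro: bdd_belowI[of _ 0])
  have t0: "0 \<le> t0" "t0 \<le> t"
    unfolding t0_def using \<open>t \<in> N\<close> \<open>bdd_below N\<close>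
    by (auto simp: N_def intro!: cInf_greatest cInf_lower)
  have eq_before: "y s = x s" if "0 \<le> s" "s < t0" for s
    using that t0 cInf_lower[OF _ \<open>bdd_below N\<close>, of s] by (force simp: N_def t0_def)
  have ll_eq: "left_lim y s = left_lim x s" if "0 < s" "s \<le> t0" for s
    using eq_before that by (intro left_lim_cong[of 0]) auto
  \<comment> \<open>The values at \<open>t0\<close> are determined by left limits on (0, t0], where
    the two solutions already agree; a jump at \<open>t0\<close> cannot separate them.\<close>
  have "y t0 = x t0"
    using eqs[OF t0(1)] before[OF t0(2)] ll_eq rhs_cong[of t0 "left_lim y" "left_lim x"] by auto
  have "t0 < t"
    using t0 \<open>y t0 = x t0\<close> \<open>y t \<noteq> x t\<close> by (cases "t0 = t") auto
  define C where "C = sqrt_lipschitz \<kappa> \<sigma> m"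
  have "0 < C" using sqrt_lipschitz_pos[OF \<open>0 < m\<close>] by (simp add: C_def)
  have "(y \<longlongrightarrow> y t0) (at_right t0)"
    using y(2) before[OF t0(2)] t0 unfolding cadlag_until_def by (auto simp: continuous_within)
  then have "\<forall>\<^sub>F s in at_right t0. dist (y s) (y t0) < 1"
    by (rule tendstoD) simp
  moreover have "\<forall>\<^sub>F s in at_right t0. dist (A s) (A t0) < 1 / (2 * C)"
    using \<open>0 < C\<close> by (intro tendstoD right_cont_clock t0) auto
  moreover have "\<forall>\<^sub>F s in at_right t0. s \<in> {t0<..<t}"
    using eventually_at_right_real[OF \<open>t0 < t\<close>] .
  ultimately have "\<forall>\<^sub>F s in at_right t0. \<bar>y s - y t0\<bar> < 1 \<and> \<bar>A s - A t0\<bar> < 1 / (2 * C) \<and> s < t"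
    by eventually_elim (auto simp: dist_real_def)
  then obtain v where v: "t0 < v"
    and near: "\<And>s. t0 < s \<Longrightarrow> s < v \<Longrightarrow> \<bar>y s - y t0\<bar> < 1 \<and> \<bar>A s - A t0\<bar> < 1 / (2 * C) \<and> s < t"
    by (auto simp: eventually_at_right[OF \<open>t0 < t\<close>])
  \<comment> \<open>Before \<open>t0\<close> the path \<open>y\<close> equals \<open>x\<close> and
    lies below \<open>B\<close>; after \<open>t0\<close> right-continuity keeps it within 1 of its
    value there. A common upper bound is required by \<open>rhs_diff\<close>.\<close>
  define B' where "B' = max B (\<bar>y t0\<bar> + 1)"
  have ybnd: "y s \<le> B'" if "0 \<le> s" "s < v" for s
  proof (cases "s < t0")
    case True
    then show ?thesis
      using eq_before[of s] bnd[of s] before[of s] t0 that by (auto simp: B'_def max.coboundedI1)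
  next
    case False
    then show ?thesis
      using near[of s] that by (cases "s = t0") (auto simp: B'_def)
  qed
  \<comment> \<open>Past \<open>t0\<close> the clock increases by less than 1 / (2 * C), so
    \<open>rhs_diff\<close> started at \<open>t0\<close> improves any bound d to d / 2.\<close>
  have halve: "\<bar>x s - y s\<bar> \<le> d / 2"
    if d: "\<And>s. s \<in> {t0<..<v} \<Longrightarrow> \<bar>x s - y s\<bar> \<le> d" and s: "s \<in> {t0<..<v}" for d s
  proof -
    have st: "s < t" "0 < s" using near[of s] s t0 by auto
    have "\<bar>\<Phi> (left_lim x) s - \<Phi> (left_lim y) s\<bar> \<le> C * d * (A s - A t0)"
      unfolding C_def
    proof (rule rhs_diff[where B=B'])
      show "left_lim x \<in> borel_measurable (restrict_space borel {0<..s})"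
        using st by (intro measurable_left_lim xlim) auto
      show "left_lim y \<in> borel_measurable (restrict_space borel {0<..s})"
        using st by (intro measurable_left_lim ylim) auto
      fix r assume r: "r \<in> {0<..s}"
      have "m \<le> left_lim x r" "left_lim x r \<le> B"
        using r st bnd before by (auto intro!: left_lim_bounds[where s=0 and m=m and B=B, OF xlim])
      then show "m \<le> left_lim x r \<and> left_lim x r \<le> B'"
        by (auto simp: B'_def)
      have "left_lim y r \<le> B'"
      proof (rule tendsto_upperbound[OF left_lim_tendsto[OF ylim]])
        show "\<forall>\<^sub>F q in at_left r. y q \<le> B'"
          using eventually_at_left_real[of 0 r] r s
          by (auto elim!: eventually_mono intro!: ybnd)
      qed (use r st in auto)
      then show "0 \<le> left_lim y r \<and> left_lim y r \<le> B'"
        using eqs(2)[of r] before[of r] r st by auto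
    next
      fix r assume r: "r \<in> {t0<..s}"
      show "\<bar>left_lim x r - left_lim y r\<bar> \<le> d"
        using r s st t0 by (intro left_lim_diff_le[of t0] xlim ylim d) auto
    qed (use t0 s ll_eq \<open>0 < m\<close> in auto)
    also have "\<dots> \<le> C * d * (1 / (2 * C))"
    proof (intro mult_left_mono)
      show "0 \<le> C * d"
        using d[OF s] \<open>0 < C\<close> by (intro mult_nonneg_nonneg) (auto intro: order.trans[OF abs_ge_zero])
    qed (use near[of s] s in auto)
    finally show ?thesis
      using eqs[of s] before[of s] st \<open>0 < C\<close> by auto
  qed
  \<comment> \<open>The initial bound adds the size of \<open>x\<close>, which lies between 0 and
    \<open>B\<close>, to that of \<open>y\<close>, which is within 1 of \<open>y t0\<close>.\<close>
  have "\<bar>x s - y s\<bar> \<le> (\<bar>B\<bar> + \<bar>y t0\<bar> + 1) / 2^n" if "s \<in> {t0<..<v}" for s n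
    using that
  proof (induction n arbitrary: s)
    case 0
    then show ?case
      using near[of s] bnd[of s] before[of s] t0 \<open>0 < m\<close> by auto
  next
    case (Suc n)
    then show ?case using halve[of "(\<bar>B\<bar> + \<bar>y t0\<bar> + 1) / 2^n" s] by simp
  qed
  moreover have "(\<lambda>n. (\<bar>B\<bar> + \<bar>y t0\<bar> + 1) / 2^n) \<longlonglongrightarrow> 0"
    using tendsto_mult_right_zero[OF LIMSEQ_realpow_zero[of "1/2"], of "\<bar>B\<bar> + \<bar>y t0\<bar> + 1"]
    by (simp add: power_one_over)
  ultimately have eq_after: "y s = x s" if "s \<in> {t0<..<v}" for s
    using LIMSEQ_le_const[of "\<lambda>n. (\<bar>B\<bar> + \<bar>y t0\<bar> + 1) / 2^n" 0 "\<bar>x s - y s\<bar>"] that by auto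
  \<comment> \<open>Since \<open>v\<close> exceeds the infimum, some time of disagreement lies
    before \<open>v\<close>, in the range where equality has been established.\<close>
  obtain s where "s \<in> N" "s < v"
    using v cInf_lessD[of N v] \<open>t \<in> N\<close> by (auto simp: t0_def)
  moreover have "t0 \<le> s"
    unfolding t0_def using \<open>s \<in> N\<close> \<open>bdd_below N\<close> by (rule cInf_lower)
  ultimately show False
    using eq_after[of s] \<open>y t0 = x t0\<close> by (cases "s = t0") (auto simp: N_def)
qed

end

section \<open>Paths that are the sum of their jumps\<close>

lemma sqrt_sum_le: "finite F \<Longrightarrow> (\<And>i. i \<in> F \<Longrightarrow> 0 \<le> f i) \<Longrightarrow> sqrt (sum f F) \<le> (\<Sum>i\<in>F. sqrt (f i))"
proof (induction F rule: finite_induct)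
  case (insert x F)
  have "sqrt (sum f (insert x F)) = sqrt (f x + sum f F)"
    using insert by simp
  also have "\<dots> \<le> sqrt (f x) + sqrt (sum f F)"
    using insert by (intro sqrt_add_le_add_sqrt sum_nonneg) auto
  finally show ?case using insert by simp
qed simp

text \<open>Bounds the square root by countably many indicators of {x > b}, the only quantities
  whose expected counts are read off the Levy measure. Values up to 1 use the powers of 1/4, whose
  square roots are the weights; larger values use the integers, because sqrt x is at most x
  there.\<close>

lemma sqrt_le_layers:
  assumes "0 \<le> x"
  shows "ennreal (sqrt x) \<le> (\<Sum>k. ennreal ((1/2)^k) * indicator {(1/4)^Suc k<..} x) + (\<Sum>k. indicator {real (Suc k)<..} x)"
    (is "_ \<le> ?P + ?Q")
proof -
  have P_ge: "ennreal ((1/2)^k) * indicator {(1/4)^Suc k<..} x \<le> ?P" for k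
  proof -
    define f where "f k = (ennreal ((1/2)^k) * indicator {(1/4)^Suc k<..} x)" for k :: nat
    have "f k = sum f {k}" by simp
    also have "\<dots> \<le> suminf f" by (intro sum_le_suminf) auto
    finally show ?thesis by (simp only: f_def[abs_def])
  qed
  consider "x = 0" | "0 < x" "x \<le> 1" | "1 < x" using assms by linarith
  then show ?thesis
  proof cases
    case 2
    \<comment> \<open>A k at which \<open>P\<close> turns true brackets x between consecutive powers
      of 1/4.\<close>
    define P where "P k \<longleftrightarrow> (1/4)^k < x" for k :: nat
    obtain k0 where "P k0"
      using real_arch_pow_inv[of x "1/4"] 2 by (auto simp: P_def)
    moreover have "\<not> P 0" using 2 by (simp add: P_def)
    ultimately have "\<exists>k. \<not> P k \<and> P (Suc k)"
      by (induction k0) auto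
    then obtain k where k: "\<not> P k" "P (Suc k)" by blast
    have "sqrt x \<le> sqrt ((1/4)^k)"
      using k by (simp add: P_def)
    also have "\<dots> = (1/2)^k"
    proof -
      have "(1/4::real)^k = ((1/2)^k)\<^sup>2"
        by (simp add: power2_eq_square flip: power_mult_distrib)
      then show ?thesis by simp
    qed
    finally have "ennreal (sqrt x) \<le> ennreal ((1/2)^k) * indicator {(1/4)^Suc k<..} x"
      using k by (simp add: P_def ennreal_leI)
    also have "\<dots> \<le> ?P + ?Q"
      using P_ge[of k] by (rule order.trans) simp
    finally show ?thesis .
  next
    case 3
    \<comment> \<open>The largest integer strictly below x: each of 1, ..., n then counts in the
      second series, and the term k = 0 of the first series supplies the missing 1.\<close>
    define n where "n = nat (\<lceil>x\<rceil> - 1)"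
    have n: "real n < x" "x \<le> real n + 1"
      using 3 unfolding n_def by linarith+
    have "ennreal (sqrt x) \<le> ennreal (1 + real n)"
    proof (rule ennreal_leI)
      have "sqrt x \<le> sqrt (x * x)" using 3 by (intro real_sqrt_le_mono) auto
      then show "sqrt x \<le> 1 + real n" using n 3 by simp
    qed
    also have "\<dots> = 1 + (\<Sum>k<n. 1)" by (simp add: ennreal_of_nat_eq_real_of_nat)
    also have "\<dots> = 1 + (\<Sum>k<n. indicator {real (Suc k)<..} x)"
    proof -
      have "real (Suc k) < x" if "k < n" for k using that n by linarith
      then show ?thesis by simp
    qed
    also have "\<dots> \<le> ?P + ?Q"
    proof (rule add_mono)
      show "1 \<le> ?P" using P_ge[of 0] 3 by simp
      show "(\<Sum>k<n. indicator {real (Suc k)<..} x) \<le> ?Q"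
        by (rule sum_le_suminf) auto
    qed
    finally show ?thesis .
  qed simp
qed

text \<open>The index \<open>i\<close> of the dyadic cell \<open>(i / 2^n, (i + 1) / 2^n]\<close> containing \<open>s\<close>.\<close>

definition cell :: "nat \<Rightarrow> real \<Rightarrow> nat" where
  "cell n s = nat (\<lceil>2^n * s\<rceil> - 1)"

lemma cell_bounds:
  assumes "s \<in> {0<..1}"
  shows "cell n s < 2^n" "s \<in> {real (cell n s) / 2^n<..real (Suc (cell n s)) / 2^n}"
proof -
  have "0 < 2^n * s" "2^n * s \<le> 2^n"
    using assms by auto
  then have "1 \<le> \<lceil>2^n * s\<rceil>" "\<lceil>2^n * s\<rceil> \<le> 2^n"
    by (auto simp: ceiling_le_iff intro: order.trans[of 1 "\<lceil>2^n * s\<rceil>"])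
  then have c: "\<lceil>2^n * s\<rceil> = int (cell n s) + 1" "cell n s < 2^n"
    by (auto simp: cell_def nat_less_iff)
  then show "cell n s < 2^n" "s \<in> {real (cell n s) / 2^n<..real (Suc (cell n s)) / 2^n}"
    by (auto simp: ceiling_eq_iff field_simps)
qed

lemma cell_unique: "s \<in> {real i / 2^n<..real (Suc i) / 2^n} \<Longrightarrow> cell n s = i"
proof -
  assume "s \<in> {real i / 2^n<..real (Suc i) / 2^n}"
  then have "\<lceil>2^n * s\<rceil> = int i + 1"
    by (auto simp: ceiling_eq_iff field_simps)
  then show ?thesis by (simp add: cell_def)
qed

text \<open>Points more than 2^-n apart cannot share a cell, and a finite set has only finitely many
  pairs to separate.\<close>

lemma eventually_inj_cell:
  assumes "finite X" "X \<subseteq> {0<..1}"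
  shows "\<forall>\<^sub>F n in sequentially. inj_on (cell n) X"
proof -
  have "\<forall>\<^sub>F n in sequentially. cell n s \<noteq> cell n s'" if "s \<in> X" "s' \<in> X" "s \<noteq> s'" for s s'
  proof -
    have "(\<lambda>n. (1/2::real)^n) \<longlonglongrightarrow> 0" by (rule LIMSEQ_realpow_zero) auto
    then have "\<forall>\<^sub>F n in sequentially. (1/2)^n < \<bar>s - s'\<bar>"
      by (rule order_tendstoD(2)) (use that in auto)
    then show ?thesis
    proof eventually_elim
      case (elim n)
      show ?case
      proof
        assume eq: "cell n s = cell n s'"
        have 1: "s \<in> {real (cell n s) / 2^n<..real (Suc (cell n s)) / 2^n}"
          "s' \<in> {real (cell n s) / 2^n<..real (Suc (cell n s)) / 2^n}"
          using cell_bounds(2)[of s n] cell_bounds(2)[of s' n] that assms(2) eq by auto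
        have "real (Suc (cell n s)) / 2^n = real (cell n s) / 2^n + (1/2)^n"
          by (simp add: add_divide_distrib power_one_over)
        then show False using 1 elim by (auto simp: abs_less_iff)
      qed
    qed
  qed
  then have "\<forall>\<^sub>F n in sequentially. \<forall>s\<in>X. \<forall>s'\<in>X. s \<noteq> s' \<longrightarrow> cell n s \<noteq> cell n s'"
    using assms(1) by (intro eventually_ball_finite ballI) (auto intro: eventually_mono)
  then show ?thesis
    by eventually_elim (auto simp: inj_on_def)
qed

section \<open>Comparing jumps with dyadic increments\<close>

definition increment :: "(real \<Rightarrow> real) \<Rightarrow> nat \<Rightarrow> nat \<Rightarrow> real" where
  "increment u n i = u (real (Suc i) / 2^n) - u (real i / 2^n)"

definition big_increments :: "(real \<Rightarrow> real) \<Rightarrow> real \<Rightarrow> nat \<Rightarrow> nat set" where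
  "big_increments u b n = {i. i < 2^n \<and> b < increment u n i}"

definition big_jumps :: "(real \<Rightarrow> real) \<Rightarrow> real \<Rightarrow> real set" where
  "big_jumps u b = {t\<in>{0<..1}. b < jump u t}"

locale jump_path =
  fixes u :: "real \<Rightarrow> real"
  assumes mono_u: "mono_on {0..} u"
    and sum_jumps: "\<And>t. 0 \<le> t \<Longrightarrow> (jump u has_sum u t) {0<..t}"
begin

lemma jump_le_increment:
  assumes "0 \<le> s" "s < t" "t \<le> r"
  shows "jump u t \<le> u r - u s"
proof -
  have "\<exists>l. (u \<longlongrightarrow> l) (at_left t)"
    using assms by (intro mono_on_left_limit mono_on_subset[OF mono_u]) auto
  then have "u s \<le> left_lim u t"
    using eventually_at_left_real[of s t] assms mono_u
    by (intro tendsto_lowerbound[OF left_lim_tendsto]) (auto elim!: eventually_mono intro: mono_onD)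
  moreover have "u t \<le> u r"
    using assms mono_u by (auto intro: mono_onD)
  ultimately show ?thesis by (simp add: jump_def)
qed

lemma jump_nonneg:
  assumes "0 < t"
  shows "0 \<le> jump u t"
proof -
  have "\<exists>l. (u \<longlongrightarrow> l) (at_left t)"
    using assms by (intro mono_on_left_limit mono_on_subset[OF mono_u]) auto
  then have "left_lim u t \<le> u t"
    using eventually_at_left_real[of 0 t] assms mono_u
    by (intro tendsto_upperbound[OF left_lim_tendsto]) (auto elim!: eventually_mono intro: mono_onD)
  then show ?thesis by (simp add: jump_def)
qed

lemma increment_has_sum:
  assumes "0 \<le> s" "s \<le> t"
  shows "(jump u has_sum (u t - u s)) {s<..t}"
proof -
  have "(jump u has_sum (u t - u s)) ({0<..t} - {0<..s})"
    using assms by (intro has_sum_Diff sum_jumps) auto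
  moreover have "{0<..t} - {0<..s} = {s<..t}" using assms by auto
  ultimately show ?thesis by simp
qed

lemma sum_jumps_le:
  assumes "0 \<le> s" "s \<le> t" "finite F" "F \<subseteq> {s<..t}"
  shows "sum (jump u) F \<le> u t - u s"
  using assms by (intro finite_sum_le_has_sum[OF increment_has_sum]) (auto intro!: jump_nonneg)

text \<open>Subadditivity of the square root on finite sets of jumps, passed to the limit along
  \<open>has_sum\<close>. The sum over the jumps is an integral over \<open>count_space\<close>,
  which allows the later exchanges with series.\<close>

lemma sqrt_increment_le:
  assumes "0 \<le> s" "s \<le> t"
  shows "ennreal (sqrt (u t - u s)) \<le> (\<integral>\<^sup>+r. ennreal (sqrt (jump u r) * indicator {s<..t} r) \<partial>count_space UNIV)"
    (is "_ \<le> ?R")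
proof (rule tendsto_upperbound)
  show "((\<lambda>F. ennreal (sqrt (sum (jump u) F))) \<longlongrightarrow> ennreal (sqrt (u t - u s))) (finite_subsets_at_top {s<..t})"
    using increment_has_sum[OF assms] unfolding has_sum_def
    by (intro tendsto_ennrealI tendsto_real_sqrt)
  show "\<forall>\<^sub>F F in finite_subsets_at_top {s<..t}. ennreal (sqrt (sum (jump u) F)) \<le> ?R"
  proof (rule eventually_finite_subsets_at_top_weakI)
    fix F assume F: "finite F" "F \<subseteq> {s<..t}"
    have pos: "0 \<le> jump u r" if "r \<in> F" for r
      using that F assms by (intro jump_nonneg) auto
    have "ennreal (sqrt (sum (jump u) F)) \<le> ennreal (\<Sum>r\<in>F. sqrt (jump u r))"
      using F pos by (intro ennreal_leI sqrt_sum_le) auto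
    also have "\<dots> = (\<Sum>r\<in>F. ennreal (sqrt (jump u r)))"
      using pos by (intro sum_ennreal[symmetric]) auto
    also have "\<dots> = (\<integral>\<^sup>+r\<in>F. ennreal (sqrt (jump u r)) \<partial>count_space UNIV)"
      using F(1) by (subst nn_integral_count_space_indicator[symmetric]) (auto simp: nn_integral_count_space_finite)
    also have "\<dots> \<le> ?R"
      using F by (intro nn_integral_mono) (auto simp: indicator_def)
    finally show "ennreal (sqrt (sum (jump u) F)) \<le> ?R" .
  qed
qed simp

text \<open>The dyadic cells partition (0, 1], so every jump is charged to exactly one increment and
  the bound does not depend on n.\<close>

lemma sum_sqrt_increments_le:
  "(\<Sum>i<2^n. ennreal (sqrt (increment u n i)))
    \<le> (\<integral>\<^sup>+r. ennreal (sqrt (jump u r) * indicator {0<..1} r) \<partial>count_space UNIV)"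
proof -
  have "(\<Sum>i<2^n. ennreal (sqrt (increment u n i)))
      \<le> (\<Sum>i<2^n. \<integral>\<^sup>+r. ennreal (sqrt (jump u r) * indicator {real i / 2^n<..real (Suc i) / 2^n} r) \<partial>count_space UNIV)"
    unfolding increment_def by (intro sum_mono sqrt_increment_le divide_right_mono) auto
  also have "\<dots> = (\<integral>\<^sup>+r. (\<Sum>i<2^n. ennreal (sqrt (jump u r) * indicator {real i / 2^n<..real (Suc i) / 2^n} r)) \<partial>count_space UNIV)"
    by (intro nn_integral_sum[symmetric]) auto
  also have "\<dots> \<le> (\<integral>\<^sup>+r. ennreal (sqrt (jump u r) * indicator {0<..1} r) \<partial>count_space UNIV)"
  proof (rule nn_integral_mono)
    fix r :: real
    show "(\<Sum>i<2^n. ennreal (sqrt (jump u r) * indicator {real i / 2^n<..real (Suc i) / 2^n} r))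
        \<le> ennreal (sqrt (jump u r) * indicator {0<..1} r)"
    proof (cases "r \<in> {0<..1}")
      case True
      have "r \<in> {real i / 2^n<..real (Suc i) / 2^n} \<longleftrightarrow> i = cell n r" for i
        using cell_bounds(2)[OF True, of n] cell_unique[of r i n] by metis
      then have "indicator {real i / 2^n<..real (Suc i) / 2^n} r = (if i = cell n r then 1 else 0 :: real)" for i
        unfolding indicator_def of_bool_def by (simp only:)
      then have "(\<Sum>i<2^n. ennreal (sqrt (jump u r) * indicator {real i / 2^n<..real (Suc i) / 2^n} r))
          = (\<Sum>i<2^n. if i = cell n r then ennreal (sqrt (jump u r)) else 0)"
        by (intro sum.cong) (simp_all del: of_nat_Suc)
      then show ?thesis using cell_bounds[OF True, of n] True by simp
    next
      case False
      have "r \<notin> {real i / 2^n<..real (Suc i) / 2^n}" if "i < 2^n" for i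
      proof
        assume r: "r \<in> {real i / 2^n<..real (Suc i) / 2^n}"
        have "real (Suc i) \<le> 2^n" using that by (metis Suc_leI of_nat_le_iff of_nat_numeral of_nat_power)
        then have "real (Suc i) / 2^n \<le> 1" by (simp del: of_nat_Suc)
        moreover have "0 \<le> real i / 2^n" by simp
        ultimately have "0 < r" "r \<le> 1"
          using r unfolding greaterThanAtMost_iff by linarith+
        then show False using False by simp
      qed
      then have "(\<Sum>i<2^n. ennreal (sqrt (jump u r) * indicator {real i / 2^n<..real (Suc i) / 2^n} r)) = 0"
        by (intro sum.neutral ballI) (simp del: of_nat_Suc greaterThanAtMost_iff)
      then show ?thesis by (simp only: zero_le)
    qed
  qed
  finally show ?thesis .
qed

lemma sqrt_jumps_le_layers:
  "(\<integral>\<^sup>+r. ennreal (sqrt (jump u r) * indicator {0<..1} r) \<partial>count_space UNIV)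
    \<le> (\<Sum>k. ennreal ((1/2)^k) * emeasure (count_space UNIV) (big_jumps u ((1/4)^Suc k)))
      + (\<Sum>k. emeasure (count_space UNIV) (big_jumps u (real (Suc k))))"
proof -
  let ?C = "count_space (UNIV :: real set)"
  have "(\<integral>\<^sup>+r. ennreal (sqrt (jump u r) * indicator {0<..1} r) \<partial>?C)
      \<le> (\<integral>\<^sup>+r. (\<Sum>k. ennreal ((1/2)^k) * indicator (big_jumps u ((1/4)^Suc k)) r)
            + (\<Sum>k. indicator (big_jumps u (real (Suc k))) r) \<partial>?C)"
  proof (rule nn_integral_mono)
    fix r :: real
    show "ennreal (sqrt (jump u r) * indicator {0<..1} r)
      \<le> (\<Sum>k. ennreal ((1/2)^k) * indicator (big_jumps u ((1/4)^Suc k)) r)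
        + (\<Sum>k. indicator (big_jumps u (real (Suc k))) r)"
    proof (cases "r \<in> {0<..1}")
      case True
      then have "indicator (big_jumps u b) r = (indicator {b<..} (jump u r) :: ennreal)" for b
        by (auto simp: big_jumps_def indicator_def)
      then show ?thesis
        using sqrt_le_layers[of "jump u r"] jump_nonneg[of r] True by simp
    qed simp
  qed
  also have "\<dots> = (\<Sum>k. ennreal ((1/2)^k) * emeasure ?C (big_jumps u ((1/4)^Suc k)))
      + (\<Sum>k. emeasure ?C (big_jumps u (real (Suc k))))"
    by (simp add: nn_integral_add nn_integral_suminf nn_integral_cmult)
  finally show ?thesis .
qed

text \<open>On a fine grid finitely many big jumps occupy distinct cells, and by monotonicity the
  increment over a cell is at least any jump inside it. An infinite set of big jumps is treated
  through its arbitrarily large finite subsets.\<close>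

lemma big_jumps_le_increments:
  "emeasure (count_space UNIV) (big_jumps u b) \<le> liminf (\<lambda>n. of_nat (card (big_increments u b n)))"
    (is "_ \<le> ?R")
proof -
  have fin: "of_nat (card X) \<le> ?R" if "finite X" "X \<subseteq> big_jumps u b" for X
  proof (rule Liminf_bounded)
    have X: "X \<subseteq> {0<..1}" using that(2) by (auto simp: big_jumps_def)
    show "\<forall>\<^sub>F n in sequentially. (of_nat (card X) :: ennreal) \<le> of_nat (card (big_increments u b n))"
      using eventually_inj_cell[OF that(1) X]
    proof eventually_elim
      case (elim n)
      have "cell n ` X \<subseteq> big_increments u b n"
      proof safe
        fix s assume "s \<in> X"
        then have s: "s \<in> {0<..1}" "b < jump u s" using that(2) by (auto simp: big_jumps_def)
        have "jump u s \<le> increment u n (cell n s)"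
          unfolding increment_def using cell_bounds[OF s(1), of n] by (intro jump_le_increment) auto
        then show "cell n s \<in> big_increments u b n"
          using s cell_bounds(1)[OF s(1), of n] by (simp add: big_increments_def)
      qed
      moreover have "finite (big_increments u b n)" by (simp add: big_increments_def)
      ultimately have "card (cell n ` X) \<le> card (big_increments u b n)" by (intro card_mono)
      then show ?case using card_image[OF elim] by simp
    qed
  qed
  show ?thesis
  proof (cases "finite (big_jumps u b)")
    case True
    then show ?thesis using fin[of "big_jumps u b"] by simp
  next
    case False
    have "of_nat m \<le> ?R" for m
      using infinite_arbitrarily_large[OF False, of m] fin by auto
    then have "?R = \<infinity>"
      using ennreal_Ex_less_of_nat[of ?R] by (metis infinity_ennreal_def leD less_top)
    then show ?thesis by simp
  qed
qed

text \<open>The converse costs a factor 2. A finite set \<open>X\<close> of jumps is chosen whose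
  sum misses less than b / 2 of \<open>u 1\<close>. Once its points lie in distinct cells, a cell
  without a jump above b / 2 receives at most b / 2 from \<open>X\<close> and less than b / 2 from
  all other jumps, so its increment is below b.\<close>

lemma big_increments_le_jumps:
  assumes "0 < b"
  shows "liminf (\<lambda>n. of_nat (card (big_increments u b n))) \<le> emeasure (count_space UNIV) (big_jumps u (b / 2))"
proof (cases "finite (big_jumps u (b / 2))")
  case True
  let ?J = "big_jumps u (b / 2)"
  have "\<forall>\<^sub>F F in finite_subsets_at_top {0<..1}. u 1 - b / 2 < sum (jump u) F"
    using sum_jumps[of 1] \<open>0 < b\<close> unfolding has_sum_def by (intro order_tendstoD(1)) auto
  then obtain F where F: "finite F" "F \<subseteq> {0<..1}"
    "\<And>X. finite X \<Longrightarrow> F \<subseteq> X \<Longrightarrow> X \<subseteq> {0<..1} \<Longrightarrow> u 1 - b / 2 < sum (jump u) X"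
    by (auto simp: eventually_finite_subsets_at_top)
  define X where "X = F \<union> ?J"
  have X: "finite X" "X \<subseteq> {0<..1}"
    using F True by (auto simp: X_def big_jumps_def)
  then have X_sum: "u 1 - b / 2 < sum (jump u) X"
    using F(3)[of X] by (simp add: X_def)
  have "(jump u has_sum u 0) {}" using sum_jumps[of 0] by simp
  then have u0: "u 0 = 0" using has_sum_unique has_sum_empty by blast
  have "\<forall>\<^sub>F n in sequentially. (of_nat (card (big_increments u b n)) :: ennreal) \<le> of_nat (card ?J)"
    using eventually_inj_cell[OF X(1,2)]
  proof eventually_elim
    case (elim n)
    have "big_increments u b n \<subseteq> cell n ` ?J"
    proof
      fix i assume i: "i \<in> big_increments u b n"
      let ?I = "{real i / 2^n<..real (Suc i) / 2^n}"
      have I1: "?I \<subseteq> {0<..1}"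
      proof -
        have "real (Suc i) \<le> 2^n"
          using i unfolding big_increments_def by (metis (lifting) Suc_leI mem_Collect_eq of_nat_le_iff of_nat_numeral of_nat_power)
        then have "real (Suc i) / 2^n \<le> 1" by (simp del: of_nat_Suc)
        moreover have "0 \<le> real i / 2^n" by simp
        ultimately show ?thesis by (intro subsetI) (unfold greaterThanAtMost_iff, linarith)
      qed
      show "i \<in> cell n ` ?J"
      proof (rule ccontr)
        assume no: "i \<notin> cell n ` ?J"
        have XI: "sum (jump u) (X \<inter> ?I) \<le> b / 2"
        proof (cases "X \<inter> ?I = {}")
          case False
          then obtain s where s: "s \<in> X" "s \<in> ?I" by blast
          have "X \<inter> ?I = {s}"
            using elim s cell_unique[of _ i n] by (auto simp: inj_on_def simp del: of_nat_Suc greaterThanAtMost_iff)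
          moreover have "jump u s \<le> b / 2"
          proof (rule ccontr)
            assume "\<not> jump u s \<le> b / 2"
            then have "s \<in> ?J" using s I1 by (auto simp: big_jumps_def)
            then show False using no cell_unique[OF s(2)] by blast
          qed
          ultimately show ?thesis by simp
        qed (use \<open>0 < b\<close> in simp)
        have "increment u n i \<le> b / 2 + (u 1 - sum (jump u) X)"
          unfolding increment_def
        proof (rule has_sum_le_finite_sums[OF increment_has_sum])
          fix Y assume Y: "finite Y" "Y \<subseteq> ?I"
          have "sum (jump u) Y = sum (jump u) (Y \<inter> X) + sum (jump u) (Y - X)"
            using Y by (subst sum.union_disjoint[symmetric]) (auto intro!: sum.cong)
          also have "sum (jump u) (Y \<inter> X) \<le> sum (jump u) (X \<inter> ?I)"
            using Y X I1 by (intro sum_mono2) (auto intro!: jump_nonneg)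
          \<comment> \<open>The jumps in \<open>Y - X\<close> are measured by what
            \<open>Y \<union> X\<close> adds to \<open>X\<close>; all jumps in (0, 1] together sum
            to at most \<open>u 1\<close>.\<close>
          also have "sum (jump u) (Y - X) = sum (jump u) (Y \<union> X) - sum (jump u) X"
            using Y X by (subst sum_diff[symmetric]) (auto intro!: sum.cong)
          also have "sum (jump u) (Y \<union> X) \<le> u 1 - u 0"
            using Y X I1 by (intro sum_jumps_le) auto
          finally show "sum (jump u) Y \<le> b / 2 + (u 1 - sum (jump u) X)"
            using XI u0 by simp
        qed (auto intro!: divide_right_mono)
        then show False using X_sum i by (simp add: big_increments_def)
      qed
    qed
    then have "card (big_increments u b n) \<le> card ?J"
      using True by (meson surj_card_le)
    then show ?case by simp
  qed
  then have "liminf (\<lambda>n. of_nat (card (big_increments u b n)) :: ennreal) \<le> of_nat (card ?J)"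
    by (rule Liminf_le[OF trivial_limit_sequentially])
  then show ?thesis
    using True by simp
qed simp

end

section \<open>The Levy measure of the Gamma subordinator\<close>

definition gamma_density :: "real \<Rightarrow> real \<Rightarrow> real \<Rightarrow> real" where
  "gamma_density \<alpha> \<beta> s = \<alpha> / s * exp (- \<beta> * s) * indicator {0<..} s"

lemma gamma_tail_large:
  assumes "0 < \<alpha>" "0 < \<beta>" "1 \<le> b"
  shows "emeasure (density lborel (\<lambda>s. ennreal (gamma_density \<alpha> \<beta> s))) {b<..}
    \<le> ennreal (\<alpha> / \<beta> * exp (- \<beta> * b))"
proof -
  have "emeasure (density lborel (\<lambda>s. ennreal (gamma_density \<alpha> \<beta> s))) {b<..}
      = (\<integral>\<^sup>+s. ennreal (gamma_density \<alpha> \<beta> s) * indicator {b<..} s \<partial>lborel)"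
    by (intro emeasure_density) (auto simp: gamma_density_def)
  also have "\<dots> \<le> (\<integral>\<^sup>+s. ennreal (\<alpha> * exp (- \<beta> * s)) * indicator {b..} s \<partial>lborel)"
  proof (rule nn_integral_mono)
    fix s :: real
    show "ennreal (gamma_density \<alpha> \<beta> s) * indicator {b<..} s \<le> ennreal (\<alpha> * exp (- \<beta> * s)) * indicator {b..} s"
    proof (cases "b < s")
      case True
      have "\<alpha> / s \<le> \<alpha>" using True assms by (simp add: divide_le_eq)
      then have "\<alpha> / s * exp (- \<beta> * s) \<le> \<alpha> * exp (- \<beta> * s)"
        by (intro mult_right_mono) auto
      then have "gamma_density \<alpha> \<beta> s \<le> \<alpha> * exp (- \<beta> * s)"
        using True assms by (simp add: gamma_density_def)
      then show ?thesis using True by (auto intro!: ennreal_leI)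
    qed simp
  qed
  also have "\<dots> = ennreal (0 - (- (\<alpha> / \<beta>) * exp (- \<beta> * b)))"
  proof (rule nn_integral_FTC_atLeast)
    fix x :: real
    show "DERIV (\<lambda>s. - (\<alpha> / \<beta>) * exp (- \<beta> * s)) x :> \<alpha> * exp (- \<beta> * x)"
      using assms by (auto intro!: derivative_eq_intros)
    have "((\<lambda>s. exp (- \<beta> * s)) \<longlongrightarrow> 0) at_top"
      using assms by real_asymp
    then show "((\<lambda>s. - (\<alpha> / \<beta>) * exp (- \<beta> * s)) \<longlongrightarrow> 0) at_top"
      using tendsto_mult_right_zero by blast
  qed (use assms in auto)
  finally show ?thesis by simp
qed

text \<open>On (b, 1] the exponential factor is estimated by 1, which leaves the logarithm of 1 / b.
  This slow growth is what the geometric weights in \<open>layer_bound\<close> absorb.\<close>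

lemma gamma_tail_small:
  assumes "0 < \<alpha>" "0 < \<beta>" "0 < b" "b \<le> 1"
  shows "emeasure (density lborel (\<lambda>s. ennreal (gamma_density \<alpha> \<beta> s))) {b<..}
    \<le> ennreal (\<alpha> * - ln b + \<alpha> / \<beta>)"
proof -
  let ?D = "density lborel (\<lambda>s. ennreal (gamma_density \<alpha> \<beta> s))"
  have "{b<..} = {b<..1} \<union> {1<..}" using assms by auto
  then have "emeasure ?D {b<..} \<le> emeasure ?D {b<..1} + emeasure ?D {1<..}"
    by (metis emeasure_subadditive sets_density sets_lborel greaterThanAtMost_borel greaterThan_borel)
  also have "emeasure ?D {b<..1} \<le> ennreal (\<alpha> * - ln b)"
  proof -
    have "emeasure ?D {b<..1} = (\<integral>\<^sup>+s. ennreal (gamma_density \<alpha> \<beta> s) * indicator {b<..1} s \<partial>lborel)"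
      by (intro emeasure_density) (auto simp: gamma_density_def)
    also have "\<dots> \<le> (\<integral>\<^sup>+s. ennreal (\<alpha> / s) * indicator {b..1} s \<partial>lborel)"
    proof (rule nn_integral_mono)
      fix s :: real
      show "ennreal (gamma_density \<alpha> \<beta> s) * indicator {b<..1} s \<le> ennreal (\<alpha> / s) * indicator {b..1} s"
      proof (cases "s \<in> {b<..1}")
        case True
        then have "\<alpha> / s * exp (- \<beta> * s) \<le> \<alpha> / s * 1"
          using assms by (intro mult_left_mono) auto
        then have "gamma_density \<alpha> \<beta> s \<le> \<alpha> / s"
          using True assms by (simp add: gamma_density_def)
        then show ?thesis using True by (auto intro!: ennreal_leI)
      qed simp
    qed
    also have "\<dots> = ennreal (\<alpha> * ln 1 - \<alpha> * ln b)"
      using assms by (intro nn_integral_FTC_Icc) (auto intro!: derivative_eq_intros)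
    finally show ?thesis by simp
  qed
  also have "emeasure ?D {1<..} \<le> ennreal (\<alpha> / \<beta>)"
  proof (rule order.trans[OF gamma_tail_large[OF assms(1,2) order_refl]])
    show "ennreal (\<alpha> / \<beta> * exp (- \<beta> * 1)) \<le> ennreal (\<alpha> / \<beta>)"
      using assms by (intro ennreal_leI mult_left_le) auto
  qed
  finally have "emeasure ?D {b<..} \<le> ennreal (\<alpha> * - ln b) + ennreal (\<alpha> / \<beta>)" by simp
  moreover have "0 \<le> \<alpha> * - ln b"
    using assms by (intro mult_nonneg_nonneg) auto
  ultimately show ?thesis
    using assms by (subst ennreal_plus) auto
qed

text \<open>The levels are half of those in \<open>sqrt_le_layers\<close>, to pay for the factor 2
  in \<open>big_increments_le_jumps\<close>.\<close>

definition layer_bound :: "real \<Rightarrow> real \<Rightarrow> ennreal" where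
  "layer_bound \<alpha> \<beta> =
    (\<Sum>k. ennreal ((1/2)^k) * emeasure (density lborel (\<lambda>s. ennreal (gamma_density \<alpha> \<beta> s))) {(1/4)^Suc k / 2<..})
    + (\<Sum>k. emeasure (density lborel (\<lambda>s. ennreal (gamma_density \<alpha> \<beta> s))) {real (Suc k) / 2<..})"

lemma layer_bound_finite:
  assumes "0 < \<alpha>" "0 < \<beta>"
  shows "layer_bound \<alpha> \<beta> < \<infinity>"
proof -
  let ?D = "density lborel (\<lambda>s. ennreal (gamma_density \<alpha> \<beta> s))"
  have l: "- ln ((1/4)^Suc k / 2) = ln 8 + real k * ln (4::real)" for k
  proof -
    have eq: "(1/4::real)^Suc k / 2 = inverse (8 * 4^k)"
      by (simp add: field_simps)
    have "- ln (inverse (8 * 4^k)) = ln (8 * 4^k :: real)"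
      by (subst ln_inverse) auto
    then show ?thesis unfolding eq by (simp add: ln_mult ln_realpow)
  qed
  have "(\<Sum>k. ennreal ((1/2)^k) * emeasure ?D {(1/4)^Suc k / 2<..})
      \<le> (\<Sum>k. ennreal ((1/2)^k * (\<alpha> * (ln 8 + real k * ln 4) + \<alpha> / \<beta>)))"
  proof (rule suminf_le)
    fix k
    have "(1/4::real)^Suc k / 2 \<le> 1"
      using power_le_one[of "1/4::real" "Suc k"] by simp
    then have "emeasure ?D {(1/4)^Suc k / 2<..} \<le> ennreal (\<alpha> * (ln 8 + real k * ln 4) + \<alpha> / \<beta>)"
      using gamma_tail_small[OF assms, of "(1/4)^Suc k / 2"] unfolding l by simp
    then show "ennreal ((1/2)^k) * emeasure ?D {(1/4)^Suc k / 2<..}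
        \<le> ennreal ((1/2)^k * (\<alpha> * (ln 8 + real k * ln 4) + \<alpha> / \<beta>))"
      using assms by (subst ennreal_mult) (auto intro!: mult_left_mono add_nonneg_nonneg)
  qed auto
  also have "\<dots> < \<infinity>"
  proof -
    \<comment> \<open>The differentiated geometric series minus the geometric series: this is the
      summability of k / 2^k, needed because the logarithmic tails grow linearly in k.\<close>
    have "summable (\<lambda>k. real (Suc k) * (1/2)^k - (1/2::real)^k)"
      using sums_summable[OF geometric_deriv_sums[of "1/2::real"]]
      by (intro summable_diff summable_geometric) auto
    then have "summable (\<lambda>k. real k * (1/2)^k)"
      by (simp add: algebra_simps)
    then have "summable (\<lambda>k. (\<alpha> * ln 8 + \<alpha> / \<beta>) * (1/2)^k + \<alpha> * ln 4 * (real k * (1/2)^k))"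
      by (intro summable_add summable_mult summable_geometric) auto
    then have "summable (\<lambda>k. (1/2)^k * (\<alpha> * (ln 8 + real k * ln 4) + \<alpha> / \<beta>))"
      by (simp add: algebra_simps)
    then show ?thesis
      using assms by (subst suminf_ennreal2) (auto intro!: mult_nonneg_nonneg add_nonneg_nonneg)
  qed
  finally have 1: "(\<Sum>k. ennreal ((1/2)^k) * emeasure ?D {(1/4)^Suc k / 2<..}) < \<infinity>" .
  \<comment> \<open>The first level is 1/2, below the range of \<open>gamma_tail_large\<close>, so
    this term is split off; the remaining levels are at least 1.\<close>
  have fin: "emeasure ?D {real (Suc 0) / 2<..} < \<infinity>"
    using gamma_tail_small[OF assms, of "1/2"] by (auto intro: le_less_trans)
  have "(\<Sum>k. emeasure ?D {real (Suc (Suc k)) / 2<..}) \<le> (\<Sum>k. ennreal (\<alpha> / \<beta> * (exp (- \<beta> / 2))^k))"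
  proof (rule suminf_le)
    fix k
    have "emeasure ?D {real (Suc (Suc k)) / 2<..} \<le> ennreal (\<alpha> / \<beta> * exp (- \<beta> * (real (Suc (Suc k)) / 2)))"
      using assms by (intro gamma_tail_large) auto
    also have "\<dots> \<le> ennreal (\<alpha> / \<beta> * exp (real k * (- \<beta> / 2)))"
      using assms by (intro ennreal_leI mult_left_mono) (auto simp: field_simps)
    finally show "emeasure ?D {real (Suc (Suc k)) / 2<..} \<le> ennreal (\<alpha> / \<beta> * (exp (- \<beta> / 2))^k)"
      by (simp only: exp_of_nat_mult)
  qed auto
  also have "\<dots> < \<infinity>"
    using assms by (subst suminf_ennreal2) (auto intro!: summable_mult summable_geometric)
  finally have "(\<Sum>k. emeasure ?D {real (Suc (Suc k)) / 2<..}) < \<infinity>" .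
  moreover have "(\<Sum>k. emeasure ?D {real (Suc k) / 2<..})
      = (\<Sum>k. emeasure ?D {real (Suc (Suc k)) / 2<..}) + emeasure ?D {real (Suc 0) / 2<..}"
    using suminf_offset[of "\<lambda>k. emeasure ?D {real (Suc k) / 2<..}" 1] by (simp add: add.commute)
  ultimately have 2: "(\<Sum>k. emeasure ?D {real (Suc k) / 2<..}) < \<infinity>"
    using fin by (simp add: ennreal_add_less_top)
  show ?thesis
    unfolding layer_bound_def using 1 2 by (simp add: ennreal_add_less_top)
qed

lemma gamma_subordinator_layers:
  assumes "gamma_subordinator M \<alpha> \<beta> \<gamma>" "0 < b"
  shows "(\<integral>\<^sup>+\<omega>. emeasure (count_space UNIV) (big_jumps (\<lambda>t. \<gamma> t \<omega>) b) \<partial>M)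
    = emeasure (density lborel (\<lambda>s. ennreal (gamma_density \<alpha> \<beta> s))) {b<..}"
proof -
  have "levy_measure M \<gamma> {b<..} = (\<integral>\<^sup>+\<omega>. emeasure (count_space UNIV) (big_jumps (\<lambda>t. \<gamma> t \<omega>) b) \<partial>M)"
    unfolding levy_measure_def big_jumps_def using assms(2)
    by (intro nn_integral_cong arg_cong[where f="emeasure (count_space UNIV)"]) auto
  then show ?thesis
    using assms(1) by (simp add: gamma_subordinator_def gamma_density_def)
qed

lemma gamma_subordinator_jump_path:
  assumes "gamma_subordinator M \<alpha> \<beta> \<gamma>"
  shows "AE \<omega> in M. jump_path (\<lambda>t. \<gamma> t \<omega>)"
proof -
  have "AE \<omega> in M. mono_on {0..} (\<lambda>t. \<gamma> t \<omega>)"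
    and "AE \<omega> in M. \<forall>t\<ge>0. (jump (\<lambda>s. \<gamma> s \<omega>) has_sum \<gamma> t \<omega>) {0<..t}"
    using assms by (auto simp: gamma_subordinator_def)
  then show ?thesis
    by eventually_elim (auto simp: jump_path_def)
qed

text \<open>Jump counts need not be measurable as such; the counts of dyadic increments are, and by
  \<open>big_jumps_le_increments\<close> and \<open>big_increments_le_jumps\<close> they sandwich the jump counts.\<close>

lemma gamma_sum_sqrt_increments:
  assumes \<gamma>: "gamma_subordinator M \<alpha> \<beta> \<gamma>"
  shows "(\<integral>\<^sup>+\<omega>. (\<Sum>i<2^n. ennreal (sqrt (increment (\<lambda>t. \<gamma> t \<omega>) n i))) \<partial>M) \<le> layer_bound \<alpha> \<beta>"
proof -
  have [measurable]: "\<gamma> t \<in> borel_measurable M" if "0 \<le> t" for t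
    using \<gamma> that by (auto simp: gamma_subordinator_def levy_process_def)
  define C where "C b \<omega> = liminf (\<lambda>n. of_nat (card (big_increments (\<lambda>t. \<gamma> t \<omega>) b n)) :: ennreal)" for b \<omega>
  have C_meas [measurable]: "C b \<in> borel_measurable M" for b
  proof -
    let ?S = "\<lambda>n i \<omega>. if b < increment (\<lambda>t. \<gamma> t \<omega>) n i then 1 else 0 :: ennreal"
    have eq: "(of_nat (card (big_increments (\<lambda>t. \<gamma> t \<omega>) b n)) :: ennreal) = (\<Sum>i\<in>{..<2^n}. ?S n i \<omega>)" for n \<omega>
    proof -
      have A: "big_increments (\<lambda>t. \<gamma> t \<omega>) b n = {i\<in>{..<2^n}. b < increment (\<lambda>t. \<gamma> t \<omega>) n i}"
        by (auto simp: big_increments_def)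
      have "(of_nat (card (big_increments (\<lambda>t. \<gamma> t \<omega>) b n)) :: ennreal)
          = (\<Sum>i\<in>big_increments (\<lambda>t. \<gamma> t \<omega>) b n. 1)"
        by (simp only: sum_constant mult_1_right)
      also have "\<dots> = (\<Sum>i\<in>{..<2^n}. ?S n i \<omega>)"
        unfolding A by (rule sum.inter_filter) (rule finite_lessThan)
      finally show ?thesis .
    qed
    have "?S n i \<in> borel_measurable M" for n i
      unfolding increment_def by measurable
    then have "(\<lambda>\<omega>. \<Sum>i\<in>{..<2^n}. ?S n i \<omega>) \<in> borel_measurable M" for n
      by (intro borel_measurable_sum)
    then show ?thesis
      unfolding C_def[abs_def] eq by (rule borel_measurable_liminf)
  qed
  have C_int: "(\<integral>\<^sup>+\<omega>. C b \<omega> \<partial>M) \<le> emeasure (density lborel (\<lambda>s. ennreal (gamma_density \<alpha> \<beta> s))) {b / 2<..}" if "0 < b" for b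
  proof -
    have "(\<integral>\<^sup>+\<omega>. C b \<omega> \<partial>M) \<le> (\<integral>\<^sup>+\<omega>. emeasure (count_space UNIV) (big_jumps (\<lambda>t. \<gamma> t \<omega>) (b / 2)) \<partial>M)"
      using gamma_subordinator_jump_path[OF \<gamma>]
      by (intro nn_integral_mono_AE) (auto elim!: eventually_mono intro: jump_path.big_increments_le_jumps that simp: C_def)
    then show ?thesis
      using gamma_subordinator_layers[OF \<gamma>, of "b/2"] that by simp
  qed
  have "(\<integral>\<^sup>+\<omega>. (\<Sum>i<2^n. ennreal (sqrt (increment (\<lambda>t. \<gamma> t \<omega>) n i))) \<partial>M)
      \<le> (\<integral>\<^sup>+\<omega>. (\<Sum>k. ennreal ((1/2)^k) * C ((1/4)^Suc k) \<omega>) + (\<Sum>k. C (real (Suc k)) \<omega>) \<partial>M)"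
  proof (rule nn_integral_mono_AE)
    show "AE \<omega> in M. (\<Sum>i<2^n. ennreal (sqrt (increment (\<lambda>t. \<gamma> t \<omega>) n i)))
        \<le> (\<Sum>k. ennreal ((1/2)^k) * C ((1/4)^Suc k) \<omega>) + (\<Sum>k. C (real (Suc k)) \<omega>)"
      using gamma_subordinator_jump_path[OF \<gamma>]
    proof eventually_elim
      case (elim \<omega>)
      then interpret jump_path "\<lambda>t. \<gamma> t \<omega>" .
      show ?case
        unfolding C_def
        by (rule order.trans[OF sum_sqrt_increments_le order.trans[OF sqrt_jumps_le_layers]])
           (intro add_mono suminf_le mult_left_mono big_jumps_le_increments; simp)
    qed
  qed
  also have "\<dots> = (\<Sum>k. ennreal ((1/2)^k) * (\<integral>\<^sup>+\<omega>. C ((1/4)^Suc k) \<omega> \<partial>M)) + (\<Sum>k. \<integral>\<^sup>+\<omega>. C (real (Suc k)) \<omega> \<partial>M)"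
    by (subst nn_integral_add) (simp_all add: nn_integral_suminf nn_integral_cmult)
  also have "\<dots> \<le> layer_bound \<alpha> \<beta>"
    unfolding layer_bound_def by (intro add_mono suminf_le mult_left_mono C_int) auto
  finally show ?thesis .
qed

section \<open>The time-changed Brownian motion\<close>

lemma measurable_vec_component [measurable (raw)]:
  fixes f :: "'a \<Rightarrow> real^'n"
  assumes "f \<in> borel_measurable M"
  shows "(\<lambda>x. f x $ j) \<in> borel_measurable M"
  by (rule borel_measurable_continuous_on[OF _ assms]) (intro continuous_intros)

lemma measurable_sigma_subset:
  assumes "f \<in> measurable (sigma (space M) \<A>) N" "sigma_sets (space M) \<A> \<subseteq> sets M" "\<A> \<subseteq> Pow (space M)"
  shows "f \<in> measurable M N"
  using assms by (auto simp: measurable_def space_measure_of sets_measure_of)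

text \<open>The two \<sigma>-algebras form a family indexed by \<open>bool\<close>, so the product
  formula for independent variables applies to X and the indicator of b.\<close>

lemma (in prob_space) indep_set_nn_integral:
  fixes X :: "'a \<Rightarrow> ennreal"
  assumes ind: "indep_set (sigma_sets (space M) \<A>) (sigma_sets (space M) \<B>)"
    and sub: "\<A> \<subseteq> Pow (space M)" "\<B> \<subseteq> Pow (space M)"
    and X: "X \<in> borel_measurable (sigma (space M) \<A>)" and b: "b \<in> sigma_sets (space M) \<B>"
  shows "(\<integral>\<^sup>+\<omega>. X \<omega> * indicator b \<omega> \<partial>M) = (\<integral>\<^sup>+\<omega>. X \<omega> \<partial>M) * emeasure M b"
proof -
  define Y where "Y i = (if i then X else indicator b)" for i
  have ev: "sigma_sets (space M) \<A> \<subseteq> events" "sigma_sets (space M) \<B> \<subseteq> events"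
    using indep_setD_ev1[OF ind] indep_setD_ev2[OF ind] by auto
  have Yb: "Y False \<in> borel_measurable (sigma (space M) \<B>)"
    unfolding Y_def if_False using b sub by (intro borel_measurable_indicator) (simp add: sets_measure_of)
  have sets: "{Y i -` A \<inter> space M |A. A \<in> sets borel} \<subseteq> (case i of True \<Rightarrow> sigma_sets (space M) \<A> | False \<Rightarrow> sigma_sets (space M) \<B>)" for i
  proof (cases i)
    case True
    then show ?thesis
      using measurable_sets[OF X] sub by (auto simp: Y_def space_measure_of sets_measure_of)
  next
    case False
    then show ?thesis
      using measurable_sets[OF Yb] sub by (auto simp: space_measure_of sets_measure_of)
  qed
  have "indep_sets (\<lambda>i. sigma_sets (space M) {Y i -` A \<inter> space M |A. A \<in> sets borel}) UNIV"
  proof (rule indep_sets_mono_sets[OF ind[unfolded indep_set_def]])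
    fix i :: bool
    show "sigma_sets (space M) {Y i -` A \<inter> space M |A. A \<in> sets borel}
        \<subseteq> (case i of True \<Rightarrow> sigma_sets (space M) \<A> | False \<Rightarrow> sigma_sets (space M) \<B>)"
      using sets[of i] by (cases i) (auto intro: sigma_sets_mono[THEN subsetD])
  qed
  moreover have "random_variable borel (Y i)" for i
  proof (cases i)
    case True
    have "X \<in> borel_measurable M"
      using X ev(1) sub(1) by (rule measurable_sigma_subset)
    then show ?thesis using True by (simp add: Y_def)
  next
    case False
    then show ?thesis using b ev(2) by (auto simp: Y_def)
  qed
  ultimately have "indep_vars (\<lambda>_. borel) Y UNIV"
    unfolding indep_vars_def by auto
  then have "(\<integral>\<^sup>+\<omega>. (\<Prod>i\<in>UNIV. Y i \<omega>) \<partial>M) = (\<Prod>i\<in>UNIV. \<integral>\<^sup>+\<omega>. Y i \<omega> \<partial>M)"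
    by (intro indep_vars_nn_integral) auto
  then show ?thesis
    using b ev(2) by (auto simp: Y_def UNIV_bool mult.commute)
qed

text \<open>The integral is split by the value of the random index \<open>c\<close>; on each piece
  the index is constant and independence factors the integral. Countability of the values is the
  reason for rounding \<gamma> later.\<close>

lemma (in prob_space) indep_countable_nn_integral_le:
  fixes X :: "nat \<Rightarrow> 'a \<Rightarrow> ennreal"
  assumes ind: "indep_set (sigma_sets (space M) \<A>) (sigma_sets (space M) \<B>)"
    and sub: "\<A> \<subseteq> Pow (space M)" "\<B> \<subseteq> Pow (space M)"
    and X: "\<And>k. X k \<in> borel_measurable (sigma (space M) \<A>)"
    and c: "c \<in> measurable (sigma (space M) \<B>) (count_space UNIV)"
    and r: "\<And>k. (\<integral>\<^sup>+\<omega>. X k \<omega> \<partial>M) \<le> r k"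
  shows "(\<integral>\<^sup>+\<omega>. X (c \<omega>) \<omega> \<partial>M) \<le> (\<integral>\<^sup>+\<omega>. r (c \<omega>) \<partial>M)"
proof -
  define b where "b k = c -` {k} \<inter> space M" for k
  have bB: "b k \<in> sigma_sets (space M) \<B>" for k
    using measurable_sets[OF c, of "{k}"] sub by (simp add: b_def space_measure_of sets_measure_of)
  then have bM [measurable]: "b k \<in> events" for k
    using indep_setD_ev2[OF ind] by auto
  have XM [measurable]: "X k \<in> borel_measurable M" for k
    using X[of k] indep_setD_ev1[OF ind] sub(1) by (rule measurable_sigma_subset)
  have disj: "disjoint_family b"
    by (auto simp: disjoint_family_on_def b_def)
  have split: "f (c \<omega>) = (\<Sum>k. f k * indicator (b k) \<omega>)" if "\<omega> \<in> space M" for f :: "nat \<Rightarrow> ennreal" and \<omega>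
    using that by (intro suminf_cmult_indicator[OF disj, symmetric]) (auto simp: b_def)
  have "(\<integral>\<^sup>+\<omega>. X (c \<omega>) \<omega> \<partial>M) = (\<integral>\<^sup>+\<omega>. (\<Sum>k. X k \<omega> * indicator (b k) \<omega>) \<partial>M)"
    by (intro nn_integral_cong split)
  also have "\<dots> = (\<Sum>k. (\<integral>\<^sup>+\<omega>. X k \<omega> \<partial>M) * emeasure M (b k))"
    by (subst nn_integral_suminf) (simp_all add: indep_set_nn_integral[OF ind sub X bB])
  also have "\<dots> \<le> (\<Sum>k. r k * emeasure M (b k))"
    by (intro suminf_le mult_right_mono r) auto
  also have "\<dots> = (\<integral>\<^sup>+\<omega>. (\<Sum>k. r k * indicator (b k) \<omega>) \<partial>M)"
    by (subst nn_integral_suminf) (simp_all add: nn_integral_cmult)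
  also have "\<dots> = (\<integral>\<^sup>+\<omega>. r (c \<omega>) \<partial>M)"
    by (intro nn_integral_cong split[symmetric])
  finally show ?thesis .
qed

lemma measurable_generated_by:
  fixes X :: "real \<Rightarrow> 'a \<Rightarrow> 'b::topological_space"
  assumes "t \<in> T"
  shows "X t \<in> borel_measurable (sigma (space M) {X s -` B \<inter> space M |s B. s \<in> T \<and> B \<in> sets borel})"
proof (rule measurableI)
  fix B :: "'b set" assume "B \<in> sets borel"
  then have "X t -` B \<inter> space M \<in> {X s -` B \<inter> space M |s B. s \<in> T \<and> B \<in> sets borel}"
    using assms by blast
  moreover have "{X s -` B \<inter> space M |s B. s \<in> T \<and> B \<in> sets borel} \<subseteq> Pow (space M)"
    by auto
  ultimately show "X t -` B \<inter> space (sigma (space M) {X s -` B \<inter> space M |s B. s \<in> T \<and> B \<in> sets borel})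
      \<in> sets (sigma (space M) {X s -` B \<inter> space M |s B. s \<in> T \<and> B \<in> sets borel})"
    by (simp add: space_measure_of sets_measure_of)
qed auto

text \<open>The first absolute moment of a centred normal law with deviation d is d * sqrt (2 / pi),
  at most d. The form with \<open>\<bar>t - s\<bar>\<close> covers all pairs of grid times, whatever
  their order.\<close>

lemma brownian_increment_nn_integral:
  fixes W :: "real \<Rightarrow> 'a \<Rightarrow> real^'n"
  assumes W: "brownian_motion M \<Sigma> W" and \<Sigma>: "\<Sigma> $ j $ j = 1" and "0 \<le> s" "0 \<le> t"
  shows "(\<integral>\<^sup>+\<omega>. ennreal \<bar>W t \<omega> $ j - W s \<omega> $ j\<bar> \<partial>M) \<le> ennreal (sqrt \<bar>t - s\<bar>)"
proof -
  have main: "(\<integral>\<^sup>+\<omega>. ennreal \<bar>W t \<omega> $ j - W s \<omega> $ j\<bar> \<partial>M) \<le> ennreal (sqrt (t - s))"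
    if st: "0 \<le> s" "s < t" for s t
  proof -
    define u :: "real^'n" where "u = axis j 1"
    define d where "d = sqrt (t - s)"
    have "0 < d" using st by (simp add: d_def)
    have "u \<noteq> 0" by (simp add: u_def axis_eq_0_iff)
    have "u \<bullet> (\<Sigma> *v u) = 1"
      using \<Sigma> by (simp add: u_def inner_axis' matrix_vector_mult_basis column_def)
    then have dist: "distributed M lborel (\<lambda>\<omega>. u \<bullet> (W t \<omega> - W s \<omega>)) (\<lambda>x. ennreal (normal_density 0 d x))"
    proof -
      have "\<forall>s t u. 0 \<le> s \<longrightarrow> s < t \<longrightarrow> u \<noteq> 0 \<longrightarrow> distributed M lborel (\<lambda>\<omega>. u \<bullet> (W t \<omega> - W s \<omega>))
          (\<lambda>x. ennreal (normal_density 0 (sqrt ((t - s) * (u \<bullet> (\<Sigma> *v u)))) x))"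
        using W by (simp add: brownian_motion_def)
      from this[rule_format, OF st \<open>u \<noteq> 0\<close>] show ?thesis
        by (simp add: \<open>u \<bullet> (\<Sigma> *v u) = 1\<close> d_def)
    qed
    have "(\<integral>\<^sup>+\<omega>. ennreal \<bar>W t \<omega> $ j - W s \<omega> $ j\<bar> \<partial>M) = (\<integral>\<^sup>+\<omega>. ennreal \<bar>u \<bullet> (W t \<omega> - W s \<omega>)\<bar> \<partial>M)"
      by (simp add: u_def inner_axis')
    also have "\<dots> = (\<integral>\<^sup>+x. ennreal (normal_density 0 d x) * ennreal \<bar>x\<bar> \<partial>lborel)"
      by (rule distributed_nn_integral[OF dist, symmetric]) simp
    also have "\<dots> = (\<integral>\<^sup>+x. ennreal (normal_density 0 d x * \<bar>x\<bar>) \<partial>lborel)"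
      by (simp add: ennreal_mult)
    also have "\<dots> = ennreal (d * sqrt (2 / pi))"
    proof -
      have "has_bochner_integral lborel (\<lambda>x. normal_density 0 d x * \<bar>x\<bar>) (d * sqrt (2 / pi))"
        using normal_moment_abs_odd[OF \<open>0 < d\<close>, of 0 0] by simp
      then show ?thesis
        by (subst nn_integral_eq_integral) (auto simp: has_bochner_integral_iff)
    qed
    also have "\<dots> \<le> ennreal d"
      using \<open>0 < d\<close> pi_ge_two by (intro ennreal_leI mult_left_le) (auto simp: divide_le_eq)
    finally show ?thesis by (simp add: d_def)
  qed
  consider "s < t" | "t < s" | "s = t" by linarith
  then show ?thesis
  proof cases
    case 1
    then show ?thesis using main[of s t] assms by simp
  next
    case 2
    then show ?thesis using main[of t s] assms by (simp add: abs_minus_commute)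
  qed simp
qed

lemma floor_approx_tendsto:
  assumes "0 \<le> (y::real)"
  shows "(\<lambda>n. real (nat \<lfloor>2^n * y\<rfloor>) / 2^n) \<longlonglongrightarrow> y"
    and "real (nat \<lfloor>2^n * y\<rfloor>) / 2^n \<le> y" and "y - (1/2)^n \<le> real (nat \<lfloor>2^n * y\<rfloor>) / 2^n"
proof -
  have r: "real (nat \<lfloor>2^n * y\<rfloor>) = of_int \<lfloor>2^n * y\<rfloor>" for n
    using assms by (simp add: of_nat_nat)
  have up: "real (nat \<lfloor>2^n * y\<rfloor>) / 2^n \<le> y" for n
  proof -
    have "real (nat \<lfloor>2^n * y\<rfloor>) \<le> 2^n * y" unfolding r by linarith
    then show ?thesis by (simp add: divide_le_eq mult.commute)
  qed
  have lo: "y - (1/2)^n \<le> real (nat \<lfloor>2^n * y\<rfloor>) / 2^n" for n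
  proof -
    have "2^n * y - 1 \<le> real (nat \<lfloor>2^n * y\<rfloor>)" unfolding r by linarith
    also have "2^n * y - 1 = (y - (1/2)^n) * 2^n" by (simp add: field_simps power_one_over)
    finally show ?thesis by (simp add: le_divide_eq)
  qed
  have "(\<lambda>n. y - (1/2)^n) \<longlonglongrightarrow> y - 0"
    by (intro tendsto_intros LIMSEQ_realpow_zero) auto
  then have lim: "(\<lambda>n. y - (1/2)^n) \<longlonglongrightarrow> y" by simp
  show "(\<lambda>n. real (nat \<lfloor>2^n * y\<rfloor>) / 2^n) \<longlonglongrightarrow> y"
    by (rule tendsto_sandwich[OF always_eventually always_eventually lim tendsto_const])
       (intro allI lo up)+
  show "real (nat \<lfloor>2^n * y\<rfloor>) / 2^n \<le> y" "y - (1/2)^n \<le> real (nat \<lfloor>2^n * y\<rfloor>) / 2^n"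
    by (rule up lo)+
qed

section \<open>Almost sure bounded variation of the time-changed path\<close>

locale gamma_time_change = prob_space M for M :: "'a measure" +
  fixes \<Sigma> :: "real^'n^'n" and W :: "real \<Rightarrow> 'a \<Rightarrow> real^'n" and \<gamma> :: "real \<Rightarrow> 'a \<Rightarrow> real"
    and \<alpha> \<beta> :: real and j :: 'n
  assumes brownian: "brownian_motion M \<Sigma> W" and unit: "\<Sigma> $ j $ j = 1"
    and pos: "0 < \<alpha>" "0 < \<beta>" and subordinator: "gamma_subordinator M \<alpha> \<beta> \<gamma>"
    and independent: "indep_set (generated_by M {0..} W) (generated_by M {0..} \<gamma>)"
    and measurable_time_changed: "\<And>t. 0 \<le> t \<Longrightarrow> time_changed W \<gamma> j t \<in> borel_measurable M"
begin

abbreviation "\<Gamma> \<equiv> time_changed W \<gamma> j"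

lemma measurable_\<gamma>: "0 \<le> t \<Longrightarrow> \<gamma> t \<in> borel_measurable M"
  using subordinator by (auto simp: gamma_subordinator_def levy_process_def)

definition regular :: "'a \<Rightarrow> bool" where
  "regular \<omega> \<longleftrightarrow> continuous_on {0..} (\<lambda>t. W t \<omega>) \<and> mono_on {0..} (\<lambda>t. \<gamma> t \<omega>) \<and> \<gamma> 0 \<omega> = 0 \<and>
    cadlag_until \<infinity> (\<lambda>t. \<gamma> t \<omega>)"

lemma AE_regular: "AE \<omega> in M. regular \<omega>"
proof -
  have "AE \<omega> in M. continuous_on {0..} (\<lambda>t. W t \<omega>)"
    using brownian by (simp add: brownian_motion_def)
  moreover have "AE \<omega> in M. mono_on {0..} (\<lambda>t. \<gamma> t \<omega>)" "AE \<omega> in M. \<gamma> 0 \<omega> = 0"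
    "AE \<omega> in M. cadlag_until \<infinity> (\<lambda>t. \<gamma> t \<omega>)"
    using subordinator by (auto simp: gamma_subordinator_def levy_process_def)
  ultimately show ?thesis
    by eventually_elim (simp add: regular_def)
qed

lemma regular_nonneg: "regular \<omega> \<Longrightarrow> 0 \<le> t \<Longrightarrow> 0 \<le> \<gamma> t \<omega>"
  unfolding regular_def by (metis atLeast_iff mono_onD order_refl)

lemma regular_mono: "regular \<omega> \<Longrightarrow> 0 \<le> s \<Longrightarrow> s \<le> t \<Longrightarrow> \<gamma> s \<omega> \<le> \<gamma> t \<omega>"
  unfolding regular_def by (auto intro: mono_onD)

lemma regular_right_cont:
  assumes "regular \<omega>" "0 \<le> t"
  shows "continuous (at_right t) (\<lambda>t. \<gamma> t \<omega>)" "continuous (at_right t) (\<lambda>t. \<Gamma> t \<omega>)"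
proof -
  show g: "continuous (at_right t) (\<lambda>t. \<gamma> t \<omega>)"
    using assms by (auto simp: regular_def cadlag_until_def)
  have "((\<lambda>s. W (\<gamma> s \<omega>) \<omega>) \<longlongrightarrow> W (\<gamma> t \<omega>) \<omega>) (at_right t)"
  proof (rule continuous_on_tendsto_compose[where s="{0..}" and f="\<lambda>t. W t \<omega>"])
    show "((\<lambda>s. \<gamma> s \<omega>) \<longlongrightarrow> \<gamma> t \<omega>) (at_right t)"
      using g by (simp add: continuous_within)
    show "\<forall>\<^sub>F s in at_right t. \<gamma> s \<omega> \<in> {0..}"
      using eventually_at_right_less[of t]
      by eventually_elim (use assms in \<open>auto intro!: regular_nonneg\<close>)
  qed (use assms in \<open>auto simp: regular_def intro: regular_nonneg\<close>)
  then show "continuous (at_right t) (\<lambda>t. \<Gamma> t \<omega>)"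
    unfolding continuous_within time_changed_def by (rule tendsto_vec_nth)
qed

text \<open>Conditioning on \<gamma> by hand: both values of \<gamma> are rounded down to a grid,
  the estimate for deterministic times is applied to each possible pair, and the rounding is removed
  by Fatou's lemma and the continuity of W.\<close>

lemma increment_nn_integral_le:
  assumes st: "0 \<le> s" "s \<le> t"
  shows "(\<integral>\<^sup>+\<omega>. ennreal \<bar>\<Gamma> t \<omega> - \<Gamma> s \<omega>\<bar> \<partial>M) \<le> (\<integral>\<^sup>+\<omega>. ennreal (sqrt (\<gamma> t \<omega> - \<gamma> s \<omega>)) \<partial>M)"
proof -
  let ?\<A> = "{W s -` B \<inter> space M |s B. s \<in> {0..} \<and> B \<in> sets borel}"
  let ?\<B> = "{\<gamma> s -` B \<inter> space M |s B. s \<in> {0..} \<and> B \<in> sets borel}"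
  \<comment> \<open>The number k encodes a pair of grid indices: \<open>X\<close> is the Brownian
    increment between these grid times, \<open>r\<close> its moment bound, and \<open>c\<close> the
    random code of the rounded values of \<gamma>.\<close>
  define X where "X n k \<omega> = ennreal \<bar>W (real (snd (prod_decode k)) / 2^n) \<omega> $ j - W (real (fst (prod_decode k)) / 2^n) \<omega> $ j\<bar>"
    for n k \<omega>
  define r where "r n k = ennreal (sqrt \<bar>real (snd (prod_decode k)) / 2^n - real (fst (prod_decode k)) / 2^n\<bar>)"
    for n k
  define c where "c n \<omega> = prod_encode (nat \<lfloor>2^n * \<gamma> s \<omega>\<rfloor>, nat \<lfloor>2^n * \<gamma> t \<omega>\<rfloor>)" for n :: nat and \<omega>
  have X_meas: "X n k \<in> borel_measurable (sigma (space M) ?\<A>)" for n k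
  proof -
    have [measurable]: "W (real p / 2^n) \<in> borel_measurable (sigma (space M) ?\<A>)" for p
      by (rule measurable_generated_by) simp
    show ?thesis unfolding X_def by measurable
  qed
  have c_meas: "c n \<in> measurable (sigma (space M) ?\<B>) (count_space UNIV)" for n
  proof -
    have [measurable]: "\<gamma> s \<in> borel_measurable (sigma (space M) ?\<B>)" "\<gamma> t \<in> borel_measurable (sigma (space M) ?\<B>)"
      by (rule measurable_generated_by, use st in simp)+
    show ?thesis unfolding c_def by measurable
  qed
  have [measurable]: "\<gamma> s \<in> borel_measurable M" "\<gamma> t \<in> borel_measurable M"
    using st by (auto intro: measurable_\<gamma>)
  have X_M: "X n k \<in> borel_measurable M" for n k
  proof -
    have [measurable]: "W (real p / 2^n) \<in> borel_measurable M" for p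
      using brownian by (simp add: brownian_motion_def)
    show ?thesis unfolding X_def by measurable
  qed
  have "c n \<in> measurable M (count_space UNIV)" for n
    unfolding c_def by measurable
  then have X_c_meas: "(\<lambda>\<omega>. X n (c n \<omega>) \<omega>) \<in> borel_measurable M" for n
    using measurable_compose_countable[of "X n" M borel "c n"] X_M by simp
  \<comment> \<open>Rounding both values down changes their difference by at most 2^-n;
    subadditivity of the square root turns this into the additive error.\<close>
  have step: "(\<integral>\<^sup>+\<omega>. X n (c n \<omega>) \<omega> \<partial>M)
      \<le> (\<integral>\<^sup>+\<omega>. ennreal (sqrt (\<gamma> t \<omega> - \<gamma> s \<omega>)) \<partial>M) + ennreal (sqrt ((1/2)^n))" for n
  proof -
    have "(\<integral>\<^sup>+\<omega>. X n (c n \<omega>) \<omega> \<partial>M) \<le> (\<integral>\<^sup>+\<omega>. r n (c n \<omega>) \<partial>M)"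
    proof (rule indep_countable_nn_integral_le[OF independent[unfolded generated_by_def] _ _ X_meas c_meas])
      fix k show "(\<integral>\<^sup>+\<omega>. X n k \<omega> \<partial>M) \<le> r n k"
        unfolding X_def r_def by (intro brownian_increment_nn_integral[OF brownian unit]) auto
    qed auto
    also have "\<dots> \<le> (\<integral>\<^sup>+\<omega>. ennreal (sqrt (\<gamma> t \<omega> - \<gamma> s \<omega>)) + ennreal (sqrt ((1/2)^n)) \<partial>M)"
    proof (rule nn_integral_mono_AE)
      show "AE \<omega> in M. r n (c n \<omega>) \<le> ennreal (sqrt (\<gamma> t \<omega> - \<gamma> s \<omega>)) + ennreal (sqrt ((1/2)^n))"
        using AE_regular
      proof eventually_elim
        case (elim \<omega>)
        have g: "0 \<le> \<gamma> s \<omega>" "0 \<le> \<gamma> t \<omega>" "\<gamma> s \<omega> \<le> \<gamma> t \<omega>"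
          using elim st by (auto intro: regular_nonneg regular_mono)
        have "sqrt \<bar>real (nat \<lfloor>2^n * \<gamma> t \<omega>\<rfloor>) / 2^n - real (nat \<lfloor>2^n * \<gamma> s \<omega>\<rfloor>) / 2^n\<bar>
            \<le> sqrt ((\<gamma> t \<omega> - \<gamma> s \<omega>) + (1/2)^n)"
          using floor_approx_tendsto(2,3)[OF g(1), of n] floor_approx_tendsto(2,3)[OF g(2), of n] g
          by (intro real_sqrt_le_mono) linarith
        also have "\<dots> \<le> sqrt (\<gamma> t \<omega> - \<gamma> s \<omega>) + sqrt ((1/2)^n)"
          using g by (intro sqrt_add_le_add_sqrt) auto
        finally show ?case
          using g by (simp add: r_def c_def ennreal_leI flip: ennreal_plus)
      qed
    qed
    also have "\<dots> = (\<integral>\<^sup>+\<omega>. ennreal (sqrt (\<gamma> t \<omega> - \<gamma> s \<omega>)) \<partial>M) + ennreal (sqrt ((1/2)^n))"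
      by (subst nn_integral_add) (auto simp: emeasure_space_1)
    finally show ?thesis .
  qed
  have "(\<integral>\<^sup>+\<omega>. ennreal \<bar>\<Gamma> t \<omega> - \<Gamma> s \<omega>\<bar> \<partial>M) \<le> (\<integral>\<^sup>+\<omega>. liminf (\<lambda>n. X n (c n \<omega>) \<omega>) \<partial>M)"
  proof (rule nn_integral_mono_AE)
    show "AE \<omega> in M. ennreal \<bar>\<Gamma> t \<omega> - \<Gamma> s \<omega>\<bar> \<le> liminf (\<lambda>n. X n (c n \<omega>) \<omega>)"
      using AE_regular
    proof eventually_elim
      case (elim \<omega>)
      have W_lim: "(\<lambda>n. W (real (nat \<lfloor>2^n * \<gamma> r \<omega>\<rfloor>) / 2^n) \<omega>) \<longlonglongrightarrow> W (\<gamma> r \<omega>) \<omega>" if "0 \<le> r" for r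
      proof (rule continuous_on_tendsto_compose[where s="{0..}" and f="\<lambda>t. W t \<omega>"])
        show "(\<lambda>n. real (nat \<lfloor>2^n * \<gamma> r \<omega>\<rfloor>) / 2^n) \<longlonglongrightarrow> \<gamma> r \<omega>"
          using regular_nonneg[OF elim that] by (rule floor_approx_tendsto)
      qed (use elim that in \<open>auto simp: regular_def intro: regular_nonneg\<close>)
      have "(\<lambda>n. X n (c n \<omega>) \<omega>) \<longlonglongrightarrow> ennreal \<bar>\<Gamma> t \<omega> - \<Gamma> s \<omega>\<bar>"
        using W_lim[of s] W_lim[of t] st unfolding X_def c_def time_changed_def
        by (auto intro!: tendsto_intros tendsto_ennrealI)
      then show ?case
        by (simp add: lim_imp_Liminf)
    qed
  qed
  also have "\<dots> \<le> liminf (\<lambda>n. \<integral>\<^sup>+\<omega>. X n (c n \<omega>) \<omega> \<partial>M)"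
    by (rule nn_integral_liminf) (rule X_c_meas)
  also have "\<dots> \<le> liminf (\<lambda>n. (\<integral>\<^sup>+\<omega>. ennreal (sqrt (\<gamma> t \<omega> - \<gamma> s \<omega>)) \<partial>M) + ennreal (sqrt ((1/2)^n)))"
    by (intro Liminf_mono always_eventually allI step)
  also have "\<dots> = (\<integral>\<^sup>+\<omega>. ennreal (sqrt (\<gamma> t \<omega> - \<gamma> s \<omega>)) \<partial>M)"
  proof (rule lim_imp_Liminf)
    have "(\<lambda>n. sqrt ((1/2)^n)) \<longlonglongrightarrow> sqrt 0"
      by (intro tendsto_real_sqrt LIMSEQ_realpow_zero) auto
    then have "(\<lambda>n. (\<integral>\<^sup>+\<omega>. ennreal (sqrt (\<gamma> t \<omega> - \<gamma> s \<omega>)) \<partial>M) + ennreal (sqrt ((1/2)^n)))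
        \<longlonglongrightarrow> (\<integral>\<^sup>+\<omega>. ennreal (sqrt (\<gamma> t \<omega> - \<gamma> s \<omega>)) \<partial>M) + ennreal (sqrt 0)"
      by (intro tendsto_add tendsto_const tendsto_ennrealI)
    then show "(\<lambda>n. (\<integral>\<^sup>+\<omega>. ennreal (sqrt (\<gamma> t \<omega> - \<gamma> s \<omega>)) \<partial>M) + ennreal (sqrt ((1/2)^n)))
        \<longlonglongrightarrow> (\<integral>\<^sup>+\<omega>. ennreal (sqrt (\<gamma> t \<omega> - \<gamma> s \<omega>)) \<partial>M)" by simp
  qed simp
  finally show ?thesis .
qed

lemma stationary_increment:
  assumes "0 \<le> s" "0 \<le> h"
  shows "(\<integral>\<^sup>+\<omega>. ennreal (sqrt (\<gamma> (s + h) \<omega> - \<gamma> s \<omega>)) \<partial>M) = (\<integral>\<^sup>+\<omega>. ennreal (sqrt (\<gamma> h \<omega> - \<gamma> 0 \<omega>)) \<partial>M)"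
proof -
  note [measurable] = measurable_\<gamma>[OF assms(1)] measurable_\<gamma>[OF assms(2)] measurable_\<gamma>[of "s+h"] measurable_\<gamma>[of 0]
  have e: "distr M borel (\<lambda>\<omega>. \<gamma> (s + h) \<omega> - \<gamma> s \<omega>) = distr M borel (\<lambda>\<omega>. \<gamma> h \<omega> - \<gamma> 0 \<omega>)"
    using subordinator assms by (simp add: gamma_subordinator_def levy_process_def)
  have "(\<integral>\<^sup>+\<omega>. ennreal (sqrt (\<gamma> (s + h) \<omega> - \<gamma> s \<omega>)) \<partial>M)
      = (\<integral>\<^sup>+x. ennreal (sqrt x) \<partial>distr M borel (\<lambda>\<omega>. \<gamma> (s + h) \<omega> - \<gamma> s \<omega>))"
    using assms by (subst nn_integral_distr) auto
  also have "\<dots> = (\<integral>\<^sup>+\<omega>. ennreal (sqrt (\<gamma> h \<omega> - \<gamma> 0 \<omega>)) \<partial>M)"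
    unfolding e using assms by (subst nn_integral_distr) auto
  finally show ?thesis .
qed

text \<open>The estimates on jumps concern the unit interval only. A grid step of [0, m + 1]
  consists of m + 1 steps of length 2^-n, and by stationarity each of these has the same expected
  square root e. Subadditivity reduces the sum to m + 1 copies of the one over the unit
  interval.\<close>

lemma dyadic_sum_nn_integral_le:
  "(\<integral>\<^sup>+\<omega>. ennreal (dyadic_sum (\<lambda>t. \<Gamma> t \<omega>) (real (Suc m)) n) \<partial>M) \<le> of_nat (Suc m) * layer_bound \<alpha> \<beta>"
proof -
  define h :: real where "h = 1 / 2^n"
  define e where "e = (\<integral>\<^sup>+\<omega>. ennreal (sqrt (\<gamma> h \<omega> - \<gamma> 0 \<omega>)) \<partial>M)"
  have [measurable]: "\<gamma> (real i * h) \<in> borel_measurable M" "\<Gamma> (real (Suc m) * (real i * h)) \<in> borel_measurable M" for i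
    by (auto simp: h_def intro!: measurable_\<gamma> measurable_time_changed)
  have "0 \<le> h" by (simp add: h_def)
  have sqrt_meas: "(\<lambda>\<omega>. ennreal (sqrt (\<gamma> (real (Suc i) * h) \<omega> - \<gamma> (real i * h) \<omega>))) \<in> borel_measurable M" for i
    by measurable
  have e_eq: "(\<integral>\<^sup>+\<omega>. ennreal (sqrt (\<gamma> (real (Suc i) * h) \<omega> - \<gamma> (real i * h) \<omega>)) \<partial>M) = e" for i
    using stationary_increment[of "real i * h" h] by (simp add: e_def h_def algebra_simps add_divide_distrib)
  have long: "(\<integral>\<^sup>+\<omega>. ennreal (sqrt (\<gamma> (real (Suc m) * (real (Suc i) * h)) \<omega> - \<gamma> (real (Suc m) * (real i * h)) \<omega>)) \<partial>M)
      \<le> of_nat (Suc m) * e" for i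
  proof -
    have "(\<integral>\<^sup>+\<omega>. ennreal (sqrt (\<gamma> (real (Suc m) * (real (Suc i) * h)) \<omega> - \<gamma> (real (Suc m) * (real i * h)) \<omega>)) \<partial>M)
        = (\<integral>\<^sup>+\<omega>. ennreal (sqrt (\<gamma> (real (Suc m) * h) \<omega> - \<gamma> 0 \<omega>)) \<partial>M)"
      using stationary_increment[of "real (Suc m) * (real i * h)" "real (Suc m) * h"]
      by (simp add: h_def algebra_simps add_divide_distrib)
    also have "\<dots> \<le> (\<integral>\<^sup>+\<omega>. (\<Sum>k<Suc m. ennreal (sqrt (\<gamma> (real (Suc k) * h) \<omega> - \<gamma> (real k * h) \<omega>))) \<partial>M)"
    proof (rule nn_integral_mono_AE)
      show "AE \<omega> in M. ennreal (sqrt (\<gamma> (real (Suc m) * h) \<omega> - \<gamma> 0 \<omega>))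
          \<le> (\<Sum>k<Suc m. ennreal (sqrt (\<gamma> (real (Suc k) * h) \<omega> - \<gamma> (real k * h) \<omega>)))"
        using AE_regular
      proof eventually_elim
        case (elim \<omega>)
        have p: "0 \<le> \<gamma> (real (Suc k) * h) \<omega> - \<gamma> (real k * h) \<omega>" for k
          using elim \<open>0 \<le> h\<close> by (simp add: regular_mono mult_right_mono)
        have "\<gamma> (real (Suc m) * h) \<omega> - \<gamma> 0 \<omega> = (\<Sum>k<Suc m. \<gamma> (real (Suc k) * h) \<omega> - \<gamma> (real k * h) \<omega>)"
          using sum_lessThan_telescope[of "\<lambda>k. \<gamma> (real k * h) \<omega>" "Suc m"] by simp
        then have "sqrt (\<gamma> (real (Suc m) * h) \<omega> - \<gamma> 0 \<omega>)
            \<le> (\<Sum>k<Suc m. sqrt (\<gamma> (real (Suc k) * h) \<omega> - \<gamma> (real k * h) \<omega>))"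
          using p by (simp only:) (rule sqrt_sum_le, auto)
        then show ?case
          using p by (subst sum_ennreal) (auto intro!: ennreal_leI)
      qed
    qed
    also have "\<dots> = of_nat (Suc m) * e"
      by (simp only: nn_integral_sum[OF sqrt_meas] e_eq sum_constant card_lessThan)
    finally show ?thesis .
  qed
  have "(\<integral>\<^sup>+\<omega>. ennreal (dyadic_sum (\<lambda>t. \<Gamma> t \<omega>) (real (Suc m)) n) \<partial>M)
      = (\<integral>\<^sup>+\<omega>. (\<Sum>i<2^n. ennreal \<bar>\<Gamma> (real (Suc m) * (real (Suc i) * h)) \<omega> - \<Gamma> (real (Suc m) * (real i * h)) \<omega>\<bar>) \<partial>M)"
    unfolding dyadic_sum_def by (intro nn_integral_cong) (simp add: h_def del: of_nat_Suc)
  also have "\<dots> = (\<Sum>i<2^n. \<integral>\<^sup>+\<omega>. ennreal \<bar>\<Gamma> (real (Suc m) * (real (Suc i) * h)) \<omega> - \<Gamma> (real (Suc m) * (real i * h)) \<omega>\<bar> \<partial>M)"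
    by (intro nn_integral_sum measurable_compose[OF _ measurable_ennreal] borel_measurable_abs borel_measurable_diff) measurable
  also have "\<dots> \<le> (\<Sum>i<2^n::nat. of_nat (Suc m) * e)"
  proof (intro sum_mono order.trans[OF increment_nn_integral_le long])
    fix i
    show "0 \<le> real (Suc m) * (real i * h)" using \<open>0 \<le> h\<close> by simp
    show "real (Suc m) * (real i * h) \<le> real (Suc m) * (real (Suc i) * h)"
      using \<open>0 \<le> h\<close> by (intro mult_left_mono mult_right_mono) auto
  qed
  also have "\<dots> = of_nat (Suc m) * (\<Sum>i<2^n::nat. e)"
    by (simp only: sum_distrib_left)
  \<comment> \<open>Stationarity in the reverse direction: the 2^n equal expectations are read as
    those of the consecutive increments on [0, 1].\<close>
  also have "(\<Sum>i<2^n::nat. e) = (\<integral>\<^sup>+\<omega>. (\<Sum>i<2^n. ennreal (sqrt (increment (\<lambda>t. \<gamma> t \<omega>) n i))) \<partial>M)"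
  proof -
    have "(\<integral>\<^sup>+\<omega>. (\<Sum>i<2^n. ennreal (sqrt (increment (\<lambda>t. \<gamma> t \<omega>) n i))) \<partial>M)
        = (\<integral>\<^sup>+\<omega>. (\<Sum>i<2^n. ennreal (sqrt (\<gamma> (real (Suc i) * h) \<omega> - \<gamma> (real i * h) \<omega>))) \<partial>M)"
      unfolding increment_def by (simp add: h_def del: of_nat_Suc)
    also have "\<dots> = (\<Sum>i<2^n::nat. e)"
      by (simp only: nn_integral_sum[OF sqrt_meas] e_eq)
    finally show ?thesis ..
  qed
  also have "of_nat (Suc m) * \<dots> \<le> of_nat (Suc m) * layer_bound \<alpha> \<beta>"
    by (intro mult_left_mono gamma_sum_sqrt_increments[OF subordinator]) simp
  finally show ?thesis .
qed

text \<open>Fatou's lemma turns the bound on the expectations into an almost surely finite liminf;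
  countably many horizons m share one null set.\<close>

lemma AE_bv_path: "AE \<omega> in M. bv_path (\<lambda>t. \<Gamma> t \<omega>)"
proof -
  have "AE \<omega> in M. liminf (\<lambda>n. ennreal (dyadic_sum (\<lambda>t. \<Gamma> t \<omega>) (real (Suc m)) n)) \<noteq> \<infinity>" for m
  proof (rule nn_integral_PInf_AE)
    have [measurable]: "(\<lambda>\<omega>. ennreal (dyadic_sum (\<lambda>t. \<Gamma> t \<omega>) (real (Suc m)) n)) \<in> borel_measurable M" for n
      unfolding dyadic_sum_def
      by (intro measurable_compose[OF _ measurable_ennreal] borel_measurable_sum borel_measurable_abs
          borel_measurable_diff measurable_time_changed) (auto simp del: of_nat_Suc)
    show "(\<lambda>\<omega>. liminf (\<lambda>n. ennreal (dyadic_sum (\<lambda>t. \<Gamma> t \<omega>) (real (Suc m)) n))) \<in> borel_measurable M"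
      by measurable
    have "(\<integral>\<^sup>+\<omega>. liminf (\<lambda>n. ennreal (dyadic_sum (\<lambda>t. \<Gamma> t \<omega>) (real (Suc m)) n)) \<partial>M)
        \<le> liminf (\<lambda>n. \<integral>\<^sup>+\<omega>. ennreal (dyadic_sum (\<lambda>t. \<Gamma> t \<omega>) (real (Suc m)) n) \<partial>M)"
      by (intro nn_integral_liminf) measurable
    also have "\<dots> \<le> of_nat (Suc m) * layer_bound \<alpha> \<beta>"
      by (intro Liminf_le always_eventually allI dyadic_sum_nn_integral_le) simp
    also have "\<dots> < \<infinity>"
      using layer_bound_finite[OF pos] by (simp add: ennreal_mult_less_top ennreal_of_nat_eq_real_of_nat del: of_nat_Suc)
    finally show "(\<integral>\<^sup>+\<omega>. liminf (\<lambda>n. ennreal (dyadic_sum (\<lambda>t. \<Gamma> t \<omega>) (real (Suc m)) n)) \<partial>M) \<noteq> \<infinity>"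
      by simp
  qed
  then have "AE \<omega> in M. \<forall>m. liminf (\<lambda>n. ennreal (dyadic_sum (\<lambda>t. \<Gamma> t \<omega>) (real (Suc m)) n)) \<noteq> \<infinity>"
    by (simp add: AE_all_countable del: of_nat_Suc)
  with AE_regular show ?thesis
  proof eventually_elim
    case (elim \<omega>)
    show ?case
      using elim regular_right_cont(2)[OF elim(1)] by (intro bv_pathI) (auto simp: less_top simp del: of_nat_Suc)
  qed
qed

end

section \<open>Adaptedness\<close>

lemma left_lim_compose:
  assumes "\<exists>l. (f \<longlongrightarrow> l) (at_left t)" "continuous_on UNIV \<phi>"
  shows "((\<lambda>s. \<phi> (f s)) \<longlongrightarrow> \<phi> (left_lim f t)) (at_left t)" "left_lim (\<lambda>s. \<phi> (f s)) t = \<phi> (left_lim f t)"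
proof -
  show "((\<lambda>s. \<phi> (f s)) \<longlongrightarrow> \<phi> (left_lim f t)) (at_left t)"
    using continuous_on_tendsto_compose[OF assms(2) left_lim_tendsto[OF assms(1)]] by simp
  then show "left_lim (\<lambda>s. \<phi> (f s)) t = \<phi> (left_lim f t)"
    by (rule left_lim_eq)
qed

context driven_equation
begin

text \<open>The next iterate is a limit of expressions in the drivers and the previous iterate at
  finitely many times up to t. This is how measurability passes from one iterate to the
  next.\<close>

lemma picard_Riemann:
  assumes "0 < t"
  shows "(\<lambda>k. x0 + (\<Sum>i<2^k. \<kappa> * (a - clamp x0 (pic n (t * real i / 2^k))) * (t * real (Suc i) / 2^k - t * real i / 2^k))
      + \<theta> * (g t - g 0)
      + \<sigma> * (\<Sum>i<2^k. sqrt (clamp x0 (pic n (t * real i / 2^k))) * (G (t * real (Suc i) / 2^k) - G (t * real i / 2^k))))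
    \<longlonglongrightarrow> pic (Suc n) t"
proof -
  have lim: "\<exists>l. (pic n \<longlongrightarrow> l) (at_left s)" if "s \<in> {0<..t}" for s
    using controlled_left_limit[OF controlled_picard[of t n]] that K_pos by auto
  define u where "u s = \<kappa> * (a - clamp x0 (pic n s))" for s
  define v where "v s = sqrt (clamp x0 (pic n s))" for s
  have cont: "continuous_on UNIV (\<lambda>y. \<kappa> * (a - clamp x0 y))" "continuous_on UNIV (\<lambda>y. sqrt (clamp x0 y))"
    by (intro continuous_intros continuous_clamp)+
  have u_lim: "\<exists>l. (u \<longlongrightarrow> l) (at_left s)" "left_lim u s = \<kappa> * (a - clamp x0 (left_lim (pic n) s))"
    and v_lim: "\<exists>l. (v \<longlongrightarrow> l) (at_left s)" "left_lim v s = sqrt (clamp x0 (left_lim (pic n) s))" if "s \<in> {0<..t}" for s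
    using left_lim_compose[OF lim[OF that] cont(1)] left_lim_compose[OF lim[OF that] cont(2)]
    unfolding u_def[abs_def] v_def[abs_def] by auto
  have cb: "\<bar>clamp x0 y\<bar> \<le> 3 * x0 / 2" for y
    using clamp_bounds[of x0 y] params by auto
  have u_bound: "\<bar>u s\<bar> \<le> \<kappa> * (a + 3 * x0 / 2)" for s
    using cb[of "pic n s"] params unfolding u_def by (simp add: abs_mult)
  have v_bound: "\<bar>v s\<bar> \<le> sqrt (3 * x0 / 2)" for s
    using clamp_bounds[of x0 "pic n s"] params unfolding v_def by auto
  \<comment> \<open>The drift is the Stieltjes integral against the identity, so the same
    convergence result covers it.\<close>
  have "(\<lambda>k. \<Sum>i<2^k. u (t * real i / 2^k) * (t * real (Suc i) / 2^k - t * real i / 2^k))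
      \<longlonglongrightarrow> (LINT s:{0<..t}|interval_measure (\<lambda>x. x). left_lim u s)"
    by (rule Riemann_sum_tendsto[OF u_lim(1) assms u_bound]) auto
  also have "(LINT s:{0<..t}|interval_measure (\<lambda>x. x). left_lim u s)
      = (LBINT s:{0<..t}. \<kappa> * (a - clamp x0 (left_lim (pic n) s)))"
    unfolding lborel_eq_real[symmetric] using u_lim(2) by (intro set_lebesgue_integral_cong) auto
  finally have 1: "(\<lambda>k. \<Sum>i<2^k. u (t * real i / 2^k) * (t * real (Suc i) / 2^k - t * real i / 2^k))
      \<longlonglongrightarrow> (LBINT s:{0<..t}. \<kappa> * (a - clamp x0 (left_lim (pic n) s)))" .
  have "(\<lambda>k. \<Sum>i<2^k. v (t * real i / 2^k) * (G (t * real (Suc i) / 2^k) - G (t * real i / 2^k)))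
      \<longlonglongrightarrow> stieltjes_integral (left_lim v) G t"
    by (rule Riemann_Stieltjes_sum_tendsto[OF v_lim(1) assms v_bound])
  also have "stieltjes_integral (left_lim v) G t = stieltjes_integral (\<lambda>s. sqrt (clamp x0 (left_lim (pic n) s))) G t"
    by (intro stieltjes_integral_cong v_lim(2))
  finally show ?thesis
    unfolding picard.simps rhs_Ioc u_def[symmetric] v_def[symmetric] using 1
    by (intro tendsto_add tendsto_mult tendsto_const)
qed

end

section \<open>Measurability with respect to the drivers up to time t\<close>

locale gamma_driven_equation = gamma_time_change M \<Sigma> W \<gamma> \<alpha> \<beta> j
  for M :: "'a measure" and \<Sigma> :: "real^'n^'n" and W :: "real \<Rightarrow> 'a \<Rightarrow> real^'n"
    and \<gamma> :: "real \<Rightarrow> 'a \<Rightarrow> real" and \<alpha> \<beta> :: real and j :: 'n +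
  fixes F :: "ennreal \<Rightarrow> 'a measure" and \<kappa> a \<theta> \<sigma> x0 :: real
  assumes filtered: "complete_filtered_prob_space M F"
    and adapted: "adapted F \<gamma>" "adapted F (time_changed W \<gamma> j)"
    and params: "0 < \<kappa>" "0 < a" "0 \<le> \<theta>" "0 < \<sigma>" "0 < x0"
begin

definition good :: "'a \<Rightarrow> bool" where
  "good \<omega> \<longleftrightarrow> regular \<omega> \<and> bv_path (\<lambda>t. \<Gamma> t \<omega>)"

lemma AE_good: "AE \<omega> in M. good \<omega>"
  using AE_regular AE_bv_path by eventually_elim (simp add: good_def)

lemma good_driven_equation: "good \<omega> \<Longrightarrow> driven_equation (\<lambda>t. \<Gamma> t \<omega>) (\<lambda>t. \<gamma> t \<omega>) \<kappa> a \<theta> \<sigma> x0"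
  unfolding good_def driven_equation_def driven_equation_axioms_def
  using regular_right_cont(1) params by (auto simp: regular_def)

abbreviation "path_picard \<omega> \<equiv> picard \<kappa> a \<theta> \<sigma> x0 (\<lambda>t. \<gamma> t \<omega>) (\<lambda>t. \<Gamma> t \<omega>)"
abbreviation "path_clock \<omega> \<equiv> clock (\<lambda>t. \<gamma> t \<omega>) (\<lambda>t. \<Gamma> t \<omega>)"
abbreviation "thr \<equiv> threshold \<kappa> a \<theta> \<sigma> x0"

text \<open>What the measurability proofs ask of a \<sigma>-algebra at time t. Both \<open>F\<close>
  (for the stopping time) and the usual augmentation (for the solution) satisfy it, so each proof is
  done once.\<close>

definition observes :: "'a measure \<Rightarrow> real \<Rightarrow> bool" where
  "observes N t \<longleftrightarrow> space N = space M \<and> null_sets M \<subseteq> sets N \<and>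
    (\<forall>s. 0 \<le> s \<longrightarrow> s \<le> t \<longrightarrow> \<gamma> s \<in> borel_measurable N \<and> \<Gamma> s \<in> borel_measurable N)"

lemma observesD:
  assumes "observes N t"
  shows "0 \<le> s \<Longrightarrow> s \<le> t \<Longrightarrow> \<gamma> s \<in> borel_measurable N"
    and "0 \<le> s \<Longrightarrow> s \<le> t \<Longrightarrow> \<Gamma> s \<in> borel_measurable N"
    and "Measurable.pred N good"
proof -
  show "0 \<le> s \<Longrightarrow> s \<le> t \<Longrightarrow> \<gamma> s \<in> borel_measurable N" "0 \<le> s \<Longrightarrow> s \<le> t \<Longrightarrow> \<Gamma> s \<in> borel_measurable N"
    using assms by (auto simp: observes_def)
  have "complete_measure M" using filtered by (simp add: complete_filtered_prob_space_def)
  \<comment> \<open>\<open>good\<close> speaks of uncountably many times; completeness turns its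
    almost sure validity into a measurable null set of exceptions.\<close>
  then have "{\<omega>\<in>space N. \<not> good \<omega>} \<in> sets N"
    using complete_measure.AE_iff_null_sets[of M good] AE_good assms by (auto simp: observes_def)
  then have "space N - {\<omega>\<in>space N. \<not> good \<omega>} \<in> sets N"
    by (rule sets.compl_sets)
  moreover have "space N - {\<omega>\<in>space N. \<not> good \<omega>} = {\<omega>\<in>space N. good \<omega>}" by auto
  ultimately show "Measurable.pred N good" by (simp add: pred_def)
qed

lemma grid_le:
  assumes "0 \<le> (t::real)" "i < 2^k"
  shows "0 \<le> t * real i / 2^k" "t * real i / 2^k \<le> t" "0 \<le> t * real (Suc i) / 2^k" "t * real (Suc i) / 2^k \<le> t"
proof -
  have "real (Suc i) \<le> 2^k" using assms(2) by (metis Suc_leI of_nat_le_iff of_nat_numeral of_nat_power)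
  moreover from this have "real i \<le> 2^k" by linarith
  ultimately have "t * real (Suc i) \<le> t * 2^k" "t * real i \<le> t * 2^k"
    using mult_left_mono[OF _ assms(1)] by blast+
  then show "0 \<le> t * real i / 2^k" "t * real i / 2^k \<le> t" "0 \<le> t * real (Suc i) / 2^k" "t * real (Suc i) / 2^k \<le> t"
    using assms(1) by (auto simp: divide_le_eq)
qed

text \<open>Induction on n through Riemann sums over [0, s], which see the drivers and the previous
  iterate at no later time. Outside \<open>good\<close>, where these sums need not converge, the
  constant x0 is substituted.\<close>

lemma measurable_picard:
  assumes obs: "observes N t"
  shows "0 \<le> s \<Longrightarrow> s \<le> t \<Longrightarrow> (\<lambda>\<omega>. if good \<omega> then path_picard \<omega> n s else x0) \<in> borel_measurable N"
proof (induction n arbitrary: s)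
  case 0
  show ?case unfolding picard.simps if_cancel by (rule borel_measurable_const)
next
  case (Suc n)
  note [measurable] = observesD(3)[OF obs]
  show ?case
  proof (cases "s = 0")
    case True
    have e: "path_picard \<omega> (Suc n) 0 = x0" for \<omega>
      by (simp add: rhs_0)
    show ?thesis unfolding True e by simp
  next
    case False
    then have "0 < s" using Suc by simp
    define Y where "Y r \<omega> = (if good \<omega> then path_picard \<omega> n r else x0)" for r \<omega>
    define R where "R k \<omega> = x0
      + (\<Sum>i<2^k. \<kappa> * (a - clamp x0 (Y (s * real i / 2^k) \<omega>)) * (s * real (Suc i) / 2^k - s * real i / 2^k))
      + \<theta> * (\<gamma> s \<omega> - \<gamma> 0 \<omega>)
      + \<sigma> * (\<Sum>i<2^k. sqrt (clamp x0 (Y (s * real i / 2^k) \<omega>)) * (\<Gamma> (s * real (Suc i) / 2^k) \<omega> - \<Gamma> (s * real i / 2^k) \<omega>))"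
      for k \<omega>
    have Y_meas: "Y (s * real i / 2^k) \<in> borel_measurable N" if "i < 2^k" for i k
      unfolding Y_def using grid_le[OF Suc.prems(1) that] Suc by (intro Suc.IH) auto
    have clamp_meas: "(\<lambda>\<omega>. clamp x0 (Y (s * real i / 2^k) \<omega>)) \<in> borel_measurable N" if "i < 2^k" for i k
      using measurable_compose[OF Y_meas[OF that] measurable_clamp] .
    have sqrt_meas: "(\<lambda>\<omega>. sqrt (clamp x0 (Y (s * real i / 2^k) \<omega>))) \<in> borel_measurable N" if "i < 2^k" for i k
      using clamp_meas[OF that] by measurable
    have \<Gamma>_meas: "(\<lambda>\<omega>. \<Gamma> (s * real (Suc i) / 2^k) \<omega> - \<Gamma> (s * real i / 2^k) \<omega>) \<in> borel_measurable N"
      if "i < 2^k" for i k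
      using grid_le[OF Suc.prems(1) that] Suc.prems
      by (intro borel_measurable_diff observesD(2)[OF obs]; linarith)
    have \<gamma>_meas: "\<gamma> s \<in> borel_measurable N" "\<gamma> 0 \<in> borel_measurable N"
      using Suc.prems by (auto intro!: observesD(1)[OF obs])
    have R_meas: "R k \<in> borel_measurable N" for k
      unfolding R_def
      by (intro borel_measurable_add borel_measurable_times borel_measurable_sum \<Gamma>_meas borel_measurable_diff
          borel_measurable_const sqrt_meas clamp_meas \<gamma>_meas) auto
    show ?thesis
    proof (rule borel_measurable_LIMSEQ_real)
      show "(\<lambda>\<omega>. if good \<omega> then R k \<omega> else x0) \<in> borel_measurable N" for k
        using R_meas[of k] by measurable
      fix \<omega>
      show "(\<lambda>k. if good \<omega> then R k \<omega> else x0) \<longlonglongrightarrow> (if good \<omega> then path_picard \<omega> (Suc n) s else x0)"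
        using driven_equation.picard_Riemann[OF good_driven_equation \<open>0 < s\<close>, of \<omega> n]
        by (auto simp: R_def Y_def simp del: of_nat_Suc picard.simps)
    qed
  qed
qed

text \<open>The variation up to t is a limit of dyadic sums, which involve the driver at grid times
  in [0, t] only.\<close>

lemma measurable_clock:
  assumes obs: "observes N t" and "0 \<le> t"
  shows "(\<lambda>\<omega>. if good \<omega> then path_clock \<omega> t else 0) \<in> borel_measurable N"
proof (cases "t = 0")
  case True
  then show ?thesis
    using driven_equation.clock_0[OF good_driven_equation] by (simp cong: if_cong)
next
  case False
  then have "0 < t" using assms by simp
  note [measurable] = observesD(3)[OF obs]
  have \<gamma>_meas [measurable]: "\<gamma> t \<in> borel_measurable N" "\<gamma> 0 \<in> borel_measurable N"
    using assms by (auto intro!: observesD(1)[OF obs])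
  have [measurable]: "(\<lambda>\<omega>. dyadic_sum (\<lambda>s. \<Gamma> s \<omega>) t n) \<in> borel_measurable N" for n
    unfolding dyadic_sum_def using grid_le[OF \<open>0 \<le> t\<close>]
    by (intro borel_measurable_sum borel_measurable_abs borel_measurable_diff observesD(2)[OF obs]) auto
  show ?thesis
  proof (rule borel_measurable_LIMSEQ_real)
    show "(\<lambda>\<omega>. if good \<omega> then t + (\<gamma> t \<omega> - \<gamma> 0 \<omega>) + dyadic_sum (\<lambda>s. \<Gamma> s \<omega>) t n else 0) \<in> borel_measurable N" for n
      by measurable
    fix \<omega>
    show "(\<lambda>n. if good \<omega> then t + (\<gamma> t \<omega> - \<gamma> 0 \<omega>) + dyadic_sum (\<lambda>s. \<Gamma> s \<omega>) t n else 0)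
        \<longlonglongrightarrow> (if good \<omega> then path_clock \<omega> t else 0)"
      using bv_path.dyadic_sum_tendsto_total_variation[of "\<lambda>s. \<Gamma> s \<omega>" t] \<open>0 < t\<close>
      by (auto simp: good_def clock_def intro!: tendsto_intros)
  qed
qed

lemma observes_F:
  assumes "0 \<le> t"
  shows "observes (F (ennreal t)) t"
proof -
  have filt: "filtration (space M) F" and sub: "\<And>t. subalgebra M (F t)" and null: "null_sets M \<subseteq> sets (F 0)"
    using filtered by (auto simp: complete_filtered_prob_space_def)
  have mono: "sets (F s) \<subseteq> sets (F t)" if "s \<le> t" for s t
    using filt that by (simp add: filtration_def)
  have sp: "space (F t) = space M" for t
    using sub[of t] by (simp add: subalgebra_def)
  have up: "f \<in> borel_measurable (F (ennreal t))" if "f \<in> borel_measurable (F (ennreal s))" "s \<le> t"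
    for f :: "'a \<Rightarrow> real" and s
  proof (rule measurable_from_subalg[OF _ that(1)])
    show "subalgebra (F (ennreal t)) (F (ennreal s))"
      using mono[of "ennreal s" "ennreal t"] that(2) by (simp add: subalgebra_def sp ennreal_leI)
  qed
  have "\<gamma> s \<in> borel_measurable (F (ennreal t))" "\<Gamma> s \<in> borel_measurable (F (ennreal t))" if "0 \<le> s" "s \<le> t" for s
    using adapted that by (auto simp: adapted_def intro!: up)
  then show ?thesis
    using sp null mono[of 0 "ennreal t"] by (auto simp: observes_def)
qed

text \<open>An event observed up to s, with s at most t, lies in every \<sigma>-algebra of the
  intersection. The bounds by \<open>Pow\<close> come first because \<open>sigma\<close> has the
  intended sets only when its generator consists of subsets of the space.\<close>

lemma observes_usual_augmentation:
  assumes "0 \<le> t"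
  shows "observes (usual_augmentation M (\<lambda>s \<omega>. (\<gamma> s \<omega>, \<Gamma> s \<omega>)) t) t"
proof -
  let ?Z = "\<lambda>s \<omega>. (\<gamma> s \<omega>, \<Gamma> s \<omega>)"
  let ?G = "\<lambda>u. generated_by M {0..u} ?Z \<union> null_sets M"
  let ?I = "\<Inter>u\<in>{t<..}. sigma_sets (space M) (?G u)"
  have gen_Pow: "generated_by M {0..u} ?Z \<subseteq> Pow (space M)" for u
    unfolding generated_by_def by (rule subsetI, rule PowI, erule sigma_sets_into_sp[rotated]) auto
  then have "?G u \<subseteq> Pow (space M)" for u
    using sets.sets_into_space[of _ M] by (auto simp: null_sets_def)
  then have "sigma_sets (space M) (?G u) \<subseteq> Pow (space M)" for u
    using sigma_sets_into_sp by (metis PowI subsetI)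
  then have I_Pow: "?I \<subseteq> Pow (space M)"
    by (intro INF_lower2[of "t + 1"]) auto
  have sp: "space (usual_augmentation M ?Z t) = space M"
    by (simp add: usual_augmentation_def space_measure_of_conv)
  have I_sets: "?I \<subseteq> sets (usual_augmentation M ?Z t)"
    unfolding usual_augmentation_def using I_Pow by (simp add: sets_measure_of sigma_sets_superset_generator)
  have Z: "?Z s \<in> borel_measurable (usual_augmentation M ?Z t)" if "0 \<le> s" "s \<le> t" for s
  proof (rule measurableI)
    fix B :: "(real \<times> real) set" assume B: "B \<in> sets borel"
    have "?Z s -` B \<inter> space M \<in> generated_by M {0..u} ?Z" if "t < u" for u
      unfolding generated_by_def using B that \<open>0 \<le> s\<close> \<open>s \<le> t\<close>
      by (intro sigma_sets.Basic CollectI exI[of _ s] exI[of _ B]) auto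
    then have "?Z s -` B \<inter> space M \<in> ?I"
      by (auto intro: sigma_sets.Basic)
    then show "?Z s -` B \<inter> space (usual_augmentation M ?Z t) \<in> sets (usual_augmentation M ?Z t)"
      using I_sets by (auto simp: sp)
  qed simp
  have "null_sets M \<subseteq> sets (usual_augmentation M ?Z t)"
    using I_sets by (force intro: sigma_sets.Basic)
  moreover have "\<gamma> s \<in> borel_measurable (usual_augmentation M ?Z t)" "\<Gamma> s \<in> borel_measurable (usual_augmentation M ?Z t)"
    if "0 \<le> s" "s \<le> t" for s
  proof -
    have "(fst :: real \<times> real \<Rightarrow> real) \<in> borel_measurable borel" "(snd :: real \<times> real \<Rightarrow> real) \<in> borel_measurable borel"
      by (intro borel_measurable_continuous_onI continuous_intros)+
    from this[THEN measurable_compose[OF Z[OF that]]]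
    show "\<gamma> s \<in> borel_measurable (usual_augmentation M ?Z t)" "\<Gamma> s \<in> borel_measurable (usual_augmentation M ?Z t)"
      by (simp_all only: fst_conv snd_conv)
  qed
  ultimately show ?thesis
    by (auto simp: observes_def sp)
qed

section \<open>The stopping time and the solution\<close>

definition \<tau> :: "'a \<Rightarrow> ennreal" where
  "\<tau> \<omega> = (if good \<omega> then Inf {ennreal s |s. 0 \<le> s \<and> thr \<le> path_clock \<omega> s} else \<infinity>)"

text \<open>On exceptional paths the constant x0 is used: cadlag paths and nonnegativity are
  demanded for every \<omega>, not merely almost every one.\<close>

definition X :: "real \<Rightarrow> 'a \<Rightarrow> real" where
  "X t \<omega> = (if good \<omega> then lim (\<lambda>n. path_picard \<omega> n t) else x0)"

lemma \<tau>_le_iff: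
  assumes "0 \<le> t"
  shows "\<tau> \<omega> \<le> ennreal t \<longleftrightarrow> good \<omega> \<and> thr \<le> path_clock \<omega> t"
proof (cases "good \<omega>")
  case True
  then interpret driven_equation "\<lambda>t. \<Gamma> t \<omega>" "\<lambda>t. \<gamma> t \<omega>" \<kappa> a \<theta> \<sigma> x0
    by (rule good_driven_equation)
  let ?S = "{ennreal s |s. 0 \<le> s \<and> thr \<le> path_clock \<omega> s}"
  have "thr \<le> path_clock \<omega> t" if "Inf ?S \<le> ennreal t"
  proof (rule ccontr)
    assume "\<not> thr \<le> path_clock \<omega> t"
    then have "\<forall>\<^sub>F s in at_right t. path_clock \<omega> s < thr"
      using order_tendstoD(2)[OF right_cont_clock[OF assms]] by simp
    moreover have "\<forall>\<^sub>F s in at_right t. t < s" by (rule eventually_at_right_less)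
    ultimately have "\<forall>\<^sub>F s in at_right t. t < s \<and> path_clock \<omega> s < thr"
      by eventually_elim simp
    then obtain v where v: "t < v" "path_clock \<omega> v < thr"
      using eventually_happens'[OF trivial_limit_at_right_real] by blast
    \<comment> \<open>The clock is still below the threshold at the later time \<open>v\<close>; by
      monotonicity every crossing time is at least \<open>v\<close>, which keeps the infimum away
      from t.\<close>
    have "ennreal v \<le> Inf ?S"
    proof (rule Inf_greatest)
      fix e assume "e \<in> ?S"
      then obtain s where s: "e = ennreal s" "0 \<le> s" "thr \<le> path_clock \<omega> s" by auto
      then have "v \<le> s"
        using v(2) clock_mono[of s v] by (meson less_le_not_le nle_le order.trans)
      then show "ennreal v \<le> e" using s by (simp add: ennreal_leI)
    qed
    also have "\<dots> \<le> ennreal t" by (rule that)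
    finally show False using v assms by (simp add: ennreal_le_iff)
  qed
  then show ?thesis
    using True assms by (auto simp: \<tau>_def intro!: Inf_lower)
qed (simp add: \<tau>_def top_unique)

lemma stopping_time_\<tau>: "stopping_time F \<tau>"
proof
  fix t :: ennreal
  show "Measurable.pred (F t) (\<lambda>\<omega>. \<tau> \<omega> \<le> t)"
  proof (cases t)
    case (real r)
    have [measurable]: "Measurable.pred (F t) good" "(\<lambda>\<omega>. if good \<omega> then path_clock \<omega> r else 0) \<in> borel_measurable (F t)"
      using observesD(3)[OF observes_F] measurable_clock[OF observes_F] real by auto
    have "(\<lambda>\<omega>. \<tau> \<omega> \<le> t) = (\<lambda>\<omega>. good \<omega> \<and> thr \<le> (if good \<omega> then path_clock \<omega> r else 0))"
      using \<tau>_le_iff[of r] real by (auto simp: fun_eq_iff)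
    then show ?thesis by simp
  qed simp
qed

lemma good_solution:
  assumes "good \<omega>"
  shows "cadlag_until (\<tau> \<omega>) (\<lambda>t. X t \<omega>)"
    and "solves_until \<kappa> a \<theta> \<sigma> x0 (\<lambda>t. \<gamma> t \<omega>) (\<lambda>t. \<Gamma> t \<omega>) (\<tau> \<omega>) (\<lambda>t. X t \<omega>)"
    and "\<And>t. 0 \<le> t \<Longrightarrow> ennreal t < \<tau> \<omega> \<Longrightarrow> x0 / 2 \<le> X t \<omega> \<and> X t \<omega> \<le> 3 * x0 / 2"
    and "0 < \<tau> \<omega>"
proof -
  interpret driven_equation "\<lambda>t. \<Gamma> t \<omega>" "\<lambda>t. \<gamma> t \<omega>" \<kappa> a \<theta> \<sigma> x0
    using assms by (rule good_driven_equation)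
  have X: "(\<lambda>t. X t \<omega>) = sol"
    using assms by (simp add: X_def sol_def fun_eq_iff)
  have T: "path_clock \<omega> t < thr" if "0 \<le> t" "ennreal t < \<tau> \<omega>" for t
    using \<tau>_le_iff[OF that(1), of \<omega>] that(2) assms by (simp add: not_le[symmetric])
  show "cadlag_until (\<tau> \<omega>) (\<lambda>t. X t \<omega>)"
    "solves_until \<kappa> a \<theta> \<sigma> x0 (\<lambda>t. \<gamma> t \<omega>) (\<lambda>t. \<Gamma> t \<omega>) (\<tau> \<omega>) (\<lambda>t. X t \<omega>)"
    unfolding X using sol_until(1,2)[OF T] by auto
  show "x0 / 2 \<le> X t \<omega> \<and> X t \<omega> \<le> 3 * x0 / 2" if "0 \<le> t" "ennreal t < \<tau> \<omega>" for t
    using sol_until(3)[OF T that] X by (metis)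
  have "\<not> \<tau> \<omega> \<le> ennreal 0"
    using threshold_pos clock_0 by (subst \<tau>_le_iff) auto
  then show "0 < \<tau> \<omega>" by (simp add: zero_less_iff_neq_zero)
qed

lemma strong_solution_X: "strong_solution M F \<kappa> a \<theta> \<sigma> x0 \<gamma> \<Gamma> \<tau> X"
  unfolding strong_solution_def
proof (intro conjI ballI allI impI)
  show "stopping_time F \<tau>" by (rule stopping_time_\<tau>)
  show "AE \<omega> in M. 0 < \<tau> \<omega>"
    using AE_good by eventually_elim (rule good_solution)
  show "AE \<omega> in M. solves_until \<kappa> a \<theta> \<sigma> x0 (\<lambda>t. \<gamma> t \<omega>) (\<lambda>t. \<Gamma> t \<omega>) (\<tau> \<omega>) (\<lambda>t. X t \<omega>)"
    using AE_good by eventually_elim (rule good_solution)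
  fix \<omega>
  show "cadlag_until (\<tau> \<omega>) (\<lambda>t. X t \<omega>)"
  proof (cases "good \<omega>")
    case False
    then show ?thesis by (auto simp: X_def cadlag_until_def)
  qed (rule good_solution)
next
  fix t :: real assume "0 \<le> t"
  let ?N = "usual_augmentation M (\<lambda>s \<omega>. (\<gamma> s \<omega>, \<Gamma> s \<omega>)) t"
  \<comment> \<open>The limit is moved outside the case distinction, so that X t is a limit of
    functions already known to be measurable; off \<open>good\<close> the sequence is
    constant.\<close>
  have "X t = (\<lambda>\<omega>. lim (\<lambda>n. if good \<omega> then path_picard \<omega> n t else x0))"
    by (auto simp: X_def fun_eq_iff)
  then have "X t \<in> borel_measurable ?N"
    using measurable_picard[OF observes_usual_augmentation[OF \<open>0 \<le> t\<close>] \<open>0 \<le> t\<close> order_refl]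
    by (simp only:) (rule borel_measurable_lim_metric)
  then show "X t \<in> borel_measurable (restrict_space ?N {\<omega> \<in> space M. ennreal t < \<tau> \<omega>})"
    by (rule measurable_restrict_space1)
qed

lemma nonnegative_X: "nonnegative_until M \<tau> X"
  unfolding nonnegative_until_def
proof (intro ballI allI impI)
  fix \<omega> t assume "0 \<le> t" "ennreal t < \<tau> \<omega>"
  then show "0 \<le> X t \<omega>"
    using good_solution(3)[of \<omega> t] params by (cases "good \<omega>") (auto simp: X_def)
qed

lemma pathwise_unique_X: "pathwise_unique M F \<kappa> a \<theta> \<sigma> x0 \<gamma> \<Gamma> \<tau> X"
  unfolding pathwise_unique_def
proof (intro allI impI)
  fix \<tau>' X'
  assume sol': "strong_solution M F \<kappa> a \<theta> \<sigma> x0 \<gamma> \<Gamma> \<tau>' X'"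
  then have ae: "AE \<omega> in M. solves_until \<kappa> a \<theta> \<sigma> x0 (\<lambda>t. \<gamma> t \<omega>) (\<lambda>t. \<Gamma> t \<omega>) (\<tau>' \<omega>) (\<lambda>t. X' t \<omega>)"
    and cadlag': "\<And>\<omega>. \<omega> \<in> space M \<Longrightarrow> cadlag_until (\<tau>' \<omega>) (\<lambda>t. X' t \<omega>)"
    by (auto simp: strong_solution_def)
  from AE_good AE_space ae show "AE \<omega> in M. \<forall>t\<ge>0. ennreal t < min (\<tau> \<omega>) (\<tau>' \<omega>) \<longrightarrow> X' t \<omega> = X t \<omega>"
  proof eventually_elim
    case (elim \<omega>)
    interpret driven_equation "\<lambda>t. \<Gamma> t \<omega>" "\<lambda>t. \<gamma> t \<omega>" \<kappa> a \<theta> \<sigma> x0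
      using elim(1) by (rule good_driven_equation)
    show ?case
      using solution_unique[OF good_solution(2,1)[OF elim(1)] elim(3) cadlag'[OF elim(2)], of "x0/2" "3 * x0/2"]
        good_solution(3)[OF elim(1)] params by simp
  qed
qed

lemma ex_solution:
  "\<exists>\<tau> X. stopping_time F \<tau> \<and> strong_solution M F \<kappa> a \<theta> \<sigma> x0 \<gamma> \<Gamma> \<tau> X \<and> nonnegative_until M \<tau> X \<and>
    pathwise_unique M F \<kappa> a \<theta> \<sigma> x0 \<gamma> \<Gamma> \<tau> X"
  using stopping_time_\<tau> strong_solution_X nonnegative_X pathwise_unique_X by blast

end

theorem theorem3p2:
  fixes M :: "'a measure" and F :: "ennreal \<Rightarrow> 'a measure"
    and \<Sigma> :: "real^4^4" and W :: "real \<Rightarrow> 'a \<Rightarrow> real^4" and \<gamma> :: "real \<Rightarrow> 'a \<Rightarrow> real"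
    and \<alpha> \<beta> \<kappa>\<^sub>v \<kappa>\<^sub>d a\<^sub>v a\<^sub>d \<sigma>\<^sub>v \<sigma>\<^sub>d \<theta>\<^sub>v \<theta>\<^sub>d V\<^sub>0 r\<^sub>0 :: real
  assumes "complete_filtered_prob_space M F"
    and "transpose \<Sigma> = \<Sigma>" and "\<forall>x. x \<noteq> 0 \<longrightarrow> 0 < x \<bullet> (\<Sigma> *v x)" and "\<forall>i. \<Sigma> $ i $ i = 1"
    and "brownian_motion M \<Sigma> W"
    and "\<alpha> > 0" and "\<beta> > 0" and "gamma_subordinator M \<alpha> \<beta> \<gamma>"
    and "prob_space.indep_set M (generated_by M {0..} W) (generated_by M {0..} \<gamma>)"
    and "adapted F \<gamma>" and "adapted F (time_changed W \<gamma> 2)" and "adapted F (time_changed W \<gamma> 3)"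
    and "\<kappa>\<^sub>v > 0" and "\<kappa>\<^sub>d > 0" and "a\<^sub>v > 0" and "a\<^sub>d > 0" and "\<sigma>\<^sub>v > 0" and "\<sigma>\<^sub>d > 0"
    and "\<theta>\<^sub>v \<ge> 0" and "\<theta>\<^sub>d \<ge> 0" and "V\<^sub>0 > 0" and "r\<^sub>0 > 0"
  shows "\<exists>\<tau>\<^sub>V \<tau>\<^sub>d. stopping_time F \<tau>\<^sub>V \<and> stopping_time F \<tau>\<^sub>d \<and>
    (\<exists>V. strong_solution M F \<kappa>\<^sub>v a\<^sub>v \<theta>\<^sub>v \<sigma>\<^sub>v V\<^sub>0 \<gamma> (time_changed W \<gamma> 2) \<tau>\<^sub>V V \<and>
         nonnegative_until M \<tau>\<^sub>V V \<and>
         pathwise_unique M F \<kappa>\<^sub>v a\<^sub>v \<theta>\<^sub>v \<sigma>\<^sub>v V\<^sub>0 \<gamma> (time_changed W \<gamma> 2) \<tau>\<^sub>V V) \<and>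
    (\<exists>r. strong_solution M F \<kappa>\<^sub>d a\<^sub>d \<theta>\<^sub>d \<sigma>\<^sub>d r\<^sub>0 \<gamma> (time_changed W \<gamma> 3) \<tau>\<^sub>d r \<and>
         nonnegative_until M \<tau>\<^sub>d r \<and>
         pathwise_unique M F \<kappa>\<^sub>d a\<^sub>d \<theta>\<^sub>d \<sigma>\<^sub>d r\<^sub>0 \<gamma> (time_changed W \<gamma> 3) \<tau>\<^sub>d r)"
proof -
  have prob: "prob_space M" and sub: "\<And>t. subalgebra M (F t)"
    using assms(1) by (auto simp: complete_filtered_prob_space_def)
  have equation: "gamma_driven_equation M \<Sigma> W \<gamma> \<alpha> \<beta> j F \<kappa> a \<theta> \<sigma> x0"
    if "adapted F (time_changed W \<gamma> j)" "0 < \<kappa>" "0 < a" "0 \<le> \<theta>" "0 < \<sigma>" "0 < x0" for j \<kappa> a \<theta> \<sigma> x0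
  proof -
    \<comment> \<open>Adaptedness to sub-\<sigma>-algebras of \<open>M\<close> yields the
      measurability that the Fatou arguments require.\<close>
    have "time_changed W \<gamma> j t \<in> borel_measurable M" if "0 \<le> t" for t
      using \<open>adapted F (time_changed W \<gamma> j)\<close> that sub
      by (auto simp: adapted_def intro: measurable_from_subalg)
    then show ?thesis
      using assms that prob
      by (auto simp: gamma_driven_equation_def gamma_time_change_def gamma_driven_equation_axioms_def
          gamma_time_change_axioms_def)
  qed
  show ?thesis
    using gamma_driven_equation.ex_solution[OF equation, of 2 \<kappa>\<^sub>v a\<^sub>v \<theta>\<^sub>v \<sigma>\<^sub>v V\<^sub>0]
      gamma_driven_equation.ex_solution[OF equation, of 3 \<kappa>\<^sub>d a\<^sub>d \<theta>\<^sub>d \<sigma>\<^sub>d r\<^sub>0] assms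
    by blast
qed

end
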